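(* The following problem is decidable. Input: a finite transducer $\mathcal R$ over alphabets $A,A$ realizing an equivalence relation $R$ on $A^*$. Question: does $R$ belong to $\mathbf{KerSeq}^{ll}$, i.e. does there exist a finite alphabet $B$ and a letter-to-letter sequential transducer over $A,B$ realizing a total function $f:A^*\to B^*$ such that for all $u,v\in A^*$, $uRv \Leftrightarrow f(u)=f(v)$?
   Context: Alphabets are finite. A finite transducer over alphabets $A,B$ is a tuple $(Q,\Delta,I,F)$ with $Q$ a finite set of states, $\Delta$ a finite set of transitions $(p,(x,y),q)$ with $p,q\in Q$, $(x,y)\in A^*\times B^*$, and $I,F\subseteq Q$ the sets of initial and final states. It realizes the relation of all pairs $(u,v)\in A^*\times B^*$ such that some path from an initial state to a final state has $u$ as the concatenation of its first components and $v$ as the concatenation of its second components. The transducer is letter-to-letter if all its transition labels are in $A\times B$. It is real-time if all its transition labels are in $A\times B^*$. It is sequential if it is real-time and deterministic with respect to the input (one initial state, and for each state $p$ and letter $a\in A$ at most one transition from $p$ with input letter $a$). The kernel of a total function $f:A^*\to B^*$ is the equivalence relation $\{(u,v)\mid f(u)=f(v)\}$. $\mathbf{KerSeq}^{ll}$ is the class of equivalence relations that are kernels of total functions realized by letter-to-letter sequential transducers (Mealy machines). *)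

theory Defs
  imports Main "HOL-Library.Nat_Bijection"
begin

record ('q, 'a, 'b) transducer =
  states :: "'q set"
  transitions :: "('q \<times> ('a list \<times> 'b list) \<times> 'q) set"
  initials :: "'q set"
  finals :: "'q set"

definition finite_transducer :: "'a set \<Rightarrow> 'b set \<Rightarrow> ('q, 'a, 'b) transducer \<Rightarrow> bool" where
  "finite_transducer A B T \<longleftrightarrow>
     finite A \<and> finite B \<and> finite (states T) \<and> finite (transitions T) \<and>
     transitions T \<subseteq> states T \<times> (lists A \<times> lists B) \<times> states T \<and>
     initials T \<subseteq> states T \<and> finals T \<subseteq> states T"

inductive path :: "('q, 'a, 'b) transducer \<Rightarrow> 'q \<Rightarrow> 'a list \<Rightarrow> 'b list \<Rightarrow> 'q \<Rightarrow> bool"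
  for T :: "('q, 'a, 'b) transducer" where
  empty: "p \<in> states T \<Longrightarrow> path T p [] [] p"
| step: "(p, (x, y), q) \<in> transitions T \<Longrightarrow> path T q u v r \<Longrightarrow> path T p (x @ u) (y @ v) r"

definition realized_relation :: "('q, 'a, 'b) transducer \<Rightarrow> ('a list \<times> 'b list) set" where
  "realized_relation T = {(u, v). \<exists>p \<in> initials T. \<exists>q \<in> finals T. path T p u v q}"

text \<open>Letters are the words of length one.\<close>

definition letter_to_letter :: "('q, 'a, 'b) transducer \<Rightarrow> bool" where
  "letter_to_letter T \<longleftrightarrow> (\<forall>(p, (x, y), q) \<in> transitions T. length x = 1 \<and> length y = 1)"

definition real_time :: "('q, 'a, 'b) transducer \<Rightarrow> bool" where
  "real_time T \<longleftrightarrow> (\<forall>(p, (x, y), q) \<in> transitions T. length x = 1)"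

definition sequential :: "('q, 'a, 'b) transducer \<Rightarrow> bool" where
  "sequential T \<longleftrightarrow> real_time T \<and> (\<exists>q. initials T = {q}) \<and>
     (\<forall>p a y q y' q'. (p, ([a], y), q) \<in> transitions T \<and> (p, ([a], y'), q') \<in> transitions T
        \<longrightarrow> y = y' \<and> q = q')"

definition realizes_total_function ::
    "'a set \<Rightarrow> ('q, 'a, 'b) transducer \<Rightarrow> ('a list \<Rightarrow> 'b list) \<Rightarrow> bool" where
  "realizes_total_function A T f \<longleftrightarrow> realized_relation T = {(u, f u) | u. u \<in> lists A}"

definition kernel :: "'a set \<Rightarrow> ('a list \<Rightarrow> 'b list) \<Rightarrow> ('a list \<times> 'a list) set" where
  "kernel A f = {(u, v). u \<in> lists A \<and> v \<in> lists A \<and> f u = f v}"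

text \<open>
  The output alphabet and the state set are only existentially quantified and finite, so
  they may be taken to consist of natural numbers, whatever their nature.
\<close>

definition KerSeq_ll :: "'a set \<Rightarrow> ('a list \<times> 'a list) set set" where
  "KerSeq_ll A =
     {kernel A f | (f :: 'a list \<Rightarrow> nat list) (B :: nat set) (T :: (nat, 'a, nat) transducer).
        finite_transducer A B T \<and> letter_to_letter T \<and> sequential T \<and>
        realizes_total_function A T f}"

datatype recf =
    Zero
  | Succ
  | Proj nat
  | Comp recf "recf list"
  | PrimRec recf recf
  | Mu recf

text \<open>
  \<open>computes f xs y\<close>: the partial recursive function denoted by \<open>f\<close> is defined on the
  argument list \<open>xs\<close> and has value \<open>y\<close> there.  Recursion and minimization act on the
  first argument.
\<close>

inductive computes :: "recf \<Rightarrow> nat list \<Rightarrow> nat \<Rightarrow> bool" where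
  Zero: "computes Zero xs 0"
| Succ: "computes Succ [n] (Suc n)"
| Proj: "i < length xs \<Longrightarrow> computes (Proj i) xs (xs ! i)"
| Comp: "list_all2 (\<lambda>g z. computes g xs z) gs zs \<Longrightarrow> computes f zs y
    \<Longrightarrow> computes (Comp f gs) xs y"
| PrimRec_0: "computes f xs y \<Longrightarrow> computes (PrimRec f g) (0 # xs) y"
| PrimRec_Suc: "computes (PrimRec f g) (n # xs) r \<Longrightarrow> computes g (n # r # xs) y
    \<Longrightarrow> computes (PrimRec f g) (Suc n # xs) y"
| Mu: "computes f (n # xs) 0 \<Longrightarrow> (\<forall>m < n. \<exists>k. computes f (m # xs) (Suc k))
    \<Longrightarrow> computes (Mu f) xs n"

inductive_cases computes_ZeroE: "computes Zero xs y"
inductive_cases computes_SuccE: "computes Succ xs y"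
inductive_cases computes_ProjE: "computes (Proj i) xs y"
inductive_cases computes_CompE: "computes (Comp f gs) xs y"
inductive_cases computes_PrimRec_0E: "computes (PrimRec f g) (0 # xs) y"
inductive_cases computes_PrimRec_SucE: "computes (PrimRec f g) (Suc n # xs) y"
inductive_cases computes_MuE: "computes (Mu f) xs y"

lemma computes_deterministic: "computes f xs y \<Longrightarrow> computes f xs z \<Longrightarrow> y = z"
proof (induction arbitrary: z rule: computes.induct)
  case (Zero xs)
  then show ?case by (rule computes_ZeroE) simp
next
  case (Succ n)
  then show ?case by (rule computes_SuccE) simp
next
  case (Proj i xs)
  from Proj.prems show ?case by (rule computes_ProjE) simp
next
  case (Comp xs gs zs f y)
  from Comp.prems obtain zs' where
    zs': "list_all2 (\<lambda>g z. computes g xs z) gs zs'" "computes f zs' z"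
    by (rule computes_CompE)
  have "zs = zs'"
    using Comp.IH(1) zs'(1) by (auto simp: list_all2_conv_all_nth intro!: nth_equalityI)
  then show ?case
    using Comp.IH(2) zs'(2) by blast
next
  case (PrimRec_0 f xs y g)
  from PrimRec_0.prems show ?case by (rule computes_PrimRec_0E) (rule PrimRec_0.IH)
next
  case (PrimRec_Suc f g n xs r y)
  from PrimRec_Suc.prems obtain r' where
    "computes (PrimRec f g) (n # xs) r'" "computes g (n # r' # xs) z"
    by (rule computes_PrimRec_SucE)
  then show ?case using PrimRec_Suc.IH by blast
next
  case (Mu f n xs)
  from Mu.prems obtain
    z: "computes f (z # xs) 0" "\<forall>m < z. \<exists>k. computes f (m # xs) (Suc k)"
    by (rule computes_MuE)
  show ?case
  proof (rule linorder_cases[of n z])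
    assume "n < z"
    then obtain k where "computes f (n # xs) (Suc k)" using z(2) by blast
    then have "0 = Suc k" by (rule Mu.IH(1))
    then show ?thesis by simp
  next
    assume "z < n"
    then obtain k where "\<And>y. computes f (z # xs) y \<Longrightarrow> Suc k = y" using Mu.IH(2) by blast
    then have "Suc k = 0" using z(1) .
    then show ?thesis by simp
  qed
qed

text \<open>
  Decidability of a problem given by a set of instances: the algorithm has to halt, with the
  correct answer, on all instances; nothing is required on inputs that are not instances.
\<close>

definition decidable_problem :: "('x \<Rightarrow> nat) \<Rightarrow> 'x set \<Rightarrow> 'x set \<Rightarrow> bool" where
  "decidable_problem code Instances Yes \<longleftrightarrow>
     (\<exists>f. \<forall>x \<in> Instances. computes f [code x] (if x \<in> Yes then 1 else 0))"

fun transition_code :: "nat \<times> (nat list \<times> nat list) \<times> nat \<Rightarrow> nat" where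
  "transition_code (p, (x, y), q) = list_encode [p, list_encode x, list_encode y, q]"

text \<open>
  In inputs, letters and states are natural numbers, which loses no generality up to renaming.
  All component sets are finite, and on finite sets \<open>set_encode\<close> is injective.
\<close>

fun transducer_code :: "nat set \<times> (nat, nat, nat) transducer \<Rightarrow> nat" where
  "transducer_code (A, T) =
     list_encode [set_encode A, set_encode (states T), set_encode (transition_code ` transitions T),
       set_encode (initials T), set_encode (finals T)]"

lemma inj_transition_code: "inj transition_code"
  by (auto simp: inj_def list_encode_eq simp del: list_encode.simps)

lemma inj_on_transducer_code:
  "inj_on transducer_code {(A, T). finite_transducer A A T}"
proof (rule inj_onI, clarify)
  fix A A' :: "nat set" and T T' :: "(nat, nat, nat) transducer"
  assume T: "finite_transducer A A T" and T': "finite_transducer A' A' T'"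
    and eq: "transducer_code (A, T) = transducer_code (A', T')"
  have fin: "finite A" "finite (states T)" "finite (transitions T)" "finite (initials T)"
    "finite (finals T)"
    using T by (auto simp: finite_transducer_def intro: finite_subset)
  have fin': "finite A'" "finite (states T')" "finite (transitions T')" "finite (initials T')"
    "finite (finals T')"
    using T' by (auto simp: finite_transducer_def intro: finite_subset)
  from eq have "A = A' \<and> states T = states T'
      \<and> transition_code ` transitions T = transition_code ` transitions T'
      \<and> initials T = initials T' \<and> finals T = finals T'"
    using fin fin' by (simp add: list_encode_eq set_encode_eq del: list_encode.simps)
  then show "A = A' \<and> T = T'"
    by (auto simp: inj_image_eq_iff[OF inj_transition_code] intro!: transducer.equality)
qed

end

theory Submission
  imports Defs "HOL-Library.Ramsey"
begin

text \<open>
  Let \<open>R\<close> be an equivalence relation on words realized by a transducer, and write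
  \<open>u \<sim> v\<close> if \<open>ux R vx\<close> for all \<open>x\<close>.  Then \<open>R\<close> is the kernel of a Mealy machine iff it is
  length-preserving, prefix-closed, and the number of \<open>\<sim>\<close>-classes inside an \<open>R\<close>-class is
  bounded.  Indeed, \<open>R\<close>-equivalent words leading a Mealy machine to the same state are
  \<open>\<sim>\<close>-equivalent; conversely, with representatives \<open>w1, \<dots>, wk\<close> of the \<open>\<sim>\<close>-classes inside
  the current \<open>R\<close>-class, a machine can store the finitely many possible residuals
  \<open>{(x, y). wi x R wj y}\<close>, and output on a letter the first \<open>wj b\<close> in the new \<open>R\<close>-class.

  If the number of \<open>\<sim>\<close>-classes is unbounded, then Ramsey's theorem, applied to the runs of an
  automaton for the pairs \<open>u R v\<close> with \<open>v\<close> lexicographically least in its \<open>\<sim>\<close>-class, yields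
  words such that for every \<open>n\<close> the words \<open>z s1\<^sup>i s2 s3\<^sup>j t\<close> with \<open>i + j = n\<close> are pairwise
  \<open>R\<close>-equivalent but not \<open>\<sim>\<close>-equivalent.  For a length-preserving relation the delay between
  the two tapes of the transducer is bounded, hence so is the number of residuals, by a computable
  function of the transducer.  This bounds the words and exponents to be inspected, and the
  criterion is decided by exhaustive search.
\<close>

section \<open>Computable functions\<close>

text \<open>Pairwise inequivalence of many words is a property of pairs, and pumping the words might
  destroy it. Being the least word of a \<open>sim\<close>-class is a property of a single word: a
  finite automaton can check it, so it survives pumping, and two distinct least words of equal
  length are never \<open>sim\<close>-equivalent. Hence one automaton suffices, with many accepted
  second tapes over a common first tape, and the pumped words are \<open>R\<close>-related through
  that first tape.

  Whether a pattern is valid depends on its words only through their action on finitely many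
  residuals. The exponent 5 in the size bound counts the pairs of blocks read in parallel:
  \<open>(s1, s1)\<close>, \<open>(s2, s1)\<close>, \<open>(s3, s1)\<close>,
  \<open>(s3, s2)\<close>, \<open>(s3, s3)\<close>.

  The code of an instance exceeds or equals the number of its letters, states and transitions and
  the lengths of its labels. It therefore serves as the only parameter of all bounds, and no size
  has to be computed.\<close>

definition recn :: "nat \<Rightarrow> (nat list \<Rightarrow> nat) \<Rightarrow> bool" where
  "recn k F \<longleftrightarrow> (\<exists>g. \<forall>xs. length xs = k \<longrightarrow> computes g xs (F xs))"

lemma recn_cong: "(\<And>xs. length xs = k \<Longrightarrow> F xs = G xs) \<Longrightarrow> recn k F \<Longrightarrow> recn k G"
  unfolding recn_def by metis

lemma recn_proj: "i < k \<Longrightarrow> recn k (\<lambda>xs. xs ! i)"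
  unfolding recn_def using computes.Proj by blast

lemma recn_comp:
  assumes F: "recn (length Gs) F" and Gs: "\<And>G. G \<in> set Gs \<Longrightarrow> recn k G"
  shows "recn k (\<lambda>xs. F (map (\<lambda>G. G xs) Gs))"
proof -
  obtain f where f: "\<And>xs. length xs = length Gs \<Longrightarrow> computes f xs (F xs)"
    using F unfolding recn_def by blast
  have "\<forall>G\<in>set Gs. \<exists>g. \<forall>xs. length xs = k \<longrightarrow> computes g xs (G xs)"
    using Gs unfolding recn_def by blast
  then obtain c where c: "\<And>G xs. G \<in> set Gs \<Longrightarrow> length xs = k \<Longrightarrow> computes (c G) xs (G xs)"
    by metis
  have "computes (Comp f (map c Gs)) xs (F (map (\<lambda>G. G xs) Gs))" if "length xs = k" for xs
    by (rule computes.Comp[where zs = "map (\<lambda>G. G xs) Gs"])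
      (auto simp: list_all2_conv_all_nth that intro!: c f)
  then show ?thesis unfolding recn_def by blast
qed

lemma recn_comp1: "recn 1 (\<lambda>ys. f (ys ! 0)) \<Longrightarrow> recn k a \<Longrightarrow> recn k (\<lambda>xs. f (a xs))"
  using recn_comp[of "[a]" "\<lambda>ys. f (ys ! 0)" k] by simp

lemma recn_comp2:
  "recn 2 (\<lambda>ys. f (ys ! 0) (ys ! 1)) \<Longrightarrow> recn k a \<Longrightarrow> recn k b \<Longrightarrow> recn k (\<lambda>xs. f (a xs) (b xs))"
  using recn_comp[of "[a, b]" "\<lambda>ys. f (ys ! 0) (ys ! 1)" k] by (auto simp: numeral_2_eq_2)

lemma recn_comp3:
  assumes "recn 3 (\<lambda>ys. f (ys ! 0) (ys ! 1) (ys ! 2))" "recn k a" "recn k b" "recn k c"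
  shows "recn k (\<lambda>xs. f (a xs) (b xs) (c xs))"
  using recn_comp[of "[a, b, c]" "\<lambda>ys. f (ys ! 0) (ys ! 1) (ys ! 2)" k] assms
  by (auto simp: eval_nat_numeral)

lemma recn_prim:
  assumes "recn k F" "recn (Suc (Suc k)) G"
  shows "recn (Suc k) (\<lambda>xs. rec_nat (F (tl xs)) (\<lambda>n r. G (n # r # tl xs)) (hd xs))"
proof -
  obtain f g where f: "\<And>xs. length xs = k \<Longrightarrow> computes f xs (F xs)"
    and g: "\<And>xs. length xs = Suc (Suc k) \<Longrightarrow> computes g xs (G xs)"
    using assms unfolding recn_def by blast
  have "computes (PrimRec f g) (n # ys) (rec_nat (F ys) (\<lambda>n r. G (n # r # ys)) n)"
    if "length ys = k" for n ys
    by (induction n) (auto intro!: computes.PrimRec_0 computes.PrimRec_Suc f g simp: that)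
  then have "\<forall>xs. length xs = Suc k \<longrightarrow>
      computes (PrimRec f g) xs (rec_nat (F (tl xs)) (\<lambda>n r. G (n # r # tl xs)) (hd xs))"
    by (auto simp: length_Suc_conv)
  then show ?thesis unfolding recn_def by blast
qed

lemma recn_Suc: "recn k a \<Longrightarrow> recn k (\<lambda>xs. Suc (a xs))"
proof -
  have "recn 1 (\<lambda>ys. Suc (ys ! 0))"
    unfolding recn_def by (rule exI[of _ Succ]) (auto simp: length_Suc_conv intro: computes.Succ)
  then show "recn k a \<Longrightarrow> recn k (\<lambda>xs. Suc (a xs))"
    by (rule recn_comp1[where f = Suc])
qed

lemma recn_const: "recn k (\<lambda>_. c)"
proof (induction c)
  case 0
  then show ?case unfolding recn_def using computes.Zero by blast
next
  case (Suc c)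
  then show ?case by (rule recn_Suc)
qed

text \<open>This and the next lemma package \<open>recn_prim\<close> with at most one parameter, so
  that each arithmetic function below needs only an equation for \<open>rec_nat\<close>.\<close>

lemma recn_prim1:
  assumes "recn 2 (\<lambda>xs. g (xs ! 0) (xs ! 1))"
  shows "recn 1 (\<lambda>xs. rec_nat c g (xs ! 0))"
proof -
  have "recn (Suc 0) (\<lambda>xs. rec_nat c (\<lambda>n r. g ((n # r # tl xs) ! 0) ((n # r # tl xs) ! 1)) (hd xs))"
    using assms by (intro recn_prim[where F = "\<lambda>_. c"] recn_const) (simp add: numeral_2_eq_2)
  then show ?thesis
    by (auto elim!: recn_cong[rotated] simp: length_Suc_conv)
qed

lemma recn_prim2:
  assumes "recn 1 (\<lambda>xs. f (xs ! 0))" "recn 3 (\<lambda>xs. g (xs ! 0) (xs ! 1) (xs ! 2))"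
  shows "recn 2 (\<lambda>xs. rec_nat (f (xs ! 1)) (\<lambda>n r. g n r (xs ! 1)) (xs ! 0))"
proof -
  have "recn (Suc 1) (\<lambda>xs. rec_nat (f (tl xs ! 0))
      (\<lambda>n r. g ((n # r # tl xs) ! 0) ((n # r # tl xs) ! 1) ((n # r # tl xs) ! 2)) (hd xs))"
    using assms by (intro recn_prim) (simp_all add: numeral_3_eq_3)
  then show ?thesis
    by (auto elim!: recn_cong[rotated] simp: length_Suc_conv numeral_2_eq_2)
qed

lemma recn_add: "recn k a \<Longrightarrow> recn k b \<Longrightarrow> recn k (\<lambda>xs. a xs + b xs)"
proof -
  have *: "rec_nat y (\<lambda>n r. Suc r) x = x + y" for x y :: nat by (induction x) auto
  have "recn 2 (\<lambda>ys. ys ! 0 + ys ! 1)"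
    using recn_prim2[of "\<lambda>y. y" "\<lambda>n r y. Suc r", OF recn_proj recn_Suc[OF recn_proj]]
    by (simp_all only: *)
  then show "recn k a \<Longrightarrow> recn k b \<Longrightarrow> recn k (\<lambda>xs. a xs + b xs)"
    by (rule recn_comp2[where f = "(+)"])
qed

lemma recn_pred: "recn k a \<Longrightarrow> recn k (\<lambda>xs. a xs - 1)"
proof -
  have *: "rec_nat 0 (\<lambda>n r. n) x = x - 1" for x :: nat by (cases x) auto
  have "recn 1 (\<lambda>ys. ys ! 0 - 1)"
    using recn_prim1[of "\<lambda>n r. n" 0, OF recn_proj] by (simp_all only: *)
  then show "recn k a \<Longrightarrow> recn k (\<lambda>xs. a xs - 1)"
    by (rule recn_comp1[where f = "\<lambda>x. x - 1"])
qed

lemma recn_diff: "recn k a \<Longrightarrow> recn k b \<Longrightarrow> recn k (\<lambda>xs. a xs - b xs)"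
proof -
  \<comment> \<open>Recursion runs over the subtrahend, so the two arguments appear in swapped
    order.\<close>
  have *: "rec_nat y (\<lambda>n r. r - 1) x = y - x" for x y :: nat by (induction x) auto
  have "recn 2 (\<lambda>ys. ys ! 1 - ys ! 0)"
    using recn_prim2[of "\<lambda>y. y" "\<lambda>n r y. r - 1", OF recn_proj recn_pred[OF recn_proj]]
    by (simp_all only: *)
  then show "recn k a \<Longrightarrow> recn k b \<Longrightarrow> recn k (\<lambda>xs. a xs - b xs)"
    using recn_comp2[where f = "\<lambda>x y. y - x"] by blast
qed

lemma recn_mult: "recn k a \<Longrightarrow> recn k b \<Longrightarrow> recn k (\<lambda>xs. a xs * b xs)"
proof -
  have *: "rec_nat 0 (\<lambda>n r. r + y) x = x * y" for x y :: nat by (induction x) auto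
  have "recn 2 (\<lambda>ys. ys ! 0 * ys ! 1)"
    using recn_prim2[of "\<lambda>y. 0" "\<lambda>n r y. r + y",
        OF recn_const recn_add[OF recn_proj recn_proj]]
    by (simp_all only: *)
  then show "recn k a \<Longrightarrow> recn k b \<Longrightarrow> recn k (\<lambda>xs. a xs * b xs)"
    by (rule recn_comp2[where f = "(*)"])
qed

lemma recn_triangle: "recn k a \<Longrightarrow> recn k (\<lambda>xs. triangle (a xs))"
proof -
  have *: "rec_nat 0 (\<lambda>n r. r + Suc n) x = triangle x" for x :: nat by (induction x) auto
  have "recn 1 (\<lambda>ys. triangle (ys ! 0))"
    using recn_prim1[of "\<lambda>n r. r + Suc n" 0, OF recn_add[OF recn_proj recn_Suc[OF recn_proj]]]
    by (simp_all only: *)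
  then show "recn k a \<Longrightarrow> recn k (\<lambda>xs. triangle (a xs))"
    by (rule recn_comp1[where f = triangle])
qed

lemma recn_prod_encode: "recn k a \<Longrightarrow> recn k b \<Longrightarrow> recn k (\<lambda>xs. prod_encode (a xs, b xs))"
  by (simp add: prod_encode_def recn_add recn_triangle)

text \<open>
  \<open>diag n\<close> is the diagonal of the Cantor enumeration on which \<open>n\<close> lies.  Counting it upwards
  replaces the recursion of \<open>prod_decode_aux\<close>, which is not primitive.
\<close>

primrec diag :: "nat \<Rightarrow> nat" where
  "diag 0 = 0"
| "diag (Suc n) = diag n + (1 - (triangle (Suc (diag n)) - Suc n))"

text \<open>A step from \<open>n\<close> to \<open>Suc n\<close> reaches at most one new triangular
  number, and truncated subtraction makes the increment 1 exactly if \<open>Suc n\<close> has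
  reached \<open>triangle (Suc (diag n))\<close>.\<close>

lemma diag_bounds: "triangle (diag n) \<le> n \<and> n < triangle (Suc (diag n))"
proof (induction n)
  case (Suc n)
  show ?case
  proof (cases "triangle (Suc (diag n)) \<le> Suc n")
    case True
    then have "diag (Suc n) = Suc (diag n)" by (simp del: triangle_Suc)
    moreover have "Suc n = triangle (Suc (diag n))" using True Suc by (simp del: triangle_Suc)
    ultimately show ?thesis by simp
  next
    case False
    then have "diag (Suc n) = diag n" by (simp del: triangle_Suc)
    then show ?thesis using False Suc by (simp del: triangle_Suc)
  qed
qed auto

text \<open>\<open>prod_encode (a, b)\<close> is \<open>triangle (a + b) + a\<close>, so
  \<open>a + b\<close> is the diagonal and \<open>a\<close> the offset on it.\<close>

lemma prod_decode_diag:
  "prod_decode n = (n - triangle (diag n), diag n - (n - triangle (diag n)))"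
proof -
  have "n = prod_encode (n - triangle (diag n), diag n - (n - triangle (diag n)))"
    using diag_bounds[of n] by (auto simp: prod_encode_def)
  then show ?thesis by (metis prod_encode_inverse)
qed

lemma recn_diag: "recn k a \<Longrightarrow> recn k (\<lambda>xs. diag (a xs))"
proof -
  have *: "rec_nat 0 (\<lambda>n r. r + (1 - (triangle (Suc r) - Suc n))) x = diag x" for x
    by (induction x) auto
  have "recn 2 (\<lambda>xs. xs ! 1 + (1 - (triangle (Suc (xs ! 1)) - Suc (xs ! 0))))"
    by (intro recn_add recn_diff recn_triangle recn_Suc recn_proj recn_const) auto
  from recn_prim1[where g = "\<lambda>n r. r + (1 - (triangle (Suc r) - Suc n))" and c = 0, OF this]
  have "recn 1 (\<lambda>ys. diag (ys ! 0))"
    by (simp only: *)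
  then show "recn k a \<Longrightarrow> recn k (\<lambda>xs. diag (a xs))"
    by (rule recn_comp1[where f = diag])
qed

lemma recn_fst_decode: "recn k a \<Longrightarrow> recn k (\<lambda>xs. fst (prod_decode (a xs)))"
  unfolding prod_decode_diag fst_conv by (intro recn_diff recn_triangle recn_diag)

lemma recn_snd_decode: "recn k a \<Longrightarrow> recn k (\<lambda>xs. snd (prod_decode (a xs)))"
  unfolding prod_decode_diag snd_conv by (intro recn_diff recn_triangle recn_diag)

text \<open>
  Codings are required to be onto, so that computability of a function is the existence of a
  single total recursive function on codes, without any domain condition.
\<close>

class coded =
  fixes enc :: "'a \<Rightarrow> nat"
  assumes bij_enc: "bij enc"

lemma enc_eq_iff [simp]: "enc x = enc y \<longleftrightarrow> x = (y :: 'a :: coded)"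
  using bij_enc by (auto simp: bij_def inj_def)

definition dec :: "nat \<Rightarrow> 'a :: coded" where "dec = inv enc"

lemma dec_enc [simp]: "dec (enc x) = x"
  unfolding dec_def by (simp add: bij_enc bij_is_inj)

lemma enc_dec [simp]: "enc (dec n :: 'a :: coded) = n"
  unfolding dec_def by (simp add: bij_enc bij_is_surj surj_f_inv_f)

instantiation nat :: coded
begin
definition enc_nat :: "nat \<Rightarrow> nat" where "enc_nat n = n"
instance by standard (simp add: enc_nat_def[abs_def] bij_def inj_def)
end

instantiation prod :: (coded, coded) coded
begin
definition enc_prod :: "'a \<times> 'b \<Rightarrow> nat" where
  "enc_prod p = prod_encode (map_prod enc enc p)"
instance
proof
  have "bij (map_prod (enc :: 'a \<Rightarrow> nat) (enc :: 'b \<Rightarrow> nat))"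
    by (rule o_bij[of "map_prod dec dec"]) (auto simp: fun_eq_iff)
  then show "bij (enc :: 'a \<times> 'b \<Rightarrow> nat)"
    unfolding enc_prod_def[abs_def] using bij_prod_encode bij_comp by (fastforce simp: comp_def)
qed
end

instantiation list :: (coded) coded
begin
definition enc_list :: "'a list \<Rightarrow> nat" where
  "enc_list l = list_encode (map enc l)"
instance
proof
  have "bij (map (enc :: 'a \<Rightarrow> nat))"
    by (rule o_bij[of "map dec"]) (auto simp: fun_eq_iff map_idI)
  then show "bij (enc :: 'a list \<Rightarrow> nat)"
    unfolding enc_list_def[abs_def] using bij_list_encode bij_comp by (fastforce simp: comp_def)
qed
end

lemma enc_Pair: "enc (a, b) = prod_encode (enc a, enc b)"
  by (simp add: enc_prod_def)

lemma enc_Cons: "enc (a # l) = Suc (prod_encode (enc a, enc l))"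
  by (simp add: enc_list_def)

section \<open>Computability lifted to coded types\<close>

definition computable :: "('a :: coded \<Rightarrow> 'b :: coded) \<Rightarrow> bool" where
  "computable f \<longleftrightarrow> recn 1 (\<lambda>xs. enc (f (dec (xs ! 0))))"

named_theorems comp_intros

lemma computable_id [comp_intros]: "computable (\<lambda>x. x)"
  unfolding computable_def by (simp add: recn_proj)

lemma computable_const [comp_intros]: "computable (\<lambda>x. c)"
  unfolding computable_def by (simp add: recn_const)

lemma computable_comp:
  assumes "computable f" "computable g"
  shows "computable (\<lambda>x. f (g x))"
  using recn_comp1[of "\<lambda>n. enc (f (dec n))" 1 "\<lambda>xs. enc (g (dec (xs ! 0)))"] assms
  unfolding computable_def by simp

lemma computable_Pair [comp_intros]:
  "computable f \<Longrightarrow> computable g \<Longrightarrow> computable (\<lambda>x. (f x, g x))"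
  unfolding computable_def enc_Pair by (rule recn_prod_encode)

lemma computable_fst [comp_intros]: "computable (f :: 'a :: coded \<Rightarrow> 'b :: coded \<times> 'c :: coded) \<Longrightarrow> computable (\<lambda>x. fst (f x))"
proof -
  have *: "enc (fst p) = fst (prod_decode (enc p))" for p :: "'b \<times> 'c"
    by (cases p) (simp add: enc_Pair)
  then show "computable f \<Longrightarrow> computable (\<lambda>x. fst (f x))"
    unfolding computable_def by (simp only: *) (rule recn_fst_decode)
qed

lemma computable_snd [comp_intros]: "computable (f :: 'a :: coded \<Rightarrow> 'b :: coded \<times> 'c :: coded) \<Longrightarrow> computable (\<lambda>x. snd (f x))"
proof -
  have *: "enc (snd p) = snd (prod_decode (enc p))" for p :: "'b \<times> 'c"
    by (cases p) (simp add: enc_Pair)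
  then show "computable f \<Longrightarrow> computable (\<lambda>x. snd (f x))"
    unfolding computable_def by (simp only: *) (rule recn_snd_decode)
qed

lemma computable_enc [comp_intros]: "computable f \<Longrightarrow> computable (\<lambda>x. enc (f x))"
  unfolding computable_def by (simp add: enc_nat_def)

lemma computable_dec [comp_intros]: "computable f \<Longrightarrow> computable (\<lambda>x. dec (f x))"
  unfolding computable_def by (simp add: enc_nat_def)

lemma computable_nat:
  "computable (f :: 'a :: coded \<Rightarrow> nat) \<longleftrightarrow> recn 1 (\<lambda>xs. f (dec (xs ! 0)))"
  unfolding computable_def by (simp add: enc_nat_def)

lemma computable_Suc [comp_intros]: "computable f \<Longrightarrow> computable (\<lambda>x. Suc (f x))"
  unfolding computable_nat by (rule recn_Suc)

lemma computable_add [comp_intros]: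
  "computable f \<Longrightarrow> computable g \<Longrightarrow> computable (\<lambda>x. f x + g x :: nat)"
  unfolding computable_nat by (rule recn_add)

lemma computable_diff [comp_intros]:
  "computable f \<Longrightarrow> computable g \<Longrightarrow> computable (\<lambda>x. f x - g x :: nat)"
  unfolding computable_nat by (rule recn_diff)

lemma computable_mult [comp_intros]:
  "computable f \<Longrightarrow> computable g \<Longrightarrow> computable (\<lambda>x. f x * g x :: nat)"
  unfolding computable_nat by (rule recn_mult)

text \<open>Iteration with a parameter is the one form of recursion lifted to coded types; the
  recursive functions on lists and numbers below are reduced to it.\<close>

lemma computable_funpow [comp_intros]:
  fixes F :: "'a :: coded \<Rightarrow> 'c :: coded \<Rightarrow> 'c"
  assumes F: "computable (\<lambda>p. F (fst p) (snd p))" and n: "computable n" and s: "computable s"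
  shows "computable (\<lambda>x. (F x ^^ n x) (s x))"
proof -
  \<comment> \<open>The iterated function on codes: it receives the counter, the accumulator and the
    parameter, and ignores the counter.\<close>
  define G :: "nat \<Rightarrow> nat \<Rightarrow> nat \<Rightarrow> nat" where "G = (\<lambda>n r x. enc (F (dec x) (dec r :: 'c)))"
  have *: "rec_nat a (\<lambda>n r. G n r (enc x)) n = enc ((F x ^^ n) (dec a :: 'c))" for a x n
    by (induction n) (auto simp: G_def)
  have dec_pair: "dec (prod_encode (c, b)) = (dec c :: 'a, dec b :: 'c)" for b c
    by (metis dec_enc enc_Pair enc_dec)
  have F': "recn 1 (\<lambda>ys. enc (F (fst (dec (ys ! 0) :: 'a \<times> 'c)) (snd (dec (ys ! 0) :: 'a \<times> 'c))))"
    using F unfolding computable_def .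
  have G: "recn 3 (\<lambda>xs. G (xs ! 0) (xs ! 1) (xs ! 2))"
  proof -
    have "recn 3 (\<lambda>xs. prod_encode (xs ! 2, xs ! 1))"
      by (intro recn_prod_encode recn_proj) auto
    from recn_comp1[where f = "\<lambda>m. enc (F (fst (dec m)) (snd (dec m)))", OF F' this]
    show ?thesis by (simp add: dec_pair G_def)
  qed
  \<comment> \<open>During the recursion the argument list is counter, accumulator, initial value,
    parameter; the parameter thus stands at position 3.\<close>
  have G': "recn 4 (\<lambda>xs. G (xs ! 0) (xs ! 1) (xs ! 3))"
    by (rule recn_comp3[where f = G, OF G]) (auto intro: recn_proj)
  have "recn (Suc 2) (\<lambda>xs. rec_nat (tl xs ! 0)
      (\<lambda>n r. G ((n # r # tl xs) ! 0) ((n # r # tl xs) ! 1) ((n # r # tl xs) ! 3)) (hd xs))"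
    using G' by (intro recn_prim recn_proj) (auto simp: eval_nat_numeral)
  then have 3: "recn 3 (\<lambda>xs. rec_nat (xs ! 1) (\<lambda>n r. G n r (xs ! 2)) (xs ! 0))"
    by (auto elim!: recn_cong[rotated] simp: length_Suc_conv eval_nat_numeral)
  have "recn 1 (\<lambda>xs. rec_nat (enc (s (dec (xs ! 0)))) (\<lambda>m r. G m r (xs ! 0)) (n (dec (xs ! 0))))"
    using n s unfolding computable_nat unfolding computable_def
    by (intro recn_comp3[where f = "\<lambda>n a x. rec_nat a (\<lambda>m r. G m r x) n", OF 3] recn_proj) auto
  moreover have "rec_nat (enc (s (dec m))) (\<lambda>k r. G k r m) (n (dec m))
      = enc ((F (dec m) ^^ n (dec m)) (s (dec m)))" for m
    using *[of "enc (s (dec m))" "dec m" "n (dec m)"] by simp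
  ultimately show ?thesis
    unfolding computable_def by simp
qed

section \<open>Decidable predicates\<close>

definition decidable :: "('a :: coded \<Rightarrow> bool) \<Rightarrow> bool" where
  "decidable P \<longleftrightarrow> computable (\<lambda>x. if P x then 1 else 0 :: nat)"

text \<open>A conditional is an iteration run once or not at all, starting from the value of the
  negative branch.\<close>

lemma computable_If [comp_intros]:
  assumes "decidable P" "computable f" "computable g"
  shows "computable (\<lambda>x. if P x then f x else g x)"
proof -
  have "computable (\<lambda>x. ((\<lambda>_. f x) ^^ (if P x then 1 else 0 :: nat)) (g x))"
    by (intro computable_funpow computable_comp[OF assms(2)] assms(1)[unfolded decidable_def]
        assms(3) computable_fst computable_id)
  moreover have "((\<lambda>_. f x) ^^ (if P x then 1 else 0 :: nat)) (g x) = (if P x then f x else g x)" for x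
    by simp
  ultimately show ?thesis by simp
qed

lemma decidable_not [comp_intros]: "decidable P \<Longrightarrow> decidable (\<lambda>x. \<not> P x)"
proof -
  assume "decidable P"
  then have "computable (\<lambda>x. if P x then 0 else 1 :: nat)"
    by (intro computable_If computable_const)
  then show ?thesis unfolding decidable_def by (rule back_subst[of computable]) auto
qed

lemma decidable_conj [comp_intros]:
  assumes "decidable P" "decidable Q"
  shows "decidable (\<lambda>x. P x \<and> Q x)"
proof -
  have "computable (\<lambda>x. if P x then if Q x then 1 else 0 else 0 :: nat)"
    by (intro computable_If computable_const assms)
  then show ?thesis unfolding decidable_def by (rule back_subst[of computable]) auto
qed

lemma decidable_disj [comp_intros]:
  assumes "decidable P" "decidable Q"
  shows "decidable (\<lambda>x. P x \<or> Q x)"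
proof -
  have "decidable (\<lambda>x. \<not> (\<not> P x \<and> \<not> Q x))"
    by (intro decidable_not decidable_conj assms)
  then show ?thesis by (rule back_subst[of decidable]) auto
qed

lemma decidable_imp [comp_intros]: "decidable P \<Longrightarrow> decidable Q \<Longrightarrow> decidable (\<lambda>x. P x \<longrightarrow> Q x)"
  unfolding imp_conv_disj by (intro decidable_not decidable_disj)

lemma decidable_zero:
  assumes "computable f" shows "decidable (\<lambda>x. f x = (0 :: nat))"
proof -
  have "computable (\<lambda>x. 1 - f x)" by (intro comp_intros assms)
  moreover have "1 - f x = (if f x = 0 then 1 else 0)" for x by simp
  ultimately show ?thesis unfolding decidable_def by simp
qed

lemma decidable_le [comp_intros]:
  "computable f \<Longrightarrow> computable g \<Longrightarrow> decidable (\<lambda>x. f x \<le> (g x :: nat))"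
  using decidable_zero[OF computable_diff, of f g] by simp

lemma decidable_eq [comp_intros]:
  fixes f g :: "'a :: coded \<Rightarrow> 'b :: coded"
  assumes "computable f" "computable g"
  shows "decidable (\<lambda>x. f x = g x)"
proof -
  have "decidable (\<lambda>x. enc (f x) \<le> enc (g x) \<and> enc (g x) \<le> enc (f x))"
    by (intro comp_intros assms)
  moreover have "enc a \<le> enc b \<and> enc b \<le> enc a \<longleftrightarrow> a = b" for a b :: 'b
    using enc_eq_iff[of a b] by linarith
  ultimately show ?thesis by simp
qed

section \<open>List functions and binary expansions\<close>

lemma computable_Cons [comp_intros]:
  "computable f \<Longrightarrow> computable g \<Longrightarrow> computable (\<lambda>x. f x # g x)"
  unfolding computable_def enc_Cons by (intro recn_Suc recn_prod_encode)

text \<open>The code of \<open>a # l\<close> is the successor of the code of the pair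
  \<open>(a, l)\<close>, hence the shift by one. The value at \<open>[]\<close> is junk, masked by
  the case distinction in \<open>computable_case_list\<close>.\<close>

definition uncons :: "'a :: coded list \<Rightarrow> 'a \<times> 'a list" where
  "uncons l = dec (enc l - 1)"

lemma uncons_Cons [simp]: "uncons (a # l) = (a, l)"
proof -
  have "uncons (a # l) = dec (enc (a, l))" by (simp add: uncons_def enc_Cons enc_Pair)
  then show ?thesis by simp
qed

lemma computable_uncons [comp_intros]: "computable f \<Longrightarrow> computable (\<lambda>x. uncons (f x))"
  unfolding uncons_def by (intro comp_intros)

lemma computable_case_list [comp_intros]:
  assumes "computable l" "computable a"
    "computable (\<lambda>x. b x (fst (uncons (l x))) (snd (uncons (l x))))"
  shows "computable (\<lambda>x. case l x of [] \<Rightarrow> a x | y # ys \<Rightarrow> b x y ys)"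
proof -
  have *: "(case l x of [] \<Rightarrow> a x | y # ys \<Rightarrow> b x y ys) =
      (if l x = [] then a x else b x (fst (uncons (l x))) (snd (uncons (l x))))" for x
    by (cases "l x") auto
  show ?thesis unfolding * by (intro comp_intros assms)
qed

lemma length_le_enc: "length l \<le> enc (l :: 'a :: coded list)"
proof (induction l)
  case (Cons a l)
  then show ?case using le_prod_encode_2[of "enc l" "enc a"] by (simp add: enc_Cons)
qed simp

text \<open>
  The code of a list bounds its length, so iterating this step as often as the code says
  consumes the whole list.
\<close>

definition foldl_step :: "('c \<Rightarrow> 'b \<Rightarrow> 'c) \<Rightarrow> 'c \<times> 'b list \<Rightarrow> 'c \<times> 'b list" where
  "foldl_step f p = (case snd p of [] \<Rightarrow> p | y # ys \<Rightarrow> (f (fst p) y, ys))"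

lemma foldl_step_funpow: "length l \<le> n \<Longrightarrow> (foldl_step f ^^ n) (a, l) = (foldl f a l, [])"
proof (induction l arbitrary: a n)
  case Nil
  show ?case by (induction n) (auto simp: foldl_step_def)
next
  case (Cons y l)
  then obtain m where "n = Suc m" "length l \<le> m" by (cases n) auto
  moreover have "(foldl_step f ^^ Suc m) (a, y # l) = (foldl_step f ^^ m) (f a y, l)"
    by (simp add: funpow_Suc_right foldl_step_def[of f "(a, y # l)"] del: funpow.simps)
  ultimately show ?case using Cons.IH[of m "f a y"] by simp
qed

lemma computable_foldl [comp_intros]:
  fixes f :: "'a :: coded \<Rightarrow> 'c :: coded \<Rightarrow> 'b :: coded \<Rightarrow> 'c"
  assumes f: "computable (\<lambda>p. f (fst p) (fst (snd p)) (snd (snd p)))"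
    and s: "computable s" and l: "computable l"
  shows "computable (\<lambda>x. foldl (f x) (s x) (l x))"
proof -
  \<comment> \<open>The hypothesis treats \<open>f\<close> as a function on triples; composition
    frees it to arguments computed in any context, as needed inside the iteration.\<close>
  have f': "computable (\<lambda>x. f (a x) (b x) (c x))" if "computable a" "computable b" "computable c"
    for a :: "'d :: coded \<Rightarrow> _" and b c
    using computable_comp[OF f, of "\<lambda>x. (a x, b x, c x)", OF computable_Pair[OF that(1) computable_Pair[OF that(2,3)]]] by simp
  have "computable (\<lambda>x. fst ((foldl_step (f x) ^^ enc (l x)) (s x, l x)))"
    unfolding foldl_step_def[abs_def] by (intro comp_intros f' s l)
  then show ?thesis by (simp add: foldl_step_funpow length_le_enc)
qed

lemma computable_rev [comp_intros]: "computable l \<Longrightarrow> computable (\<lambda>x. rev (l x))"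
proof -
  have *: "rev l = foldl (\<lambda>acc y. y # acc) [] l" for l :: "'c list"
    by (induction l rule: rev_induct) auto
  show "computable l \<Longrightarrow> computable (\<lambda>x. rev (l x))" unfolding * by (intro comp_intros)
qed

lemma computable_foldr [comp_intros]:
  fixes f :: "'a :: coded \<Rightarrow> 'b :: coded \<Rightarrow> 'c :: coded \<Rightarrow> 'c"
  assumes f: "computable (\<lambda>p. f (fst p) (fst (snd p)) (snd (snd p)))"
    and s: "computable s" and l: "computable l"
  shows "computable (\<lambda>x. foldr (f x) (l x) (s x))"
proof -
  have f': "computable (\<lambda>x. f (a x) (b x) (c x))" if "computable a" "computable b" "computable c"
    for a :: "'d :: coded \<Rightarrow> _" and b c
    using computable_comp[OF f, of "\<lambda>x. (a x, b x, c x)", OF computable_Pair[OF that(1) computable_Pair[OF that(2,3)]]] by simp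
  show ?thesis unfolding foldr_conv_foldl by (intro comp_intros f' s l)
qed

lemma computable_append [comp_intros]:
  "computable f \<Longrightarrow> computable g \<Longrightarrow> computable (\<lambda>x. f x @ g x)"
proof -
  have *: "xs @ ys = foldr (#) xs ys" for xs ys :: "'c list" by (induction xs) auto
  show "computable f \<Longrightarrow> computable g \<Longrightarrow> computable (\<lambda>x. f x @ g x)"
    unfolding * by (intro comp_intros)
qed

lemma computable_map [comp_intros]:
  fixes f :: "'a :: coded \<Rightarrow> 'b :: coded \<Rightarrow> 'c :: coded"
  assumes f: "computable (\<lambda>p. f (fst p) (snd p))" and l: "computable l"
  shows "computable (\<lambda>x. map (f x) (l x))"
proof -
  have *: "map g xs = foldr (\<lambda>y acc. g y # acc) xs []" for g :: "'b \<Rightarrow> 'c" and xs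
    by (induction xs) auto
  have f': "computable (\<lambda>x. f (a x) (b x))" if "computable a" "computable b"
    for a :: "'d :: coded \<Rightarrow> _" and b
    using computable_comp[OF f, of "\<lambda>x. (a x, b x)", OF computable_Pair[OF that]] by simp
  show ?thesis unfolding * by (intro comp_intros f' l)
qed

lemma computable_concat [comp_intros]: "computable l \<Longrightarrow> computable (\<lambda>x. concat (l x))"
  unfolding concat_conv_foldr by (intro comp_intros)

lemma computable_length [comp_intros]: "computable l \<Longrightarrow> computable (\<lambda>x. length (l x))"
proof -
  have *: "length xs = foldr (\<lambda>_. Suc) xs 0" for xs :: "'c list" by (induction xs) auto
  show "computable l \<Longrightarrow> computable (\<lambda>x. length (l x))" unfolding * by (intro comp_intros)
qed

lemma decidable_comp:
  "decidable (\<lambda>p. P (fst p) (snd p)) \<Longrightarrow> computable a \<Longrightarrow> computable b \<Longrightarrow> decidable (\<lambda>x. P (a x) (b x))"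
  unfolding decidable_def
  using computable_comp[of "\<lambda>p. if P (fst p) (snd p) then 1 else 0 :: nat" "\<lambda>x. (a x, b x)"]
    computable_Pair[of a b] by simp

lemma computable_filter [comp_intros]:
  fixes P :: "'a :: coded \<Rightarrow> 'b :: coded \<Rightarrow> bool"
  assumes P: "decidable (\<lambda>p. P (fst p) (snd p))" and l: "computable l"
  shows "computable (\<lambda>x. filter (P x) (l x))"
proof -
  have *: "filter Q xs = foldr (\<lambda>y acc. if Q y then y # acc else acc) xs []" for Q and xs :: "'b list"
    by (induction xs) auto
  show ?thesis unfolding * by (intro comp_intros decidable_comp[OF P] l)
qed

lemma decidable_ball [comp_intros]:
  fixes P :: "'a :: coded \<Rightarrow> 'b :: coded \<Rightarrow> bool"
  assumes P: "decidable (\<lambda>p. P (fst p) (snd p))" and l: "computable l"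
  shows "decidable (\<lambda>x. \<forall>y \<in> set (l x). P x y)"
proof -
  have *: "(\<forall>y \<in> set xs. Q y) \<longleftrightarrow> filter (\<lambda>y. \<not> Q y) xs = []" for Q and xs :: "'b list"
    by (auto simp: filter_empty_conv)
  show ?thesis unfolding * by (intro comp_intros P l)
qed

lemma decidable_bex [comp_intros]:
  fixes P :: "'a :: coded \<Rightarrow> 'b :: coded \<Rightarrow> bool"
  assumes P: "decidable (\<lambda>p. P (fst p) (snd p))" and l: "computable l"
  shows "decidable (\<lambda>x. \<exists>y \<in> set (l x). P x y)"
  using decidable_not[OF decidable_ball[OF decidable_not[OF P] l]] by simp

lemma computable_upt [comp_intros]: "computable n \<Longrightarrow> computable (\<lambda>x. [0..<n x])"
proof -
  have *: "[0..<n] = ((\<lambda>l. l @ [length l]) ^^ n) []" for n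
  proof (induction n)
    case (Suc n)
    show ?case by (simp flip: Suc)
  qed simp
  show "computable n \<Longrightarrow> computable (\<lambda>x. [0..<n x])" unfolding * by (intro comp_intros)
qed

lemma computable_take_drop:
  assumes "computable n" "computable l"
  shows "computable (\<lambda>x. take (n x) (l x))" "computable (\<lambda>x. drop (n x) (l x))"
proof -
  have step: "((\<lambda>p. case snd p of [] \<Rightarrow> p | y # ys \<Rightarrow> (fst p @ [y], ys)) ^^ n) (a, xs)
      = (a @ take n xs, drop n xs)" for a and xs :: "'b list" and n
  proof (induction n arbitrary: a xs)
    case (Suc n)
    then show ?case by (cases xs) (auto simp: funpow_Suc_right simp del: funpow.simps)
  qed auto
  have c: "computable (\<lambda>x. ((\<lambda>p. case snd p of [] \<Rightarrow> p | y # ys \<Rightarrow> (fst p @ [y], ys)) ^^ n x) ([], l x))"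
    by (intro comp_intros assms)
  show "computable (\<lambda>x. take (n x) (l x))" "computable (\<lambda>x. drop (n x) (l x))"
    using computable_fst[OF c] computable_snd[OF c] unfolding step by simp_all
qed

lemmas [comp_intros] = computable_take_drop

lemma computable_n_lists [comp_intros]:
  assumes "computable n" "computable l"
  shows "computable (\<lambda>x. List.n_lists (n x) (l x))"
proof -
  have *: "List.n_lists n xs = ((\<lambda>r. concat (map (\<lambda>ys. map (\<lambda>y. y # ys) xs) r)) ^^ n) [[]]"
    for n and xs :: "'b list"
    by (induction n) auto
  show ?thesis
    unfolding * by (intro comp_intros assms computable_comp[OF assms(2)])
qed

lemma computable_power [comp_intros]:
  assumes "computable a" "computable n"
  shows "computable (\<lambda>x. a x ^ n x :: nat)"
proof -
  have *: "a ^ n = (((*) a) ^^ n) 1" for a n :: nat by (induction n) auto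
  show ?thesis
    unfolding * by (intro comp_intros assms computable_comp[OF assms(1)])
qed

text \<open>The pair \<open>(n div 2, Suc n div 2)\<close> advances by a swap and one increment, so
  halving is an iteration without division.\<close>

lemma computable_half [comp_intros]:
  assumes "computable n"
  shows "computable (\<lambda>x. n x div 2 :: nat)"
proof -
  have *: "((\<lambda>p. (snd p, Suc (fst p))) ^^ n) (0, 0) = (n div 2, Suc n div 2)" for n :: nat
    by (induction n) auto
  have "computable (\<lambda>x. fst (((\<lambda>p. (snd p, Suc (fst p))) ^^ n x) (0, 0 :: nat)))"
    by (intro comp_intros assms)
  then show ?thesis unfolding * by simp
qed

text \<open>If bit \<open>i\<close> of \<open>n\<close> is set, then
  \<open>i < 2 ^ i \<le> n\<close>, so filtering \<open>[0..<n]\<close> finds all bits. Oddness of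
  \<open>m\<close> is expressed as \<open>m\<close> differing from twice its half.\<close>

definition bit_list :: "nat \<Rightarrow> nat list" where
  "bit_list n = filter (\<lambda>i. \<not> ((\<lambda>m. m div 2) ^^ i) n = 2 * (((\<lambda>m. m div 2) ^^ i) n div 2)) [0..<n]"

lemma set_bit_list: "set (bit_list n) = set_decode n"
proof -
  have h: "((\<lambda>m. m div 2) ^^ i) n = n div 2 ^ i" for i n :: nat
    by (induction i) (auto simp: div_mult2_eq[symmetric] mult.commute)
  have "i < n" if "i \<in> set_decode n" for i
  proof -
    have "n div 2 ^ i \<noteq> 0" using that unfolding set_decode_def by (metis even_zero mem_Collect_eq)
    then have "2 ^ i \<le> n" by (auto simp: div_eq_0_iff not_less)
    then show ?thesis using less_exp[of i] by linarith
  qed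
  moreover have "n div 2 ^ i \<noteq> 2 * (n div 2 ^ i div 2) \<longleftrightarrow> odd (n div 2 ^ i)" for i
    by (metis dvd_mult_div_cancel dvd_triv_left)
  ultimately show ?thesis
    by (auto simp: bit_list_def set_decode_def h)
qed

lemma computable_bit_list [comp_intros]:
  "computable f \<Longrightarrow> computable (\<lambda>x. bit_list (f x))"
proof (rule computable_comp[of bit_list])
  show "computable bit_list"
    unfolding bit_list_def[abs_def] by (intro comp_intros)
qed

lemma computable_list_decode [comp_intros]:
  "computable f \<Longrightarrow> computable (\<lambda>x. list_decode (f x))"
proof -
  have "list_decode n = dec n" for n
  proof -
    have "enc (list_decode n) = n" by (simp add: enc_list_def enc_nat_def map_idI)
    then show ?thesis by (metis dec_enc)
  qed
  then show "computable f \<Longrightarrow> computable (\<lambda>x. list_decode (f x))"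
    by (simp add: computable_dec)
qed

text \<open>The default value 0 keeps decoding total, also on numbers that code no instance.\<close>

definition nth0 :: "nat list \<Rightarrow> nat \<Rightarrow> nat" where
  "nth0 l i = (case drop i l of [] \<Rightarrow> 0 | y # _ \<Rightarrow> y)"

lemma computable_nth0 [comp_intros]:
  assumes "computable l" "computable i"
  shows "computable (\<lambda>x. nth0 (l x) (i x))"
  unfolding nth0_def by (intro comp_intros assms)

lemma decidable_computes:
  assumes "decidable (P :: nat \<Rightarrow> bool)"
  shows "\<exists>g. \<forall>n. computes g [n] (if P n then 1 else 0)"
proof -
  have "dec n = n" for n :: nat by (metis dec_enc enc_nat_def)
  then have "recn 1 (\<lambda>xs. if P (xs ! 0) then 1 else 0)"
    using assms unfolding decidable_def computable_nat by simp
  then obtain g where g: "\<And>xs. length xs = 1 \<Longrightarrow> computes g xs (if P (xs ! 0) then 1 else 0)"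
    unfolding recn_def by blast
  have "computes g [n] (if P n then 1 else 0)" for n
    using g[of "[n]"] by simp
  then show ?thesis by blast
qed

section \<open>Kernels of Mealy machines\<close>

lemma path_append:
  "path T p u v q \<Longrightarrow> path T q u' v' r \<Longrightarrow> path T p (u @ u') (v @ v') r"
  by (induction rule: path.induct) (auto dest: path.step)

text \<open>Every transition reads exactly one letter, so each cut of the input falls between two
  transitions.\<close>

lemma path_real_time_split:
  assumes "path T p w y q" "real_time T" "finite_transducer A B T" "w = u @ v"
  shows "\<exists>r y1 y2. path T p u y1 r \<and> path T r v y2 q \<and> y = y1 @ y2"
  using assms
proof (induction arbitrary: u rule: path.induct)
  case (empty p)
  then show ?case by (auto intro: path.empty)
next
  case (step p x y q w z r)
  then obtain a where x: "x = [a]"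
    by (auto simp: real_time_def length_Suc_conv)
  have p: "p \<in> states T" using step by (auto simp: finite_transducer_def)
  show ?case
  proof (cases u)
    case Nil
    then show ?thesis
      using path.empty[OF p] step path.step[OF step.hyps] by (metis append_Nil)
  next
    case (Cons b u')
    then have u: "u = x @ u'" "w = u' @ v" using step.prems x by auto
    then obtain s y1 y2 where s: "path T q u' y1 s" "path T s v y2 r" "z = y1 @ y2"
      using step.IH[of u'] step.prems by blast
    then have "path T p u (y @ y1) s" using u path.step[OF step.hyps(1)] by blast
    then show ?thesis using s by (metis append.assoc)
  qed
qed

text \<open>No transition reads the empty word, so two paths on the same input proceed in lockstep,
  and determinism makes them agree at every letter.\<close>

lemma path_sequential_deterministic:
  assumes "path T p u y q" "sequential T" "path T p u y' q'"
  shows "y = y' \<and> q = q'"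
  using assms
proof (induction arbitrary: y' q' rule: path.induct)
  case (empty p)
  have "real_time T" using empty by (simp add: sequential_def)
  with empty(3) show ?case
    by cases (auto simp: real_time_def)
next
  case (step p x y q u v r)
  have rt: "real_time T" using step by (simp add: sequential_def)
  then obtain a where x: "x = [a]"
    using step by (auto simp: real_time_def length_Suc_conv)
  from step.prems(2) show ?case
  proof cases
    case (step x2 y2 q2 u2 v2)
    then obtain a2 where "x2 = [a2]" using rt by (auto simp: real_time_def length_Suc_conv)
    then have "x2 = [a]" "u2 = u" using x step by auto
    moreover from this have "y2 = y" "q2 = q"
      using step \<open>(p, (x, y), q) \<in> transitions T\<close> x \<open>sequential T\<close> unfolding sequential_def by blast+
    ultimately show ?thesis using step \<open>sequential T\<close> step.IH by auto
  qed (use x in auto)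
qed

lemma path_letter_length:
  "path T p u v q \<Longrightarrow> letter_to_letter T \<Longrightarrow> length u = length v"
  by (induction rule: path.induct) (auto simp: letter_to_letter_def)

text \<open>Words of one \<open>R\<close>-class lying in pairwise different
  \<open>sim\<close>-classes. An infinite set has \<open>card\<close> 0, but its finite subsets are
  separated as well, so a uniform bound on \<open>card\<close> excludes it too.\<close>

definition separated :: "'a set \<Rightarrow> ('a list \<times> 'a list) set \<Rightarrow> 'a list set \<Rightarrow> bool" where
  "separated A R V \<longleftrightarrow> (\<forall>u \<in> V. \<forall>v \<in> V. (u, v) \<in> R \<and> (u \<noteq> v \<longrightarrow> (\<exists>x \<in> lists A. (u @ x, v @ x) \<notin> R)))"

definition length_preserving :: "('a list \<times> 'a list) set \<Rightarrow> bool" where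
  "length_preserving R \<longleftrightarrow> (\<forall>(u, v) \<in> R. length u = length v)"

definition prefix_closed :: "('a list \<times> 'a list) set \<Rightarrow> bool" where
  "prefix_closed R \<longleftrightarrow> (\<forall>u v a b. (u @ [a], v @ [b]) \<in> R \<longrightarrow> (u, v) \<in> R)"

lemma KerSeq_ll_imp:
  assumes "R \<in> KerSeq_ll A"
  shows "length_preserving R" "prefix_closed R" "\<exists>k. \<forall>V. separated A R V \<longrightarrow> card V \<le> k"
proof -
  obtain f :: "'a list \<Rightarrow> nat list" and B and T :: "(nat, 'a, nat) transducer" where
    R: "R = kernel A f" and T: "finite_transducer A B T" "letter_to_letter T" "sequential T"
    and f: "realizes_total_function A T f"
    using assms unfolding KerSeq_ll_def by blast
  have rt: "real_time T" using T by (simp add: sequential_def)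
  obtain i where i: "initials T = {i}" using T by (auto simp: sequential_def)
  have f_iff: "(u, v) \<in> realized_relation T \<longleftrightarrow> u \<in> lists A \<and> v = f u" for u v
    using f by (auto simp: realizes_total_function_def)
  have "\<exists>q. path T i u (f u) q" if "u \<in> lists A" for u
    using f_iff[of u "f u"] that i by (auto simp: realized_relation_def)
  then obtain st where st: "\<And>u. u \<in> lists A \<Longrightarrow> path T i u (f u) (st u)" by metis
  have len: "length (f u) = length u" if "u \<in> lists A" for u
    using path_letter_length[OF st[OF that] T(2)] by simp
  have st_in: "st u \<in> states T" if "u \<in> lists A" for u
    using st[OF that] T(1) by (induction rule: path.induct) (auto simp: finite_transducer_def)
  \<comment> \<open>By determinism the run on \<open>u @ x\<close> passes through
    \<open>st u\<close>, so the output prolongs \<open>f u\<close> by a word that depends on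
    \<open>st u\<close> and \<open>x\<close> only.\<close>
  have ex: "\<exists>y. f (u @ x) = f u @ y \<and> path T (st u) x y (st (u @ x))"
    if "u \<in> lists A" "x \<in> lists A" for u x
  proof -
    have "path T i (u @ x) (f (u @ x)) (st (u @ x))" using that st by simp
    from path_real_time_split[OF this rt T(1) refl] obtain r y1 y2 where
      *: "path T i u y1 r" "path T r x y2 (st (u @ x))" "f (u @ x) = y1 @ y2" by blast
    from path_sequential_deterministic[OF st[OF that(1)] T(3) *(1)] * show ?thesis by auto
  qed
  show "length_preserving R"
  proof -
    have "length u = length v" if "(u, v) \<in> R" for u v
    proof -
      have "u \<in> lists A" "v \<in> lists A" "f u = f v" using that by (auto simp: R kernel_def)
      then show ?thesis by (metis len)
    qed
    then show ?thesis by (auto simp: length_preserving_def)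
  qed
  show "prefix_closed R"
    unfolding prefix_closed_def
  proof (intro allI impI)
    fix u v a b assume "(u @ [a], v @ [b]) \<in> R"
    then have *: "u \<in> lists A" "v \<in> lists A" "a \<in> A" "b \<in> A" "f (u @ [a]) = f (v @ [b])"
      by (auto simp: R kernel_def)
    obtain y z where yz: "f (u @ [a]) = f u @ y" "f (v @ [b]) = f v @ z"
      using ex[of u "[a]"] ex[of v "[b]"] *(1-4) by auto
    have "length (u @ [a]) = length (v @ [b])"
      using len[of "u @ [a]"] len[of "v @ [b]"] * by simp
    \<comment> \<open>Outputs are as long as inputs, so the two equal outputs are cut at the same
      place.\<close>
    then have "length (f u) = length (f v)"
      using len[OF *(1)] len[OF *(2)] by simp
    moreover have "f u @ y = f v @ z" using yz *(5) by simp
    ultimately have "f u = f v" by (simp add: append_eq_append_conv)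
    then show "(u, v) \<in> R" using *(1,2) by (simp add: R kernel_def)
  qed
  have "card V \<le> card (states T)" if V: "separated A R V" for V
  proof (rule card_inj_on_le[of st])
    have V_A: "u \<in> lists A" "f u = f v" if "u \<in> V" "v \<in> V" for u v
    proof -
      have "(u, v) \<in> R" using V that unfolding separated_def by blast
      then show "u \<in> lists A" "f u = f v" by (auto simp: R kernel_def)
    qed
    show "st ` V \<subseteq> states T" using st_in V_A by blast
    show "finite (states T)" using T by (simp add: finite_transducer_def)
    show "inj_on st V"
    proof (rule inj_onI, rule ccontr)
      fix u v assume uv: "u \<in> V" "v \<in> V" "st u = st v" "u \<noteq> v"
      then obtain x where x: "x \<in> lists A" "(u @ x, v @ x) \<notin> R"
        using V unfolding separated_def by blast
      have u: "u \<in> lists A" and v: "v \<in> lists A" and fuv: "f u = f v"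
        using V_A uv by blast+
      obtain y z where "f (u @ x) = f u @ y" "path T (st u) x y (st (u @ x))"
        "f (v @ x) = f v @ z" "path T (st v) x z (st (v @ x))"
        using ex[OF u x(1)] ex[OF v x(1)] by blast
      then have "f (u @ x) = f (v @ x)"
        using path_sequential_deterministic[OF _ T(3)] uv(3) fuv by metis
      then show False using x u v by (simp add: R kernel_def)
    qed
  qed
  then show "\<exists>k. \<forall>V. separated A R V \<longrightarrow> card V \<le> k" by blast
qed

section \<open>Mealy machines as transducers\<close>

fun mealy_out :: "('s \<Rightarrow> 'a \<Rightarrow> 's) \<Rightarrow> ('s \<Rightarrow> 'a \<Rightarrow> 'o) \<Rightarrow> 's \<Rightarrow> 'a list \<Rightarrow> 'o list" where
  "mealy_out \<delta> out s [] = []"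
| "mealy_out \<delta> out s (a # u) = out s a # mealy_out \<delta> out (\<delta> s a) u"

lemma mealy_out_snoc:
  "mealy_out \<delta> out s (u @ [a]) = mealy_out \<delta> out s u @ [out (foldl \<delta> s u) a]"
  by (induction u arbitrary: s) auto

lemma mealy_kernel:
  assumes "finite A" "finite S" "s0 \<in> S" and closed: "\<And>s a. s \<in> S \<Longrightarrow> a \<in> A \<Longrightarrow> \<delta> s a \<in> S"
  shows "kernel A (mealy_out \<delta> out s0 :: 'a list \<Rightarrow> nat list) \<in> KerSeq_ll A"
proof -
  obtain e :: "'b \<Rightarrow> nat" where e: "inj_on e S"
    using finite_imp_inj_to_nat_seg[OF assms(2)] by blast
  define B where "B = (\<lambda>(s, a). out s a) ` (S \<times> A)"
  define D where "D = (\<lambda>(s, a). (e s, ([a], [out s a]), e (\<delta> s a))) ` (S \<times> A)"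
  \<comment> \<open>Every state is final, so each run is accepted and the realized function is
    total.\<close>
  define T :: "(nat, 'a, nat) transducer" where
    "T = \<lparr>states = e ` S, transitions = D, initials = {e s0}, finals = e ` S\<rparr>"
  have fin: "finite_transducer A B T"
    using assms unfolding finite_transducer_def T_def D_def B_def by auto
  have ll: "letter_to_letter T" and seq: "sequential T"
    unfolding letter_to_letter_def sequential_def real_time_def T_def D_def
    using e by (auto dest: inj_onD)
  have 1: "path T p u v q \<Longrightarrow> s \<in> S \<Longrightarrow> p = e s \<Longrightarrow> u \<in> lists A \<and> v = mealy_out \<delta> out s u" for p u v q s
  proof (induction arbitrary: s rule: path.induct)
    case (step p x y q u v r)
    then obtain s' a where "s' \<in> S" "a \<in> A" "e s' = e s" "x = [a]" "y = [out s' a]" "q = e (\<delta> s' a)"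
      by (auto simp: T_def D_def)
    then show ?case using step.IH[of "\<delta> s' a"] closed step.prems inj_onD[OF e, of s' s] by auto
  qed auto
  have 2: "u \<in> lists A \<Longrightarrow> s \<in> S \<Longrightarrow> \<exists>q \<in> e ` S. path T (e s) u (mealy_out \<delta> out s u) q" for u s
  proof (induction u arbitrary: s)
    case Nil
    then have "path T (e s) [] [] (e s)" by (intro path.empty) (simp add: T_def)
    then show ?case using Nil by auto
  next
    case (Cons a u)
    then obtain q where q: "q \<in> e ` S" "path T (e (\<delta> s a)) u (mealy_out \<delta> out (\<delta> s a) u) q"
      using closed by force
    have "(e s, ([a], [out s a]), e (\<delta> s a)) \<in> transitions T"
      using Cons by (force simp: T_def D_def)
    from path.step[OF this q(2)] q(1) show ?case by auto
  qed
  have "realizes_total_function A T (mealy_out \<delta> out s0)"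
    unfolding realizes_total_function_def realized_relation_def
    using 1[OF _ assms(3) refl] 2[OF _ assms(3)] by (fastforce simp: T_def)
  then show ?thesis
    using fin ll seq unfolding KerSeq_ll_def by blast
qed

text \<open>The left quotient of a relation by a pair of words, that is, its Brzozowski
  derivative.\<close>

definition der :: "'a list \<Rightarrow> 'a list \<Rightarrow> ('a list \<times> 'a list) set \<Rightarrow> ('a list \<times> 'a list) set" where
  "der u v R = {(x, y). (u @ x, v @ y) \<in> R}"

lemma in_der [simp]: "(x, y) \<in> der u v R \<longleftrightarrow> (u @ x, v @ y) \<in> R"
  by (simp add: der_def)

lemma der_der [simp]: "der x y (der u v R) = der (u @ x) (v @ y) R"
  by (simp add: der_def)

lemma der_Nil [simp]: "der [] [] R = R"
  by (simp add: der_def)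

text \<open>Stated for a residual instead of two words: \<open>sim\<close>-equivalence of
  \<open>u\<close> and \<open>v\<close> can be read off from \<open>der u v R\<close>, which a
  finite machine can remember.\<close>

definition nonsep :: "'a set \<Rightarrow> ('a list \<times> 'a list) set \<Rightarrow> bool" where
  "nonsep A r \<longleftrightarrow> (\<forall>x \<in> lists A. (x, x) \<in> r)"

text \<open>
  No automaton for \<open>R\<close> is ever constructed: the residuals of pairs of words of equal length
  serve as its states.
\<close>

definition residuals :: "'a set \<Rightarrow> ('a list \<times> 'a list) set \<Rightarrow> ('a list \<times> 'a list) set set" where
  "residuals A R = {der u v R | u v. u \<in> lists A \<and> v \<in> lists A \<and> length u = length v}"

lemma residualsI:
  "u \<in> lists A \<Longrightarrow> v \<in> lists A \<Longrightarrow> length u = length v \<Longrightarrow> der u v R \<in> residuals A R"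
  by (auto simp: residuals_def)

lemma der_in_residuals:
  assumes "r \<in> residuals A R" "x \<in> lists A" "y \<in> lists A" "length x = length y"
  shows "der x y r \<in> residuals A R"
  using assms unfolding residuals_def
  by (force simp: der_der)

text \<open>The first element of each class survives, so the choice is canonical: it depends on
  \<open>E\<close> and on the order of the list alone.\<close>

fun dedup :: "('b \<Rightarrow> 'b \<Rightarrow> bool) \<Rightarrow> 'b list \<Rightarrow> 'b list" where
  "dedup E [] = []"
| "dedup E (x # xs) = x # filter (\<lambda>y. \<not> E x y) (dedup E xs)"

lemma set_dedup: "set (dedup E xs) \<subseteq> set xs"
  by (induction xs) auto

lemma dedup_cover:
  assumes "\<And>x. x \<in> set xs \<Longrightarrow> E x x"
    and "\<And>x y z. x \<in> set xs \<Longrightarrow> y \<in> set xs \<Longrightarrow> z \<in> set xs \<Longrightarrow> E x y \<Longrightarrow> E y z \<Longrightarrow> E x z"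
    and "z \<in> set xs"
  shows "\<exists>y \<in> set (dedup E xs). E y z"
  using assms
proof (induction xs)
  case (Cons x xs)
  show ?case
  proof (cases "z = x")
    case True
    then show ?thesis using Cons.prems(1) by auto
  next
    case False
    then have z: "z \<in> set xs" using Cons.prems(3) by simp
    have "\<exists>y \<in> set (dedup E xs). E y z"
    proof (rule Cons.IH)
      show "E x y" if "x \<in> set xs" "w \<in> set xs" "y \<in> set xs" "E x w" "E w y" for x w y
        by (rule Cons.prems(2)[of x w y]) (use that in auto)
    qed (use Cons.prems(1) z in auto)
    then obtain y where y: "y \<in> set (dedup E xs)" "E y z" by blast
    then have "y \<in> set xs" using set_dedup by fast
    then show ?thesis
    proof (cases "E x y")
      case True
      then have "E x z" using Cons.prems(2)[of x y z] Cons.prems(3) y \<open>y \<in> set xs\<close> by simp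
      then show ?thesis by auto
    qed (use y in auto)
  qed
qed simp

lemma sorted_wrt_dedup: "sorted_wrt (\<lambda>x y. \<not> E x y) (dedup E xs)"
  by (induction xs) (auto intro: sorted_wrt_filter)

section \<open>Length-preserving equivalences and their right congruence\<close>

locale kernel_candidate =
  fixes A :: "'a set" and R :: "('a list \<times> 'a list) set"
  assumes finite_A: "finite A" and equiv_R: "equiv (lists A) R"
    and lp: "length_preserving R"
begin

lemma R_refl: "u \<in> lists A \<Longrightarrow> (u, u) \<in> R"
  using equiv_R by (meson equivE refl_onD)

lemma R_sym: "(u, v) \<in> R \<Longrightarrow> (v, u) \<in> R"
  using equiv_R by (meson equivE symD)

lemma R_trans: "(u, v) \<in> R \<Longrightarrow> (v, w) \<in> R \<Longrightarrow> (u, w) \<in> R"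
  using equiv_R by (meson equivE transD)

lemma R_lists: "(u, v) \<in> R \<Longrightarrow> u \<in> lists A \<and> v \<in> lists A"
  using equiv_type[OF equiv_R] by blast

lemma R_length: "(u, v) \<in> R \<Longrightarrow> length u = length v"
  using lp by (auto simp: length_preserving_def)

text \<open>The coarsest right congruence on \<open>lists A\<close> contained in
  \<open>R\<close>.\<close>

definition sim :: "'a list \<Rightarrow> 'a list \<Rightarrow> bool" where
  "sim u v \<longleftrightarrow> nonsep A (der u v R)"

lemma sim_iff: "sim u v \<longleftrightarrow> (\<forall>x \<in> lists A. (u @ x, v @ x) \<in> R)"
  by (simp add: sim_def nonsep_def del: in_lists_conv_set)

lemma sim_R: "sim u v \<Longrightarrow> (u, v) \<in> R"
  unfolding sim_iff by (drule bspec[of _ _ "[]"]) auto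

lemma sim_lists: "sim u v \<Longrightarrow> u \<in> lists A \<and> v \<in> lists A"
  using sim_R R_lists by blast

lemma sim_refl: "u \<in> lists A \<Longrightarrow> sim u u"
  unfolding sim_iff using R_refl by (metis append_in_lists_conv)

lemma sim_sym: "sim u v \<Longrightarrow> sim v u"
  unfolding sim_iff using R_sym by blast

lemma sim_trans: "sim u v \<Longrightarrow> sim v w \<Longrightarrow> sim u w"
  unfolding sim_iff using R_trans by blast

lemma sim_append: "sim u v \<Longrightarrow> x \<in> lists A \<Longrightarrow> sim (u @ x) (v @ x)"
  unfolding sim_iff by (metis append_assoc append_in_lists_conv)

lemma separated_iff:
  "separated A R V \<longleftrightarrow> (\<forall>u \<in> V. \<forall>v \<in> V. (u, v) \<in> R \<and> (u \<noteq> v \<longrightarrow> \<not> sim u v))"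
  unfolding separated_def sim_iff by meson

end

text \<open>
  A state of the Mealy machine: with representatives \<open>ws\<close> of the \<open>sim\<close>-classes inside the
  \<open>R\<close>-class of the word read so far, it holds the index of the representative of that word
  and the matrix of the residuals of all pairs from \<open>ws\<close>.  Pairs \<open>(j, b)\<close> below stand for
  the word \<open>ws ! j @ [b]\<close>.
\<close>

type_synonym 'a signature = "nat \<times> ('a list \<times> 'a list) set list list"

text \<open>\<open>Al\<close> fixes an enumeration of the alphabet, whose order makes the choice of
  representatives canonical.\<close>

locale bounded_candidate = kernel_candidate +
  fixes Al :: "'a list" and k :: nat
  assumes pc: "prefix_closed R" and fin_res: "finite (residuals A R)"
    and bounded: "\<And>V. separated A R V \<Longrightarrow> card V \<le> k"
    and set_Al: "set Al = A"
begin

text \<open>The word read so far is \<open>sim\<close>-equivalent to its representative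
  \<open>ws ! fst s\<close>, which may replace it; so column \<open>fst s\<close> of the stored
  matrix decides which one-letter extensions enter the new \<open>R\<close>-class.\<close>

definition cands :: "'a signature \<Rightarrow> 'a \<Rightarrow> (nat \<times> 'a) list" where
  "cands s a = filter (\<lambda>p. ([snd p], [a]) \<in> snd s ! fst p ! fst s)
     (List.product [0..<length (snd s)] Al)"

definition same_ext :: "'a signature \<Rightarrow> nat \<times> 'a \<Rightarrow> nat \<times> 'a \<Rightarrow> bool" where
  "same_ext s p q \<longleftrightarrow> nonsep A (der [snd p] [snd q] (snd s ! fst p ! fst q))"

definition exts :: "'a signature \<Rightarrow> 'a \<Rightarrow> (nat \<times> 'a) list" where
  "exts s a = dedup (same_ext s) (cands s a)"

definition next_sig :: "'a signature \<Rightarrow> 'a \<Rightarrow> 'a signature" where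
  "next_sig s a =
     ((LEAST l. l < length (exts s a) \<and> same_ext s (exts s a ! l) (fst s, a)),
      map (\<lambda>p. map (\<lambda>q. der [snd p] [snd q] (snd s ! fst p ! fst q)) (exts s a)) (exts s a))"

text \<open>The representatives grow with the input and cannot belong to a finite state. They are
  carried along in the proof only; the signature is updated by derivatives without them.\<close>

definition next_reps :: "'a list list \<Rightarrow> 'a signature \<Rightarrow> 'a \<Rightarrow> 'a list list" where
  "next_reps ws s a = map (\<lambda>p. ws ! fst p @ [snd p]) (exts s a)"

definition init_sig :: "'a signature" where
  "init_sig = (0, [[R]])"

definition invariant :: "'a list list \<Rightarrow> 'a signature \<Rightarrow> 'a list \<Rightarrow> bool" where
  "invariant ws s u \<longleftrightarrow> snd s = map (\<lambda>w. map (\<lambda>w'. der w w' R) ws) ws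
     \<and> fst s < length ws \<and> sim (ws ! fst s) u
     \<and> (\<forall>w \<in> set ws. (w, u) \<in> R)
     \<and> (\<forall>v. (v, u) \<in> R \<longrightarrow> (\<exists>w \<in> set ws. sim w v))
     \<and> sorted_wrt (\<lambda>w w'. \<not> sim w w') ws"

lemma inv_init: "invariant [[]] init_sig []"
proof -
  have "sim [] []" by (rule sim_refl) simp
  moreover have "([], []) \<in> R" by (rule R_refl) simp
  moreover have "v = []" if "(v, []) \<in> R" for v using R_length[OF that] by simp
  ultimately show ?thesis by (auto simp: invariant_def init_sig_def)
qed

context
  fixes ws s u a
  assumes inv: "invariant ws s u" and a: "a \<in> A"
begin

lemma length_sig: "length (snd s) = length ws"
  using inv by (auto simp: invariant_def)

lemma sig_nth: "i < length ws \<Longrightarrow> j < length ws \<Longrightarrow> snd s ! i ! j = der (ws ! i) (ws ! j) R"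
  using inv by (auto simp: invariant_def)

lemma idx: "fst s < length ws" "sim (ws ! fst s) u"
  using inv by (auto simp: invariant_def)

lemma idx_ext: "sim (ws ! fst s @ [a]) (u @ [a])"
  using sim_append[OF idx(2), of "[a]"] a by simp

lemma set_cands:
  "set (cands s a) = {(j, b). j < length ws \<and> b \<in> A \<and> (ws ! j @ [b], u @ [a]) \<in> R}"
proof -
  have "(ws ! j @ [b], ws ! fst s @ [a]) \<in> R \<longleftrightarrow> (ws ! j @ [b], u @ [a]) \<in> R" for j b
    using R_trans R_sym sim_R[OF idx_ext] by blast
  then show ?thesis
    using idx(1) by (auto simp: cands_def length_sig sig_nth set_Al)
qed

lemma same_ext_iff:
  "fst p < length ws \<Longrightarrow> fst q < length ws \<Longrightarrow>
    same_ext s p q \<longleftrightarrow> sim (ws ! fst p @ [snd p]) (ws ! fst q @ [snd q])"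
  by (simp add: same_ext_def sim_def sig_nth)

lemma exts_subset: "p \<in> set (exts s a) \<Longrightarrow>
    fst p < length ws \<and> snd p \<in> A \<and> (ws ! fst p @ [snd p], u @ [a]) \<in> R"
  using set_dedup[of "same_ext s" "cands s a"] set_cands by (auto simp: exts_def)

lemma exts_cover:
  assumes "j < length ws" "b \<in> A" "(ws ! j @ [b], u @ [a]) \<in> R"
  shows "\<exists>p \<in> set (exts s a). sim (ws ! fst p @ [snd p]) (ws ! j @ [b])"
proof -
  have "\<exists>y \<in> set (exts s a). same_ext s y (j, b)"
    unfolding exts_def
  proof (rule dedup_cover)
    show "same_ext s x x" if "x \<in> set (cands s a)" for x
      using that set_cands R_lists sim_refl by (subst same_ext_iff) fastforce+
    show "same_ext s x z" if "x \<in> set (cands s a)" "y \<in> set (cands s a)" "z \<in> set (cands s a)"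
      "same_ext s x y" "same_ext s y z" for x y z
      using that set_cands sim_trans by (auto simp: same_ext_iff)
    show "(j, b) \<in> set (cands s a)" using assms set_cands by auto
  qed
  then obtain y where y: "y \<in> set (exts s a)" "same_ext s y (j, b)" by blast
  have "fst y < length ws" using exts_subset[OF y(1)] by simp
  then have "sim (ws ! fst y @ [snd y]) (ws ! j @ [b])"
    using same_ext_iff[of y "(j, b)"] y(2) assms(1) by simp
  then show ?thesis using y(1) by blast
qed

lemma inv_step:
  "invariant (next_reps ws s a) (next_sig s a) (u @ [a])"
  unfolding invariant_def
proof (intro conjI ballI allI impI)
  let ?J = "exts s a" and ?ws = "next_reps ws s a"
  have nth: "?ws ! l = ws ! fst (?J ! l) @ [snd (?J ! l)]" if "l < length ?J" for l
    using that by (simp add: next_reps_def)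
  have len: "length ?ws = length ?J" by (simp add: next_reps_def)
  show "snd (next_sig s a) = map (\<lambda>w. map (\<lambda>w'. der w w' R) ?ws) ?ws"
    using exts_subset by (auto simp: next_sig_def next_reps_def sig_nth)
  have self: "(ws ! fst s @ [a], u @ [a]) \<in> R" using sim_R[OF idx_ext] .
  from exts_cover[OF idx(1) a self] obtain p where
    p: "p \<in> set ?J" "sim (ws ! fst p @ [snd p]) (ws ! fst s @ [a])" by blast
  have same_idx: "same_ext s q (fst s, a) \<longleftrightarrow> sim (ws ! fst q @ [snd q]) (ws ! fst s @ [a])"
    if "q \<in> set ?J" for q
    using same_ext_iff[of q "(fst s, a)"] exts_subset[OF that] idx(1) by simp
  obtain l where "l < length ?J \<and> same_ext s (?J ! l) (fst s, a)"
    using p same_idx[OF p(1)] by (auto simp: in_set_conv_nth)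
  then have l: "fst (next_sig s a) < length ?J \<and> same_ext s (?J ! fst (next_sig s a)) (fst s, a)"
    unfolding next_sig_def fst_conv by (rule LeastI)
  then show "fst (next_sig s a) < length ?ws" using len by simp
  have "sim (ws ! fst (?J ! fst (next_sig s a)) @ [snd (?J ! fst (next_sig s a))]) (ws ! fst s @ [a])"
    using l same_idx[OF nth_mem] by blast
  then show "sim (?ws ! fst (next_sig s a)) (u @ [a])"
    using nth l sim_trans[OF _ idx_ext] by simp
  show "(w, u @ [a]) \<in> R" if "w \<in> set ?ws" for w
    using that exts_subset by (auto simp: next_reps_def)
  show "\<exists>w \<in> set ?ws. sim w v" if v: "(v, u @ [a]) \<in> R" for v
  proof -
    have "v \<noteq> []" using R_length[OF v] by auto
    then obtain v' b where v': "v = v' @ [b]" by (metis rev_exhaust)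
    \<comment> \<open>Prefix closure puts \<open>v'\<close> into the class of \<open>u\<close>, so
      \<open>v'\<close> already has a representative, and the extension of that representative by
      \<open>b\<close> is a candidate.\<close>
    then have "(v', u) \<in> R" "b \<in> A" using pc v R_lists[OF v] by (auto simp: prefix_closed_def)
    then obtain w where "w \<in> set ws" "sim w v'" using inv unfolding invariant_def by blast
    then obtain j where j: "j < length ws" "sim (ws ! j) v'" by (auto simp: in_set_conv_nth)
    have *: "sim (ws ! j @ [b]) v" using sim_append[OF j(2), of "[b]"] \<open>b \<in> A\<close> v' by simp
    then have "(ws ! j @ [b], u @ [a]) \<in> R" using R_trans[OF sim_R v] by blast
    from exts_cover[OF j(1) \<open>b \<in> A\<close> this] obtain p where
      "p \<in> set ?J" "sim (ws ! fst p @ [snd p]) (ws ! j @ [b])" by blast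
    then show ?thesis using sim_trans[OF _ *] by (auto simp: next_reps_def)
  qed
  have "sorted_wrt (\<lambda>p q. \<not> same_ext s p q) ?J"
    unfolding exts_def by (rule sorted_wrt_dedup)
  then show "sorted_wrt (\<lambda>w w'. \<not> sim w w') ?ws"
    unfolding next_reps_def sorted_wrt_map
    using exts_subset by (elim sorted_wrt_mono_rel[rotated]) (simp add: same_ext_iff)
qed

end

lemma separated_inv:
  assumes "invariant ws s u"
  shows "length ws \<le> k"
proof -
  have cls: "\<And>w. w \<in> set ws \<Longrightarrow> (w, u) \<in> R" and srt: "sorted_wrt (\<lambda>w w'. \<not> sim w w') ws"
    using assms unfolding invariant_def by blast+
  have sim: "\<not> sim (ws ! i) (ws ! j)" if "i < j" "j < length ws" for i j
    using sorted_wrt_nth_less[OF srt that] .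
  have "ws ! i \<noteq> ws ! j" if ij: "i < length ws" "j < length ws" "i \<noteq> j" for i j
  proof -
    have "sim (ws ! i) (ws ! i)" using cls[OF nth_mem[OF ij(1)]] R_lists sim_refl by blast
    then show ?thesis using sim[of i j] sim[of j i] ij by (cases "i < j") auto
  qed
  then have "distinct ws" unfolding distinct_conv_nth by blast
  moreover have "separated A R (set ws)"
    unfolding separated_iff
  proof (intro ballI conjI impI)
    fix v w assume vw: "v \<in> set ws" "w \<in> set ws"
    then show "(v, w) \<in> R" using cls R_trans R_sym by blast
    assume "v \<noteq> w"
    obtain i j where ij: "i < length ws" "j < length ws" "v = ws ! i" "w = ws ! j"
      using vw by (auto simp: in_set_conv_nth)
    then have "i \<noteq> j" using \<open>v \<noteq> w\<close> by auto
    then show "\<not> sim v w" using sim[of i j] sim[of j i] sim_sym ij by (cases "i < j") auto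
  qed
  ultimately show ?thesis using bounded[of "set ws"] by (simp add: distinct_card)
qed

definition sig :: "'a list \<Rightarrow> 'a signature" where
  "sig u = foldl next_sig init_sig u"

text \<open>Letters are appended on the right and each step needs the signature of the prefix, so
  the recursion goes over the reversed word.\<close>

fun rev_reps :: "'a list \<Rightarrow> 'a list list" where
  "rev_reps [] = [[]]"
| "rev_reps (a # u) = next_reps (rev_reps u) (sig (rev u)) a"

definition reps :: "'a list \<Rightarrow> 'a list list" where
  "reps u = rev_reps (rev u)"

lemma reps_simps [simp]:
  "reps [] = [[]]" "reps (u @ [a]) = next_reps (reps u) (sig u) a"
  by (simp_all add: reps_def)

lemma sig_simps [simp]: "sig [] = init_sig" "sig (u @ [a]) = next_sig (sig u) a"
  by (simp_all add: sig_def)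

lemma inv_reps: "u \<in> lists A \<Longrightarrow> invariant (reps u) (sig u) u"
proof (induction u rule: rev_induct)
  case (snoc a u)
  then show ?case using inv_step[of "reps u" "sig u" u a] by simp
qed (simp add: inv_init)

text \<open>Equal representatives give equal matrices. The indices \<open>fst s\<close> and
  \<open>fst t\<close> may differ, but both filters describe membership in the same new
  \<open>R\<close>-class.\<close>

lemma exts_cong:
  assumes "invariant ws s u" "invariant ws t v" "a \<in> A" "b \<in> A" "(u @ [a], v @ [b]) \<in> R"
  shows "exts s a = exts t b"
proof -
  have "snd s = snd t" using assms by (auto simp: invariant_def)
  then have "same_ext s = same_ext t" by (auto simp: same_ext_def fun_eq_iff)
  moreover have "cands s a = cands t b"
    unfolding cands_def
  proof (rule filter_cong)
    show "List.product [0..<length (snd s)] Al = List.product [0..<length (snd t)] Al"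
      using \<open>snd s = snd t\<close> by simp
    fix p assume p: "p \<in> set (List.product [0..<length (snd t)] Al)"
    have "(w, u @ [a]) \<in> R \<longleftrightarrow> (w, v @ [b]) \<in> R" for w
      using R_trans R_sym assms(5) by blast
    then have "p \<in> set (cands s a) \<longleftrightarrow> p \<in> set (cands t b)"
      unfolding set_cands[OF assms(1,3)] set_cands[OF assms(2,4)] by simp
    then show "([snd p], [a]) \<in> snd s ! fst p ! fst s \<longleftrightarrow> ([snd p], [b]) \<in> snd t ! fst p ! fst t"
      using p \<open>snd s = snd t\<close> unfolding cands_def by simp
  qed
  ultimately show ?thesis by (simp add: exts_def)
qed

text \<open>By prefix closure, related words have related prefixes, so the induction applies. Of a
  signature, only the index depends on the word and not just on its class.\<close>

lemma reps_cong: "(u, v) \<in> R \<Longrightarrow> reps u = reps v"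
proof (induction u arbitrary: v rule: rev_induct)
  case Nil
  then show ?case using R_length by fastforce
next
  case (snoc a u)
  then have "v \<noteq> []" using R_length[OF snoc.prems] by auto
  then obtain v' b where v': "v = v' @ [b]" by (metis rev_exhaust)
  then have *: "(u, v') \<in> R" "a \<in> A" "b \<in> A" "u \<in> lists A" "v' \<in> lists A"
    using pc snoc.prems R_lists[OF snoc.prems] by (auto simp: prefix_closed_def)
  have "reps u = reps v'" using snoc.IH * by blast
  moreover from this have "exts (sig u) a = exts (sig v') b"
    using exts_cong inv_reps * snoc.prems v' by metis
  ultimately show ?case by (simp add: v' next_reps_def)
qed

text \<open>
  The output letter names the \<open>R\<close>-class of the extended word by its first representative, which
  depends on that class only.
\<close>

definition child :: "'a signature \<Rightarrow> 'a \<Rightarrow> nat \<times> 'a" where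
  "child s a = hd (exts s a)"

lemma child_in:
  assumes "u \<in> lists A" "a \<in> A"
  shows "child (sig u) a \<in> set (exts (sig u) a)"
proof -
  note i = inv_reps[OF assms(1)]
  have "exts (sig u) a \<noteq> []"
    using exts_cover[OF i assms(2) idx(1)[OF i assms(2)] assms(2) sim_R[OF idx_ext[OF i assms(2)]]]
    by auto
  then show ?thesis by (simp add: child_def)
qed

text \<open>Equal outputs on the prefixes place these in one class, hence with the same
  representatives; equal last letters then name one representative that is related to both extended
  words.\<close>

lemma mealy_out_eq_iff:
  "u \<in> lists A \<Longrightarrow> v \<in> lists A \<Longrightarrow>
    mealy_out next_sig child init_sig u = mealy_out next_sig child init_sig v \<longleftrightarrow> (u, v) \<in> R"
proof (induction u arbitrary: v rule: rev_induct)
  case Nil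
  show ?case
  proof (cases v)
    case Nil
    then show ?thesis using R_refl[of "[]"] by simp
  next
    case (Cons b v')
    then show ?thesis using R_length[of "[]" v] by auto
  qed
next
  case (snoc a u)
  note IH = snoc.IH and ua = snoc.prems
  show ?case
  proof (cases v rule: rev_cases)
    case Nil
    then show ?thesis using R_length[of "u @ [a]" v] by (auto simp: mealy_out_snoc)
  next
    case (snoc v' b)
    have *: "u \<in> lists A" "a \<in> A" "v' \<in> lists A" "b \<in> A"
      using ua \<open>v = v' @ [b]\<close> by auto
    note iu = inv_reps[OF *(1)] and iv = inv_reps[OF *(3)]
    have "child (sig u) a = child (sig v') b \<longleftrightarrow> (u @ [a], v' @ [b]) \<in> R" if uv: "(u, v') \<in> R"
    proof
      assume c: "child (sig u) a = child (sig v') b"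
      have "(reps u ! fst (child (sig u) a) @ [snd (child (sig u) a)], u @ [a]) \<in> R"
        using exts_subset[OF iu *(2) child_in[OF *(1,2)]] by blast
      moreover have "(reps v' ! fst (child (sig v') b) @ [snd (child (sig v') b)], v' @ [b]) \<in> R"
        using exts_subset[OF iv *(4) child_in[OF *(3,4)]] by blast
      ultimately show "(u @ [a], v' @ [b]) \<in> R"
        using R_trans R_sym unfolding c reps_cong[OF uv] by blast
    next
      assume "(u @ [a], v' @ [b]) \<in> R"
      then have "exts (sig u) a = exts (sig v') b"
        using exts_cong[OF iu[unfolded reps_cong[OF uv]] iv *(2,4)] by simp
      then show "child (sig u) a = child (sig v') b" by (simp add: child_def)
    qed
    then show ?thesis
      using IH[OF *(1,3)] pc unfolding \<open>v = v' @ [b]\<close> mealy_out_snoc prefix_closed_def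
        append1_eq_conv sig_def[symmetric] by blast
  qed
qed

text \<open>A signature is an index below \<open>k\<close> and a matrix with at most
  \<open>k\<close> rows and columns over the finite set of residuals.\<close>

lemma finite_sigs: "finite (sig ` lists A)"
proof (rule finite_subset)
  let ?L = "{xs. set xs \<subseteq> {ys. set ys \<subseteq> residuals A R \<and> length ys \<le> k} \<and> length xs \<le> k}"
  show "finite ({..<k} \<times> ?L)"
    using fin_res by (intro finite_cartesian_product finite_lists_length_le) auto
  have "sig u \<in> {..<k} \<times> ?L" if "u \<in> lists A" for u
  proof -
    note i = inv_reps[OF that]
    have R: "(w, u) \<in> R" if "w \<in> set (reps u)" for w using i that unfolding invariant_def by blast
    have "der w w' R \<in> residuals A R" if "w \<in> set (reps u)" "w' \<in> set (reps u)" for w w'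
      using R[OF that(1)] R[OF that(2)] R_lists R_length by (intro residualsI) fastforce+
    moreover have "fst (sig u) < length (reps u)"
      "snd (sig u) = map (\<lambda>w. map (\<lambda>w'. der w w' R) (reps u)) (reps u)"
      using i unfolding invariant_def by blast+
    ultimately show ?thesis using separated_inv[OF i] by (auto simp: mem_Times_iff)
  qed
  then show "sig ` lists A \<subseteq> {..<k} \<times> ?L" by blast
qed

lemma sig_closed: "s \<in> sig ` lists A \<Longrightarrow> a \<in> A \<Longrightarrow> next_sig s a \<in> sig ` lists A"
proof -
  assume "s \<in> sig ` lists A" "a \<in> A"
  then obtain u where "u \<in> lists A" "s = sig u" by blast
  then show ?thesis using \<open>a \<in> A\<close> by (intro image_eqI[of _ _ "u @ [a]"]) auto
qed

end

lemma mealy_out_comp: "mealy_out \<delta> (\<lambda>s a. h (out s a)) s u = map h (mealy_out \<delta> out s u)"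
  by (induction u arbitrary: s) auto

lemma set_mealy_out:
  assumes "\<And>s a. s \<in> S \<Longrightarrow> a \<in> A \<Longrightarrow> \<delta> s a \<in> S"
  shows "s \<in> S \<Longrightarrow> u \<in> lists A \<Longrightarrow> set (mealy_out \<delta> out s u) \<subseteq> (\<lambda>(s, a). out s a) ` (S \<times> A)"
  using assms by (induction u arbitrary: s) auto

context bounded_candidate
begin

lemma KerSeq_ll: "R \<in> KerSeq_ll A"
proof -
  let ?S = "sig ` lists A"
  have init: "init_sig \<in> ?S" by (rule image_eqI[of _ _ "[]"]) auto
  \<comment> \<open>The output letters that occur form a finite set of pairs, which is renamed
    injectively into the naturals.\<close>
  define H where "H = (\<lambda>(s, a). child s a) ` (?S \<times> A)"
  have "finite H" unfolding H_def using finite_sigs finite_A by blast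
  then obtain h :: "nat \<times> 'a \<Rightarrow> nat" where h: "inj_on h H"
    using finite_imp_inj_to_nat_seg by blast
  let ?f = "mealy_out next_sig (\<lambda>s a. h (child s a)) init_sig"
  have "?f u = ?f v \<longleftrightarrow> (u, v) \<in> R" if "u \<in> lists A" "v \<in> lists A" for u v
  proof -
    have "set (mealy_out next_sig child init_sig w) \<subseteq> H" if "w \<in> lists A" for w
      unfolding H_def by (rule set_mealy_out[OF sig_closed init that])
    then have "?f u = ?f v \<longleftrightarrow> mealy_out next_sig child init_sig u = mealy_out next_sig child init_sig v"
      unfolding mealy_out_comp using that by (intro inj_on_map_eq_map inj_on_subset[OF h]) simp
    then show ?thesis using mealy_out_eq_iff[OF that] by simp
  qed
  then have "(u, v) \<in> kernel A ?f \<longleftrightarrow> (u, v) \<in> R" for u v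
    using R_lists[of u v] unfolding kernel_def mem_Collect_eq case_prod_conv by meson
  then have "kernel A ?f = R" by (simp only: set_eq_iff split_paired_All) simp
  moreover have "kernel A ?f \<in> KerSeq_ll A"
    using mealy_kernel[OF finite_A finite_sigs init sig_closed] .
  ultimately show ?thesis by simp
qed

end

section \<open>Pumping in automata with unboundedly many runs\<close>

text \<open>\<open>E \<subseteq> E O E\<close> allows an endless chain of points to be inserted
  between \<open>p\<close> and \<open>q\<close>. The range is finite, so a point repeats, and
  transitivity turns the repetition into a loop.\<close>

lemma idempotent_loop:
  assumes E: "E O E = E" and fin: "finite (Range E)" and pq: "(p, q) \<in> E"
  obtains l where "(p, l) \<in> E" "(l, l) \<in> E" "(l, q) \<in> E"
proof -
  have tr: "trans E" unfolding trans_def using E by blast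
  have "\<exists>x. \<forall>n. ((p, x n) \<in> E \<and> (x n, q) \<in> E) \<and> (x n, x (Suc n)) \<in> E"
  proof (rule dependent_nat_choice)
    show "\<exists>x. (p, x) \<in> E \<and> (x, q) \<in> E" using pq E by blast
    fix x and n :: nat assume x: "(p, x) \<in> E \<and> (x, q) \<in> E"
    then obtain y where "(x, y) \<in> E" "(y, q) \<in> E" using E by blast
    then show "\<exists>y. ((p, y) \<in> E \<and> (y, q) \<in> E) \<and> (x, y) \<in> E"
      using x tr by (meson transD)
  qed
  then obtain x where x: "\<And>n. (p, x n) \<in> E" "\<And>n. (x n, q) \<in> E" "\<And>n. (x n, x (Suc n)) \<in> E"
    by blast
  have lt: "(x i, x j) \<in> E" if "i < j" for i j
    using that
  proof (induction j)
    case (Suc j)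
    then show ?case using x(3)[of j] tr by (cases "i = j") (auto dest: transD)
  qed simp
  have "range x \<subseteq> Range E" using x(1) by blast
  then have "finite (range x)" using fin finite_subset by blast
  then have "\<not> inj x" using finite_imageD by fastforce
  then obtain i j where "x i = x j" "i \<noteq> j" by (auto simp: inj_def)
  then have "(x i, x i) \<in> E" using lt[of i j] lt[of j i] by (cases "i < j") auto
  then show thesis using that x by blast
qed

text \<open>\<open>P\<close> is the set of levels at which the prefix tree of \<open>V\<close>
  branches. Two distinct words first differ at such a level, so a word is determined by its letters
  at the positions in \<open>P\<close>.\<close>

lemma card_le_branching:
  assumes fin: "finite B" and V: "\<And>v. v \<in> V \<Longrightarrow> v \<in> lists B \<and> length v = n"
    and P: "P = {t. t < n \<and> (\<exists>v \<in> V. \<exists>v' \<in> V. take t v = take t v' \<and> v ! t \<noteq> v' ! t)}"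
  shows "card V \<le> card B ^ card P"
proof -
  have finP: "finite P" by (simp add: P)
  have "inj_on (\<lambda>v. restrict (\<lambda>t. v ! t) P) V"
  proof (rule inj_onI, rule ccontr)
    fix v v' assume v: "v \<in> V" "v' \<in> V" "restrict ((!) v) P = restrict ((!) v') P" "v \<noteq> v'"
    then have len: "length v = n" "length v' = n" using V by blast+
    then have ex: "\<exists>t. t < n \<and> v ! t \<noteq> v' ! t" using v(4) nth_equalityI by metis
    define t where "t = (LEAST t. t < n \<and> v ! t \<noteq> v' ! t)"
    have t: "t < n \<and> v ! t \<noteq> v' ! t" unfolding t_def by (rule LeastI_ex[OF ex])
    have "v ! i = v' ! i" if "i < t" for i
      using that t not_less_Least[of i "\<lambda>t. t < n \<and> v ! t \<noteq> v' ! t"] unfolding t_def by auto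
    then have "take t v = take t v'" using t len by (intro nth_take_lemma) auto
    then have "t \<in> P" using t v unfolding P by blast
    then show False using v(3) t by (metis restrict_apply)
  qed
  moreover have "(\<lambda>v. restrict (\<lambda>t. v ! t) P) ` V \<subseteq> P \<rightarrow>\<^sub>E B"
  proof (intro image_subsetI)
    fix v assume "v \<in> V"
    then have "set v \<subseteq> B" "length v = n" using V by blast+
    then show "restrict (\<lambda>t. v ! t) P \<in> P \<rightarrow>\<^sub>E B" by (auto simp: P)
  qed
  moreover have "finite (P \<rightarrow>\<^sub>E B)" using fin finP by (intro finite_PiE)
  ultimately have "card V \<le> card (P \<rightarrow>\<^sub>E B)" by (rule card_inj_on_le)
  then show ?thesis using finP by (simp add: card_PiE)
qed

lemma foldl_zip_append:
  "length u = length v \<Longrightarrow> foldl \<delta> p (zip (u @ u') (v @ v')) = foldl \<delta> (foldl \<delta> p (zip u v)) (zip u' v')"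
  by simp

text \<open>Homogeneous sets of size four are needed because four cut points bound three adjacent
  blocks: one before a branching, one starting with it, one after. \<open>N\<close> depends only on
  the colours and can be fixed before the word is chosen.\<close>

lemma ramsey_chain:
  assumes "finite C"
  shows "\<exists>N :: nat. \<forall>c. (\<forall>i j. c i j \<in> C) \<longrightarrow> (\<exists>i0 i1 i2 i3 e. i0 < i1 \<and> i1 < i2 \<and> i2 < i3 \<and> i3 < N \<and>
       c i0 i1 = e \<and> c i1 i2 = e \<and> c i2 i3 = e \<and> c i0 i2 = e \<and> c i1 i3 = e \<and> c i0 i3 = (e :: 'c))"
proof -
  obtain h where h: "bij_betw h C {0..<card C}" using ex_bij_betw_finite_nat[OF assms] by blast
  obtain N :: nat where N: "partn_lst {..<N} (replicate (card C) 4) 2"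
    using ramsey_full by blast
  have "\<exists>i0 i1 i2 i3 e. i0 < i1 \<and> i1 < i2 \<and> i2 < i3 \<and> i3 < N \<and>
       c i0 i1 = e \<and> c i1 i2 = e \<and> c i2 i3 = e \<and> c i0 i2 = e \<and> c i1 i3 = e \<and> c i0 i3 = e"
    if c: "\<And>i j. c i j \<in> C" for c :: "nat \<Rightarrow> nat \<Rightarrow> 'c"
  proof -
    \<comment> \<open>An ordered pair is recovered from a two-element set by \<open>Min\<close> and
      \<open>Max\<close>.\<close>
    define f where "f = (\<lambda>X :: nat set. h (c (Min X) (Max X)))"
    have "f \<in> nsets {..<N} 2 \<rightarrow> {..<length (replicate (card C) 4)}"
      using h c by (auto simp: f_def bij_betw_def)
    then obtain i where "i < card C" "monochromatic {..<N} 4 2 f i"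
      using N unfolding partn_lst_def by (metis length_replicate nth_replicate)
    then obtain H where H: "H \<in> nsets {..<N} 4" "f ` nsets H 2 \<subseteq> {i}"
      by (auto simp: monochromatic_def)
    then have finH: "finite H" and cardH: "card H = 4" and HN: "H \<subseteq> {..<N}"
      by (auto simp: nsets_def)
    define xs where "xs = sorted_list_of_set H"
    have xs: "length xs = 4" "sorted_wrt (<) xs" "set xs = H"
      using finH cardH by (auto simp: xs_def)
    have lt: "xs ! a < xs ! b" if "a < b" "b < 4" for a b
      using sorted_wrt_nth_less[OF xs(2)] that xs(1) by auto
    have col: "h (c (xs ! a) (xs ! b)) = i" if "a < b" "b < 4" for a b
    proof -
      have l: "xs ! a < xs ! b" using lt that by blast
      have "{xs ! a, xs ! b} \<in> nsets H 2"
        using l that xs nth_mem[of a xs] nth_mem[of b xs] by (auto simp: nsets_def)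
      then have "f {xs ! a, xs ! b} = i" using H(2) by blast
      then show ?thesis using l by (simp add: f_def)
    qed
    have inj: "inj_on h C" using h by (simp add: bij_betw_def)
    have eq: "c (xs ! a) (xs ! b) = c (xs ! 0) (xs ! 1)" if "a < b" "b < 4" for a b
      using inj_onD[OF inj _ c c] col[OF that] col[of 0 1] by simp
    have "xs ! 3 < N" using HN xs nth_mem[of 3 xs] by auto
    then show ?thesis
      using lt[of 0 1] lt[of 1 2] lt[of 2 3] eq[of 1 2] eq[of 2 3] eq[of 0 2] eq[of 1 3] eq[of 0 3]
      by (intro exI[of _ "xs ! 0"] exI[of _ "xs ! 1"] exI[of _ "xs ! 2"] exI[of _ "xs ! 3"]
          exI[of _ "c (xs ! 0) (xs ! 1)"]) simp
  qed
  then show ?thesis by blast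
qed

text \<open>The automaton projected to its first tape, with the second tape guessed; concatenation
  of words becomes composition of these relations.\<close>

definition reach_rel :: "('q \<Rightarrow> 'a \<times> 'b \<Rightarrow> 'q) \<Rightarrow> 'q set \<Rightarrow> 'b set \<Rightarrow> 'a list \<Rightarrow> ('q \<times> 'q) set" where
  "reach_rel \<delta> Q B w =
     {(p, q). p \<in> Q \<and> q \<in> Q \<and> (\<exists>y \<in> lists B. length y = length w \<and> foldl \<delta> p (zip w y) = q)}"

lemma foldl_closed:
  assumes "\<And>q a b. q \<in> Q \<Longrightarrow> a \<in> A \<Longrightarrow> b \<in> B \<Longrightarrow> \<delta> q (a, b) \<in> Q"
  shows "q \<in> Q \<Longrightarrow> u \<in> lists A \<Longrightarrow> v \<in> lists B \<Longrightarrow> foldl \<delta> q (zip u v) \<in> Q"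
proof (induction u arbitrary: q v)
  case (Cons a u)
  then show ?case using assms by (cases v) auto
qed simp

lemma reach_rel_append:
  assumes closed: "\<And>q a b. q \<in> Q \<Longrightarrow> a \<in> A \<Longrightarrow> b \<in> B \<Longrightarrow> \<delta> q (a, b) \<in> Q" and w: "w \<in> lists A"
  shows "reach_rel \<delta> Q B (w @ w') = reach_rel \<delta> Q B w O reach_rel \<delta> Q B w'"
proof (intro equalityI subrelI)
  fix p q assume "(p, q) \<in> reach_rel \<delta> Q B (w @ w')"
  then obtain y where y: "p \<in> Q" "q \<in> Q" "y \<in> lists B" "length y = length (w @ w')"
    "foldl \<delta> p (zip (w @ w') y) = q" unfolding reach_rel_def by blast
  define y1 y2 where "y1 = take (length w) y" and "y2 = drop (length w) y"
  have yy: "y = y1 @ y2" "length y1 = length w" "length y2 = length w'"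
    using y(4) by (auto simp: y1_def y2_def)
  then have B: "y1 \<in> lists B" "y2 \<in> lists B" using y(3) by auto
  have r: "foldl \<delta> p (zip w y1) \<in> Q"
    using foldl_closed[where Q = Q and A = A and B = B and \<delta> = \<delta>] closed y(1) w B(1) by blast
  have "foldl \<delta> (foldl \<delta> p (zip w y1)) (zip w' y2) = q" using y(5) yy by simp
  then have "(p, foldl \<delta> p (zip w y1)) \<in> reach_rel \<delta> Q B w" "(foldl \<delta> p (zip w y1), q) \<in> reach_rel \<delta> Q B w'"
    using y r yy B unfolding reach_rel_def by blast+
  then show "(p, q) \<in> reach_rel \<delta> Q B w O reach_rel \<delta> Q B w'" by blast
next
  fix p q assume "(p, q) \<in> reach_rel \<delta> Q B w O reach_rel \<delta> Q B w'"
  then obtain r where "(p, r) \<in> reach_rel \<delta> Q B w" "(r, q) \<in> reach_rel \<delta> Q B w'" by blast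
  then obtain y y' where y: "p \<in> Q" "q \<in> Q" "y \<in> lists B" "y' \<in> lists B" "length y = length w"
    "length y' = length w'" "foldl \<delta> p (zip w y) = r" "foldl \<delta> r (zip w' y') = q"
    unfolding reach_rel_def by blast
  then have "y @ y' \<in> lists B" "length (y @ y') = length (w @ w')"
    "foldl \<delta> p (zip (w @ w') (y @ y')) = q" by auto
  then show "(p, q) \<in> reach_rel \<delta> Q B (w @ w')" using y(1,2) unfolding reach_rel_def by blast
qed

text \<open>The first tape is cut at branching levels, and Ramsey's theorem makes all blocks between
  four of them act as one idempotent relation \<open>E\<close>. Idempotency provides a looping state
  \<open>l\<close> before the branching and a looping state \<open>m\<close> after it. The loop
  words \<open>s1\<close>, \<open>s3\<close> and the passage \<open>s2\<close> from \<open>l\<close>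
  to \<open>m\<close> are all read over the same \<open>w\<close>; the branching makes it possible
  to choose \<open>s2\<close> different from \<open>s1\<close>.\<close>

theorem unbounded_pattern:
  fixes \<delta> :: "'q \<Rightarrow> 'a \<times> 'b \<Rightarrow> 'q"
  assumes finQ: "finite Q" and q0: "q0 \<in> Q" and finB: "finite B"
    and closed: "\<And>q a b. q \<in> Q \<Longrightarrow> a \<in> A \<Longrightarrow> b \<in> B \<Longrightarrow> \<delta> q (a, b) \<in> Q"
    and unbounded: "\<And>k. \<exists>u \<in> lists A.
      k < card {v \<in> lists B. length v = length u \<and> foldl \<delta> q0 (zip u v) \<in> F}"
  obtains x z w s1 s2 s3 y t l m where
    "w \<in> lists A" "z \<in> lists B" "s1 \<in> lists B" "s2 \<in> lists B" "s3 \<in> lists B" "t \<in> lists B"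
    "length x = length z" "length s1 = length w" "length s2 = length w" "length s3 = length w"
    "length y = length t" "s1 \<noteq> s2"
    "foldl \<delta> q0 (zip x z) = l" "foldl \<delta> l (zip w s1) = l" "foldl \<delta> l (zip w s2) = m"
    "foldl \<delta> m (zip w s3) = m" "foldl \<delta> m (zip y t) \<in> F"
    "x \<in> lists A" "y \<in> lists A"
proof -
  have "finite (Pow (Q \<times> Q))" using finQ by simp
  from ramsey_chain[OF this] obtain N :: nat where
    N: "\<forall>c. (\<forall>i j. c i j \<in> Pow (Q \<times> Q)) \<longrightarrow> (\<exists>i0 i1 i2 i3 e. i0 < i1 \<and> i1 < i2 \<and> i2 < i3 \<and> i3 < N \<and>
       c i0 i1 = e \<and> c i1 i2 = e \<and> c i2 i3 = e \<and> c i0 i2 = e \<and> c i1 i3 = e \<and> c i0 i3 = e)"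
    by blast
  \<comment> \<open>The added 1 keeps the base positive, so comparing powers compares exponents and
    more than \<open>N\<close> branching levels result.\<close>
  obtain u where u: "u \<in> lists A"
    and big: "(card B + 1) ^ N < card {v \<in> lists B. length v = length u \<and> foldl \<delta> q0 (zip u v) \<in> F}"
    using unbounded by blast
  define V where "V = {v \<in> lists B. length v = length u \<and> foldl \<delta> q0 (zip u v) \<in> F}"
  define P where "P = {t. t < length u \<and> (\<exists>v \<in> V. \<exists>v' \<in> V. take t v = take t v' \<and> v ! t \<noteq> v' ! t)}"
  have VB: "v \<in> lists B" "length v = length u" "foldl \<delta> q0 (zip u v) \<in> F" if "v \<in> V" for v
    using that unfolding V_def by blast+
  have "card V \<le> card B ^ card P"
    by (rule card_le_branching[OF finB _ P_def]) (use VB in blast)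
  also have "\<dots> \<le> (card B + 1) ^ card P" by (rule power_mono) auto
  finally have "(card B + 1) ^ N < (card B + 1) ^ card P" using big[folded V_def] by linarith
  then have NP: "N < card P"
    using power_increasing[of "card P" N "card B + 1"] by (cases "card P \<le> N") auto
  have finP: "finite P" unfolding P_def by simp
  define ts where "ts = sorted_list_of_set P"
  have ts: "length ts = card P" "sorted_wrt (<) ts" "set ts = P"
    using finP by (auto simp: ts_def)
  define seg :: "nat \<Rightarrow> nat \<Rightarrow> 'a list" where "seg i j = take (ts ! j - ts ! i) (drop (ts ! i) u)" for i j
  define c where "c = (\<lambda>i j. reach_rel \<delta> Q B (seg i j))"
  have "c i j \<in> Pow (Q \<times> Q)" for i j unfolding c_def reach_rel_def by blast
  then have "\<exists>i0 i1 i2 i3 e. i0 < i1 \<and> i1 < i2 \<and> i2 < i3 \<and> i3 < N \<and>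
       c i0 i1 = e \<and> c i1 i2 = e \<and> c i2 i3 = e \<and> c i0 i2 = e \<and> c i1 i3 = e \<and> c i0 i3 = e"
    using N[rule_format, of c] by blast
  then obtain i0 i1 i2 i3 E where i: "i0 < i1" "i1 < i2" "i2 < i3" "i3 < N"
    and cE: "c i0 i1 = E" "c i1 i2 = E" "c i2 i3 = E" "c i0 i2 = E" "c i0 i3 = E"
    by (elim exE conjE)
  define t0 t1 t2 t3 where t_def: "t0 = ts ! i0" "t1 = ts ! i1" "t2 = ts ! i2" "t3 = ts ! i3"
  have t: "t0 < t1" "t1 < t2" "t2 < t3"
    unfolding t_def using i NP ts sorted_wrt_nth_less[OF ts(2)] by simp_all
  have "t1 \<in> P" "t3 \<in> P" unfolding t_def ts(3)[symmetric] using i NP ts(1) by simp_all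
  then have t3: "t3 < length u" unfolding P_def by blast
  \<comment> \<open>The two words agree before the branching level \<open>t1\<close>, so their runs
    are in the same state there.\<close>
  obtain v v' where v: "v \<in> V" "v' \<in> V" "take t1 v = take t1 v'" "v ! t1 \<noteq> v' ! t1"
    using \<open>t1 \<in> P\<close> unfolding P_def by blast
  define sg :: "'b list \<Rightarrow> nat \<Rightarrow> nat \<Rightarrow> 'b list" where "sg y i j = take (j - i) (drop i y)" for y i j
  define ug :: "nat \<Rightarrow> nat \<Rightarrow> 'a list" where "ug i j = take (j - i) (drop i u)" for i j
  have E01: "reach_rel \<delta> Q B (ug t0 t1) = E" and E12: "reach_rel \<delta> Q B (ug t1 t2) = E"
    and E23: "reach_rel \<delta> Q B (ug t2 t3) = E" and E02: "reach_rel \<delta> Q B (ug t0 t2) = E"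
    and E03: "reach_rel \<delta> Q B (ug t0 t3) = E"
    using cE unfolding c_def seg_def ug_def t_def by blast+
  have ug_lists: "ug i j \<in> lists A" for i j
    using u unfolding ug_def by (auto dest!: in_set_takeD in_set_dropD)
  have ug_app: "ug i k = ug i j @ ug j k" if "i \<le> j" "j \<le> k" for i j k
  proof -
    have "take (k - i) (drop i u) = take (j - i + (k - j)) (drop i u)" using that by simp
    also have "\<dots> = take (j - i) (drop i u) @ take (k - j) (drop (j - i) (drop i u))"
      by (rule take_add)
    finally show ?thesis using that by (simp add: ug_def)
  qed
  have "E O E = E"
    using reach_rel_append[where Q = Q and A = A and B = B and \<delta> = \<delta> and w = "ug t0 t1" and w' = "ug t1 t2"]
      closed ug_lists E01 E12 E02 ug_app[of t0 t1 t2] t by simp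
  moreover have "finite (Range E)"
  proof -
    have "Range E \<subseteq> Q" unfolding E01[symmetric] reach_rel_def by blast
    then show ?thesis using finQ finite_subset by blast
  qed
  ultimately have loop: "\<exists>l. (p, l) \<in> E \<and> (l, l) \<in> E \<and> (l, q) \<in> E" if "(p, q) \<in> E" for p q
    by (rule idempotent_loop[OF _ _ that]) blast
  define st where "st = (\<lambda>y i. foldl \<delta> q0 (zip (take i u) (take i y)))"
  have st_Q: "st y i \<in> Q" if "y \<in> V" for y i
  proof -
    have "take i u \<in> lists A" "take i y \<in> lists B"
      using u VB[OF that] by (auto dest!: in_set_takeD)
    then show ?thesis unfolding st_def
      using foldl_closed[where Q = Q and A = A and B = B and \<delta> = \<delta>] closed q0 by blast
  qed
  have sg_lists: "sg y i j \<in> lists B" if "y \<in> V" for y i j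
    using VB[OF that] unfolding sg_def by (auto dest!: in_set_takeD in_set_dropD)
  have sg_len: "length (sg y i j) = length (ug i j)" if "y \<in> V" for y i j
    using VB[OF that] unfolding sg_def ug_def by simp
  have st_step: "foldl \<delta> (st y i) (zip (ug i j) (sg y i j)) = st y j" if y: "y \<in> V" and ij: "i \<le> j" for y i j
  proof -
    have "take j u = take i u @ ug i j" "take j y = take i y @ sg y i j"
      unfolding ug_def sg_def using take_add[of i "j - i"] ij by simp_all
    moreover have "length (take i u) = length (take i y)" using VB[OF y] by simp
    ultimately show ?thesis unfolding st_def by simp
  qed
  have st_E: "(st y i, st y j) \<in> reach_rel \<delta> Q B (ug i j)" if "y \<in> V" "i \<le> j" for y i j
    using st_step[OF that] st_Q sg_lists sg_len that unfolding reach_rel_def by blast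
  have st_F: "foldl \<delta> (st y t3) (zip (drop t3 u) (drop t3 y)) \<in> F" if y: "y \<in> V" for y
  proof -
    have "length (take t3 u) = length (take t3 y)" using VB[OF y] by simp
    then have "foldl \<delta> q0 (zip (take t3 u @ drop t3 u) (take t3 y @ drop t3 y)) =
        foldl \<delta> (st y t3) (zip (drop t3 u) (drop t3 y))"
      unfolding st_def by (rule foldl_zip_append)
    then show ?thesis using VB(3)[OF y] by simp
  qed
  have E_D: "\<exists>y \<in> lists B. length y = length w \<and> foldl \<delta> p (zip w y) = q"
    if "(p, q) \<in> E" "reach_rel \<delta> Q B w = E" for p q w
    using that unfolding reach_rel_def by blast
  define p where "p = st v t1"
  have p': "st v' t1 = p" unfolding p_def st_def using v(3) by simp
  have "(st v t0, p) \<in> E" unfolding p_def using st_E[OF v(1), of t0 t1] E01 t by simp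
  then obtain l where l: "(st v t0, l) \<in> E" "(l, l) \<in> E" "(l, p) \<in> E" using loop by blast
  \<comment> \<open>The loop word spans all three blocks. Its relation is still \<open>E\<close>,
    and a passage over it factors into a way from \<open>l\<close> to \<open>p\<close>, the original
    letters of \<open>v\<close> or \<open>v'\<close> from the branching on, and a way to
    \<open>m\<close>.\<close>
  define w where "w = ug t0 t3"
  have w: "w = ug t0 t1 @ ug t1 t2 @ ug t2 t3"
    unfolding w_def using ug_app[of t0 t1 t3] ug_app[of t1 t2 t3] t by simp
  obtain y0 where y0: "y0 \<in> lists B" "length y0 = length w" "foldl \<delta> (st v t0) (zip w y0) = l"
    using E_D[OF l(1) E03] w_def by blast
  obtain s1 where s1: "s1 \<in> lists B" "length s1 = length w" "foldl \<delta> l (zip w s1) = l"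
    using E_D[OF l(2) E03] w_def by blast
  obtain a where a: "a \<in> lists B" "length a = length (ug t0 t1)" "foldl \<delta> l (zip (ug t0 t1) a) = p"
    using E_D[OF l(3) E01] by blast
  have branch: "\<exists>c m s3 d. c \<in> lists B \<and> s3 \<in> lists B \<and> d \<in> lists B \<and> length c = length (ug t2 t3) \<and>
      length s3 = length w \<and> length d = length w \<and>
      foldl \<delta> l (zip w (a @ sg y t1 t2 @ c)) = m \<and> foldl \<delta> m (zip w s3) = m \<and>
      foldl \<delta> m (zip (w @ drop t3 u) (d @ drop t3 y)) \<in> F"
    if y: "y \<in> V" and yp: "st y t1 = p" for y
  proof -
    have "(st y t2, st y t3) \<in> E" using st_E[OF y, of t2 t3] E23 t by simp
    then obtain m where m: "(st y t2, m) \<in> E" "(m, m) \<in> E" "(m, st y t3) \<in> E" using loop by blast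
    obtain c where c: "c \<in> lists B" "length c = length (ug t2 t3)" "foldl \<delta> (st y t2) (zip (ug t2 t3) c) = m"
      using E_D[OF m(1) E23] by blast
    obtain s3 where s3: "s3 \<in> lists B" "length s3 = length w" "foldl \<delta> m (zip w s3) = m"
      using E_D[OF m(2) E03] w_def by blast
    obtain d where d: "d \<in> lists B" "length d = length w" "foldl \<delta> m (zip w d) = st y t3"
      using E_D[OF m(3) E03] w_def by blast
    have "foldl \<delta> l (zip w (a @ sg y t1 t2 @ c)) = m"
      unfolding w using a c st_step[OF y, of t1 t2] t yp sg_len[OF y] by simp
    moreover have "foldl \<delta> m (zip (w @ drop t3 u) (d @ drop t3 y)) \<in> F"
      using d st_F[OF y] by simp
    ultimately show ?thesis using c s3 d by blast
  qed
  \<comment> \<open>The passages built from \<open>v\<close> and from \<open>v'\<close> share the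
    prefix \<open>a\<close> and differ in the next letter, so \<open>s1\<close> agrees with at most
    one of them.\<close>
  have "\<exists>y \<in> V. st y t1 = p \<and> (\<forall>c. length c = length (ug t2 t3) \<longrightarrow> a @ sg y t1 t2 @ c \<noteq> s1)"
  proof (rule ccontr)
    assume "\<not> ?thesis"
    then have no: "\<exists>c. a @ sg y t1 t2 @ c = s1" if "y \<in> V" "st y t1 = p" for y
      using that by blast
    obtain c where c: "a @ sg v t1 t2 @ c = s1" using no[OF v(1) p_def[symmetric]] by blast
    obtain c' where c': "a @ sg v' t1 t2 @ c' = s1" using no[OF v(2) p'] by blast
    have "sg v t1 t2 @ c = sg v' t1 t2 @ c'" using c c' by (metis same_append_eq)
    moreover have "length (sg v t1 t2) = length (sg v' t1 t2)"
      using sg_len[OF v(1), of t1 t2] sg_len[OF v(2), of t1 t2] by simp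
    ultimately have "sg v t1 t2 = sg v' t1 t2" by simp
    then have "sg v t1 t2 ! 0 = sg v' t1 t2 ! 0" by simp
    then show False
      using v(4) t t3 VB(2)[OF v(1)] VB(2)[OF v(2)] unfolding sg_def by simp
  qed
  then obtain y where y: "y \<in> V" "st y t1 = p"
    "\<And>c. length c = length (ug t2 t3) \<Longrightarrow> a @ sg y t1 t2 @ c \<noteq> s1" by blast
  obtain c m s3 d where b: "c \<in> lists B" "s3 \<in> lists B" "d \<in> lists B" "length c = length (ug t2 t3)"
      "length s3 = length w" "length d = length w"
      "foldl \<delta> l (zip w (a @ sg y t1 t2 @ c)) = m" "foldl \<delta> m (zip w s3) = m"
      "foldl \<delta> m (zip (w @ drop t3 u) (d @ drop t3 y)) \<in> F"
    using branch[OF y(1,2)] by blast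
  \<comment> \<open>One extra copy of \<open>w\<close> is inserted at either end: reading
    \<open>y0\<close> over it leads into \<open>l\<close>, reading \<open>d\<close> over it leads
    out of \<open>m\<close>.\<close>
  show thesis
  proof (rule that[of w "take t0 v @ y0" s1 "a @ sg y t1 t2 @ c" s3 "d @ drop t3 y"
        "take t0 u @ w" "w @ drop t3 u" l m])
    show "w \<in> lists A" unfolding w_def by (rule ug_lists)
    show "take t0 v @ y0 \<in> lists B" using y0 VB(1)[OF v(1)] by (auto dest: in_set_takeD)
    show "s1 \<in> lists B" "s3 \<in> lists B" using s1 b by blast+
    show "a @ sg y t1 t2 @ c \<in> lists B" using a b sg_lists[OF y(1), of t1 t2] by simp
    show "d @ drop t3 y \<in> lists B" using b VB(1)[OF y(1)] by (auto dest: in_set_dropD)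
    show "length (take t0 u @ w) = length (take t0 v @ y0)" using y0 VB(2)[OF v(1)] by simp
    show "length s1 = length w" "length s3 = length w" using s1 b by blast+
    show "length (a @ sg y t1 t2 @ c) = length w"
      using a b sg_len[OF y(1), of t1 t2] by (simp add: w)
    show "length (w @ drop t3 u) = length (d @ drop t3 y)" using b VB(2)[OF y(1)] by simp
    show "s1 \<noteq> a @ sg y t1 t2 @ c" using y(3)[OF b(4)] by metis
    have "foldl \<delta> q0 (zip (take t0 u @ w) (take t0 v @ y0)) = foldl \<delta> (st v t0) (zip w y0)"
      unfolding st_def by (rule foldl_zip_append) (use VB(2)[OF v(1)] in simp)
    then show "foldl \<delta> q0 (zip (take t0 u @ w) (take t0 v @ y0)) = l" using y0 by simp
    show "foldl \<delta> l (zip w s1) = l" using s1 by blast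
    show "foldl \<delta> l (zip w (a @ sg y t1 t2 @ c)) = m" "foldl \<delta> m (zip w s3) = m"
      "foldl \<delta> m (zip (w @ drop t3 u) (d @ drop t3 y)) \<in> F" using b by blast+
    show "take t0 u @ w \<in> lists A" using u ug_lists[of t0 t3] by (auto simp: w_def dest: in_set_takeD)
    show "w @ drop t3 u \<in> lists A" using u ug_lists[of t0 t3] by (auto simp: w_def dest: in_set_dropD)
  qed
qed

section \<open>Pumpable relations\<close>

abbreviation word_pow :: "nat \<Rightarrow> 'a list \<Rightarrow> 'a list" where
  "word_pow n s \<equiv> concat (replicate n s)"

lemma word_pow_lists: "s \<in> lists A \<Longrightarrow> word_pow n s \<in> lists A"
  by (induction n) auto

lemma length_word_pow [simp]: "length (word_pow n s) = n * length s"
  by (induction n) auto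

lemma word_pow_add: "word_pow (m + n) s = word_pow m s @ word_pow n s"
  by (simp add: replicate_add)

lemma der_word_pow: "der (word_pow n s) (word_pow n s') r = (der s s' ^^ n) r"
proof (induction n arbitrary: r)
  case (Suc n)
  have "der (word_pow (Suc n) s) (word_pow (Suc n) s') r = der (word_pow n s) (word_pow n s') (der s s' r)"
    by simp
  also have "\<dots> = (der s s' ^^ n) (der s s' r)" by (rule Suc)
  finally show ?case by (simp add: funpow_swap1)
qed simp

text \<open>
  Both words have the form \<open>z s1\<^sup>k s2 s3\<^sup>l t\<close> with the same \<open>k + l\<close>, once with
  \<open>k = i\<close> and once with \<open>k = i + a + 1\<close>; they are factored so that they can be read blockwise
  in parallel.
\<close>

definition pump1 :: "'a list \<Rightarrow> 'a list \<Rightarrow> 'a list \<Rightarrow> 'a list \<Rightarrow> 'a list \<Rightarrow> nat \<Rightarrow> nat \<Rightarrow> nat \<Rightarrow> 'a list" where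
  "pump1 z s1 s2 s3 t i a b = z @ word_pow i s1 @ s2 @ word_pow a s3 @ s3 @ word_pow b s3 @ t"

definition pump2 :: "'a list \<Rightarrow> 'a list \<Rightarrow> 'a list \<Rightarrow> 'a list \<Rightarrow> 'a list \<Rightarrow> nat \<Rightarrow> nat \<Rightarrow> nat \<Rightarrow> 'a list" where
  "pump2 z s1 s2 s3 t i a b = z @ word_pow i s1 @ s1 @ word_pow a s1 @ s2 @ word_pow b s3 @ t"

text \<open>Blockwise reading turns the exponents into iterates of maps on a finite set of
  residuals, where they can be reduced.\<close>

definition pump_res :: "('a list \<times> 'a list) set \<Rightarrow> 'a list \<Rightarrow> 'a list \<Rightarrow> 'a list \<Rightarrow> 'a list \<Rightarrow> 'a list
    \<Rightarrow> nat \<Rightarrow> nat \<Rightarrow> nat \<Rightarrow> ('a list \<times> 'a list) set" where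
  "pump_res R z s1 s2 s3 t i a b = der t t ((der s3 s3 ^^ b) (der s3 s2 ((der s3 s1 ^^ a)
     (der s2 s1 ((der s1 s1 ^^ i) (der z z R))))))"

lemma pump_res: "der (pump1 z s1 s2 s3 t i a b) (pump2 z s1 s2 s3 t i a b) R = pump_res R z s1 s2 s3 t i a b"
  unfolding pump_res_def pump1_def pump2_def der_word_pow[symmetric] by simp

definition pumpable :: "'a set \<Rightarrow> ('a list \<times> 'a list) set \<Rightarrow> 'a list \<Rightarrow> 'a list \<Rightarrow> 'a list \<Rightarrow> 'a list \<Rightarrow> 'a list \<Rightarrow> bool" where
  "pumpable A R z s1 s2 s3 t \<longleftrightarrow> length s2 = length s1 \<and> length s3 = length s1 \<and>
    (\<forall>i a b. (pump1 z s1 s2 s3 t i a b, pump2 z s1 s2 s3 t i a b) \<in> R \<and>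
       (\<exists>x \<in> lists A. (pump1 z s1 s2 s3 t i a b @ x, pump2 z s1 s2 s3 t i a b @ x) \<notin> R))"

definition bounded_pumpable :: "nat \<Rightarrow> 'a set \<Rightarrow> ('a list \<times> 'a list) set \<Rightarrow> 'a list \<Rightarrow> 'a list \<Rightarrow> 'a list \<Rightarrow> 'a list \<Rightarrow> 'a list \<Rightarrow> bool" where
  "bounded_pumpable n A R z s1 s2 s3 t \<longleftrightarrow> length s2 = length s1 \<and> length s3 = length s1 \<and>
    (\<forall>i \<le> n. \<forall>a \<le> n. \<forall>b \<le> n. (pump1 z s1 s2 s3 t i a b, pump2 z s1 s2 s3 t i a b) \<in> R \<and>
       (\<exists>x \<in> lists A. length x \<le> n \<and>
          (pump1 z s1 s2 s3 t i a b @ x, pump2 z s1 s2 s3 t i a b @ x) \<notin> R))"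

lemma map_lists: "W \<in> lists L \<Longrightarrow> (\<And>l. l \<in> L \<Longrightarrow> f l \<in> A) \<Longrightarrow> map f W \<in> lists A"
  by auto

text \<open>Pigeonhole: among the first \<open>card S + 1\<close> prefixes of a longer word two have
  the same value of \<open>st\<close>, and cutting out what lies between them preserves the final
  value. The map \<open>st\<close> is kept abstract so that single words, tuples of words and
  exponents are covered alike.\<close>

lemma short_word:
  fixes st :: "'l list \<Rightarrow> 's"
  assumes fin: "finite S" and range: "\<And>W. W \<in> lists L \<Longrightarrow> st W \<in> S"
    and congr: "\<And>W W' l. W \<in> lists L \<Longrightarrow> W' \<in> lists L \<Longrightarrow> l \<in> L \<Longrightarrow> st W = st W' \<Longrightarrow> st (W @ [l]) = st (W' @ [l])"
    and W: "W \<in> lists L"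
  shows "\<exists>W' \<in> lists L. length W' \<le> card S \<and> st W' = st W"
  using W
proof (induction "length W" arbitrary: W rule: less_induct)
  case less
  show ?case
  proof (cases "length W \<le> card S")
    case True
    then show ?thesis using less.prems by blast
  next
    case False
    have tk: "take i W \<in> lists L" "drop i W \<in> lists L" for i
      using less.prems by (auto dest: in_set_takeD in_set_dropD)
    have "\<not> inj_on (\<lambda>i. st (take i W)) {..card S}"
    proof
      assume "inj_on (\<lambda>i. st (take i W)) {..card S}"
      moreover have "(\<lambda>i. st (take i W)) ` {..card S} \<subseteq> S" using range tk by blast
      ultimately have "card {..card S} \<le> card S" using fin by (rule card_inj_on_le)
      then show False by simp
    qed
    then obtain i0 j0 where "st (take i0 W) = st (take j0 W)" "i0 \<le> card S" "j0 \<le> card S" "i0 \<noteq> j0"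
      unfolding inj_on_def by auto
    then obtain i j where ij: "st (take i W) = st (take j W)" "i < j" "j \<le> card S"
      by (metis linorder_neqE_nat)
    have ext: "st (take i W @ X) = st (take j W @ X)" if "X \<in> lists L" for X
      using that
    proof (induction X rule: rev_induct)
      case (snoc l X)
      then show ?case using congr[of "take i W @ X" "take j W @ X" l] tk by simp
    qed (use ij in simp)
    let ?W = "take i W @ drop j W"
    have st: "st ?W = st W" using ext[OF tk(2)[of j]] by simp
    have "length ?W < length W" using ij False by simp
    moreover have "?W \<in> lists L" using tk(1)[of i] tk(2)[of j] by simp
    ultimately obtain W' where "W' \<in> lists L" "length W' \<le> card S" "st W' = st ?W"
      using less.hyps by blast
    then show ?thesis using st by (intro bexI[of _ W']) simp_all
  qed
qed

lemma short_funpow: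
  assumes "finite P" "\<And>r. r \<in> P \<Longrightarrow> F r \<in> P" "r \<in> P"
  shows "\<exists>i' \<le> card P. (F ^^ i') r = (F ^^ i) r"
proof -
  have P: "(F ^^ n) r \<in> P" for n using assms(2,3) by (induction n) auto
  \<comment> \<open>An exponent is a word over a one-letter alphabet.\<close>
  have "\<exists>W' \<in> lists (UNIV :: unit set). length W' \<le> card P \<and> (F ^^ length W') r = (F ^^ length (replicate i ())) r"
    by (rule short_word[where st = "\<lambda>W. (F ^^ length W) r"]) (use assms(1) P in auto)
  then show ?thesis by auto
qed

lemma funpow_cong_on:
  assumes "\<And>r. r \<in> P \<Longrightarrow> F r \<in> P" "\<And>r. r \<in> P \<Longrightarrow> F r = G r" "r \<in> P"
  shows "(F ^^ n) r = (G ^^ n) r \<and> (F ^^ n) r \<in> P"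
  using assms by (induction n) auto

context kernel_candidate
begin

lemma not_sim_iff: "\<not> sim u v \<longleftrightarrow> (\<exists>x \<in> lists A. (u @ x, v @ x) \<notin> R)"
  unfolding sim_iff by blast

lemma pumpable_unbounded:
  assumes lists: "z \<in> lists A" "s1 \<in> lists A" "s2 \<in> lists A" "s3 \<in> lists A" "t \<in> lists A"
    and pump: "pumpable A R z s1 s2 s3 t"
  shows "\<exists>V. separated A R V \<and> card V = n"
proof -
  define w where "w = (\<lambda>i. z @ word_pow i s1 @ s2 @ word_pow (n - 1 - i) s3 @ t)"
  have w_lists: "w i \<in> lists A" for i
    using lists word_pow_lists[of s1 A i] word_pow_lists[of s3 A "n - 1 - i"] unfolding w_def by simp
  have less: "(w i, w j) \<in> R \<and> \<not> sim (w i) (w j)" if ij: "i < j" "j < n" for i j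
  proof -
    \<comment> \<open>In blocks, \<open>a\<close> is the distance strictly between the two
      occurrences of \<open>s2\<close>, and \<open>b\<close> is what follows the later one.\<close>
    define a b where "a = j - i - 1" and "b = n - 1 - j"
    have e: "n - 1 - i = a + Suc b" "j = i + Suc a" using ij unfolding a_def b_def by auto
    have "w i = pump1 z s1 s2 s3 t i a b"
      unfolding w_def pump1_def e(1) word_pow_add by simp
    moreover have "w j = z @ word_pow (i + Suc a) s1 @ s2 @ word_pow b s3 @ t"
      unfolding w_def b_def e(2) by simp
    then have "w j = pump2 z s1 s2 s3 t i a b"
      unfolding pump2_def word_pow_add by simp
    ultimately show ?thesis using pump unfolding pumpable_def not_sim_iff by simp
  qed
  have pair: "(w i, w j) \<in> R \<and> (i \<noteq> j \<longrightarrow> \<not> sim (w i) (w j))" if "i < n" "j < n" for i j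
    using less[of i j] less[of j i] that R_sym sim_sym R_refl[OF w_lists]
    by (cases i j rule: linorder_cases) blast+
  have "inj_on w {..<n}"
  proof (rule inj_onI, rule ccontr)
    fix i j assume "i \<in> {..<n}" "j \<in> {..<n}" "w i = w j" "i \<noteq> j"
    then show False using pair[of i j] sim_refl[OF w_lists[of i]] by simp
  qed
  then have "card (w ` {..<n}) = n" by (simp add: card_image)
  moreover have "separated A R (w ` {..<n})"
    unfolding separated_iff using pair by blast
  ultimately show ?thesis by blast
qed

lemma R_in_residuals: "R \<in> residuals A R"
  using residualsI[of "[]" A "[]" R] by simp

text \<open>Both \<open>(u @ [a], v @ [b]) \<in> R\<close> and \<open>(u, v) \<in> R\<close> depend
  only on the residual of \<open>(u, v)\<close>, and a short pair has the same residual.\<close>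

lemma prefix_closed_bounded:
  assumes fin: "finite (residuals A R)" and n: "card (residuals A R) \<le> n"
    and bd: "\<And>u v a b. u \<in> lists A \<Longrightarrow> v \<in> lists A \<Longrightarrow> length u \<le> n \<Longrightarrow> length v \<le> n \<Longrightarrow> length u = length v \<Longrightarrow>
      (u @ [a], v @ [b]) \<in> R \<Longrightarrow> (u, v) \<in> R"
  shows "prefix_closed R"
  unfolding prefix_closed_def
proof (intro allI impI)
  fix u v a b assume uv: "(u @ [a], v @ [b]) \<in> R"
  then have len: "length u = length v" and l: "u \<in> lists A" "v \<in> lists A"
    using R_length[OF uv] R_lists[OF uv] by auto
  define st where "st = (\<lambda>W. der (map fst W) (map snd W) R)"
  \<comment> \<open>A pair of words of equal length is read as one word over
    \<open>A \<times> A\<close>.\<close>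
  have W: "zip u v \<in> lists (A \<times> A)" "map fst (zip u v) = u" "map snd (zip u v) = v"
    using l len by (auto dest: set_zip_leftD set_zip_rightD)
  have maps: "map fst W \<in> lists A" "map snd W \<in> lists A" if "W \<in> lists (A \<times> A)" for W
    by (rule map_lists[OF that]; simp add: mem_Times_iff)+
  have step: "st (W @ [x]) = der [fst x] [snd x] (st W)" for W x unfolding st_def by simp
  have "\<exists>W' \<in> lists (A \<times> A). length W' \<le> card (residuals A R) \<and> st W' = st (zip u v)"
  proof (rule short_word[OF fin _ _ W(1)])
    show "st W \<in> residuals A R" if "W \<in> lists (A \<times> A)" for W
      unfolding st_def by (rule residualsI[OF maps[OF that]]) simp
    show "st (W @ [x]) = st (W' @ [x])" if "st W = st W'" for W W' x unfolding step that ..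
  qed
  then obtain W' where W': "W' \<in> lists (A \<times> A)" "length W' \<le> card (residuals A R)" "st W' = st (zip u v)"
    by blast
  have eq: "der (map fst W') (map snd W') R = der u v R" using W'(3) W unfolding st_def by simp
  have "([a], [b]) \<in> der (map fst W') (map snd W') R" unfolding eq using uv by simp
  then have "(map fst W', map snd W') \<in> R"
    using bd[OF maps[OF W'(1)], of a b] W'(2) n by simp
  then have "([], []) \<in> der u v R" unfolding eq[symmetric] by simp
  then show "(u, v) \<in> R" by simp
qed

lemma card_le_power:
  assumes "finite P" "P \<noteq> {}" "finite I" "card I \<le> 5"
  shows "finite (I \<times> P \<rightarrow>\<^sub>E P)" "card (I \<times> P \<rightarrow>\<^sub>E P) \<le> card P ^ (5 * card P)"
proof -
  have "card P \<ge> 1" using assms by (simp add: Suc_leI card_gt_0_iff)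
  moreover have "card I * card P \<le> 5 * card P" using assms(4) by simp
  ultimately show "card (I \<times> P \<rightarrow>\<^sub>E P) \<le> card P ^ (5 * card P)"
    using assms by (simp add: card_PiE card_cartesian_product power_increasing)
  show "finite (I \<times> P \<rightarrow>\<^sub>E P)" using assms by (intro finite_PiE) auto
qed

text \<open>The exponents are reduced in the order in which the loops are read. Each reduction
  preserves the residual entering the next loop, so every pumped pair has the residual of one with
  exponents at most \<open>n\<close>.\<close>

lemma bounded_pumpable_imp_pumpable:
  assumes fin: "finite (residuals A R)" and n: "card (residuals A R) \<le> n"
    and l: "z \<in> lists A" "s1 \<in> lists A" "s2 \<in> lists A" "s3 \<in> lists A"
    and pump: "bounded_pumpable n A R z s1 s2 s3 t"
  shows "pumpable A R z s1 s2 s3 t"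
proof -
  let ?P = "residuals A R"
  have len: "length s2 = length s1" "length s3 = length s1"
    using pump unfolding bounded_pumpable_def by blast+
  note cl = der_in_residuals[where A = A and R = R]
  have "(pump1 z s1 s2 s3 t i a b, pump2 z s1 s2 s3 t i a b) \<in> R \<and>
       (\<exists>x \<in> lists A. (pump1 z s1 s2 s3 t i a b @ x, pump2 z s1 s2 s3 t i a b @ x) \<notin> R)" for i a b
  proof -
    have F: "\<And>r. r \<in> ?P \<Longrightarrow> der s1 s1 r \<in> ?P" "\<And>r. r \<in> ?P \<Longrightarrow> der s2 s1 r \<in> ?P"
      "\<And>r. r \<in> ?P \<Longrightarrow> der s3 s1 r \<in> ?P" "\<And>r. r \<in> ?P \<Longrightarrow> der s3 s2 r \<in> ?P"
      "\<And>r. r \<in> ?P \<Longrightarrow> der s3 s3 r \<in> ?P"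
      using cl l len by simp_all
    have pw: "(G ^^ k) r \<in> ?P" if "\<And>r. r \<in> ?P \<Longrightarrow> G r \<in> ?P" "r \<in> ?P" for G k r
      using that by (induction k) auto
    have r0: "der z z R \<in> ?P" using residualsI[OF l(1) l(1)] by simp
    obtain i' where i': "i' \<le> card ?P" "(der s1 s1 ^^ i') (der z z R) = (der s1 s1 ^^ i) (der z z R)"
      using short_funpow[where F = "der s1 s1" and P = ?P, OF fin F(1) r0, of i] by blast
    have r1: "der s2 s1 ((der s1 s1 ^^ i) (der z z R)) \<in> ?P" by (intro F pw r0)
    obtain a' where a': "a' \<le> card ?P" "(der s3 s1 ^^ a') (der s2 s1 ((der s1 s1 ^^ i) (der z z R)))
        = (der s3 s1 ^^ a) (der s2 s1 ((der s1 s1 ^^ i) (der z z R)))"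
      using short_funpow[where F = "der s3 s1" and P = ?P, OF fin F(3) r1, of a] by blast
    have r2: "der s3 s2 ((der s3 s1 ^^ a) (der s2 s1 ((der s1 s1 ^^ i) (der z z R)))) \<in> ?P"
      by (intro F pw r0)
    obtain b' where b': "b' \<le> card ?P"
       "(der s3 s3 ^^ b') (der s3 s2 ((der s3 s1 ^^ a) (der s2 s1 ((der s1 s1 ^^ i) (der z z R)))))
        = (der s3 s3 ^^ b) (der s3 s2 ((der s3 s1 ^^ a) (der s2 s1 ((der s1 s1 ^^ i) (der z z R)))))"
      using short_funpow[where F = "der s3 s3" and P = ?P, OF fin F(5) r2, of b] by blast
    have eq: "pump_res R z s1 s2 s3 t i' a' b' = pump_res R z s1 s2 s3 t i a b"
      unfolding pump_res_def i'(2) a'(2) b'(2) ..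
    have "i' \<le> n" "a' \<le> n" "b' \<le> n" using i' a' b' n by simp_all
    then have "(pump1 z s1 s2 s3 t i' a' b', pump2 z s1 s2 s3 t i' a' b') \<in> R \<and>
       (\<exists>x \<in> lists A. (pump1 z s1 s2 s3 t i' a' b' @ x, pump2 z s1 s2 s3 t i' a' b' @ x) \<notin> R)"
      using pump unfolding bounded_pumpable_def by blast
    then have "([], []) \<in> pump_res R z s1 s2 s3 t i' a' b' \<and>
      (\<exists>x \<in> lists A. (x, x) \<notin> pump_res R z s1 s2 s3 t i' a' b')"
      unfolding pump_res[symmetric] by simp
    then show ?thesis unfolding eq unfolding pump_res[symmetric] by simp
  qed
  then show ?thesis unfolding pumpable_def using len by blast
qed

text \<open>The word \<open>z\<close> is read first and may be replaced by any word with the same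
  residual of \<open>R\<close>. The word \<open>t\<close> is read after arbitrary exponents, so its
  replacement has to act alike on all residuals; this is why functions from residuals to residuals
  are counted.\<close>

lemma pumpable_imp_bounded:
  assumes fin: "finite (residuals A R)" and n: "card (residuals A R) ^ (5 * card (residuals A R)) \<le> n"
    and l: "z \<in> lists A" "s1 \<in> lists A" "s2 \<in> lists A" "s3 \<in> lists A" "t \<in> lists A"
    and pump: "pumpable A R z s1 s2 s3 t"
  obtains z' s1' s2' s3' t' where
    "z' \<in> lists A" "s1' \<in> lists A" "s2' \<in> lists A" "s3' \<in> lists A" "t' \<in> lists A"
    "length z' \<le> n" "length s1' \<le> n" "length s2' \<le> n" "length s3' \<le> n" "length t' \<le> n"
    "bounded_pumpable n A R z' s1' s2' s3' t'"
proof -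
  let ?P = "residuals A R"
  have ne: "?P \<noteq> {}" using R_in_residuals by blast
  then have P1: "card ?P \<ge> 1" using fin by (simp add: Suc_leI card_gt_0_iff)
  have "card ?P ^ 1 \<le> card ?P ^ (5 * card ?P)" using P1 by (intro power_increasing) auto
  then have Pn: "card ?P \<le> n" using n by simp
  have len: "length s2 = length s1" "length s3 = length s1"
    using pump unfolding pumpable_def by blast+
  have step: "der (W @ [x]) (W' @ [x']) r = der [x] [x'] (der W W' r)" for W W' r and x x' :: 'a by simp
  have "\<exists>z' \<in> lists A. length z' \<le> card ?P \<and> der z' z' R = der z z R"
  proof (rule short_word[where st = "\<lambda>Z. der Z Z R", OF fin])
    show "der Z Z R \<in> ?P" if "Z \<in> lists A" for Z using residualsI[OF that that] by simp
    show "der (Z @ [x]) (Z @ [x]) R = der (Z' @ [x]) (Z' @ [x]) R" if "der Z Z R = der Z' Z' R" for Z Z' x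
      unfolding step that ..
  qed (rule l)
  then obtain z' where z': "z' \<in> lists A" "length z' \<le> card ?P" "der z' z' R = der z z R" by blast
  have "\<exists>t' \<in> lists A. length t' \<le> card (?P \<rightarrow>\<^sub>E ?P) \<and>
      restrict (\<lambda>r. der t' t' r) ?P = restrict (\<lambda>r. der t t r) ?P"
  proof (rule short_word[where st = "\<lambda>T. restrict (\<lambda>r. der T T r) ?P"])
    show "finite (?P \<rightarrow>\<^sub>E ?P)" using fin by (intro finite_PiE)
    show "restrict (der T T) ?P \<in> ?P \<rightarrow>\<^sub>E ?P" if "T \<in> lists A" for T
      using der_in_residuals[OF _ that that] by auto
    show "restrict (der (T @ [x]) (T @ [x])) ?P = restrict (der (T' @ [x]) (T' @ [x])) ?P"
      if "restrict (der T T) ?P = restrict (der T' T') ?P" for T T' x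
    proof (rule restrict_ext)
      fix r assume "r \<in> ?P"
      then have "der T T r = der T' T' r" using fun_cong[OF that, of r] by simp
      then show "der (T @ [x]) (T @ [x]) r = der (T' @ [x]) (T' @ [x]) r" unfolding step by simp
    qed
  qed (use l in blast)
  then obtain t' where t': "t' \<in> lists A" "length t' \<le> card (?P \<rightarrow>\<^sub>E ?P)"
      "restrict (\<lambda>r. der t' t' r) ?P = restrict (\<lambda>r. der t t r) ?P" by blast
  have "card (?P \<rightarrow>\<^sub>E ?P) = card ?P ^ card ?P" using fin by (simp add: card_PiE)
  also have "\<dots> \<le> card ?P ^ (5 * card ?P)" using P1 by (intro power_increasing) auto
  finally have t'n: "length t' \<le> n" using t'(2) n by simp
  txt \<open>
    The triple \<open>(s1, s2, s3)\<close> matters only through the action on the residuals of the five pairs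
    occurring in \<open>pump_res\<close>, so the finite set of these actions bounds the length of a shortest
    triple, read as one word over triples of letters.
  \<close>
  define \<pi>1 \<pi>2 \<pi>3 where "\<pi>1 = (fst :: 'a \<times> 'a \<times> 'a \<Rightarrow> 'a)" and "\<pi>2 = (fst \<circ> snd :: 'a \<times> 'a \<times> 'a \<Rightarrow> 'a)"
    and "\<pi>3 = (snd \<circ> snd :: 'a \<times> 'a \<times> 'a \<Rightarrow> 'a)"
  define I where "I = {(\<pi>1, \<pi>1), (\<pi>2, \<pi>1), (\<pi>3, \<pi>1), (\<pi>3, \<pi>2), (\<pi>3, \<pi>3)}"
  have I: "finite I" "card I \<le> 5" unfolding I_def by (auto intro!: card_insert_le_m1)
  define st where "st = (\<lambda>W. restrict (\<lambda>((f, g), r). der (map f W) (map g W) r) (I \<times> ?P))"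
  define W where "W = zip s1 (zip s2 s3)"
  have map_W: "map \<pi>1 W = s1" "map \<pi>2 W = s2" "map \<pi>3 W = s3"
    using len unfolding W_def \<pi>1_def \<pi>2_def \<pi>3_def map_map[symmetric] by simp_all
  have W: "W \<in> lists (A \<times> A \<times> A)"
    unfolding W_def using l by (auto elim!: in_set_zipE)
  have proj: "\<pi>1 x \<in> A" "\<pi>2 x \<in> A" "\<pi>3 x \<in> A" if "x \<in> A \<times> A \<times> A" for x
    using that unfolding \<pi>1_def \<pi>2_def \<pi>3_def by auto
  have map_A: "map f V \<in> lists A \<and> map g V \<in> lists A" if "(f, g) \<in> I" "V \<in> lists (A \<times> A \<times> A)" for f g V
    using that(1) map_lists[OF that(2)] proj unfolding I_def by blast
  have "\<exists>W' \<in> lists (A \<times> A \<times> A). length W' \<le> card (I \<times> ?P \<rightarrow>\<^sub>E ?P) \<and> st W' = st W"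
  proof (rule short_word[where st = st])
    show "finite (I \<times> ?P \<rightarrow>\<^sub>E ?P)" using card_le_power(1)[OF fin ne I] .
    show "st V \<in> I \<times> ?P \<rightarrow>\<^sub>E ?P" if "V \<in> lists (A \<times> A \<times> A)" for V
      unfolding st_def
    proof (rule restrict_PiE_iff[THEN iffD2], rule ballI)
      fix p assume "p \<in> I \<times> ?P"
      then obtain f g r where p: "p = ((f, g), r)" "(f, g) \<in> I" "r \<in> ?P" by auto
      have "der (map f V) (map g V) r \<in> ?P"
        using der_in_residuals[OF p(3)] map_A[OF p(2) that] by simp
      then show "(case p of (x, xa) \<Rightarrow> (case x of (f, g) \<Rightarrow> der (map f V) (map g V)) xa) \<in> ?P"
        unfolding p(1) by simp
    qed
    show "st (V @ [x]) = st (V' @ [x])" if "st V = st V'" for V V' x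
      unfolding st_def
    proof (rule restrict_ext)
      fix p assume pI: "p \<in> I \<times> ?P"
      then obtain f g r where p: "p = ((f, g), r)" by (cases p) auto
      have "st V p = st V' p" using that by simp
      then have "der (map f V) (map g V) r = der (map f V') (map g V') r"
        using pI unfolding st_def p by simp
      then show "(case p of (x, xa) \<Rightarrow> (case x of (f, g) \<Rightarrow> der (map f (V @ [x'])) (map g (V @ [x']))) xa)
        = (case p of (x, xa) \<Rightarrow> (case x of (f, g) \<Rightarrow> der (map f (V' @ [x'])) (map g (V' @ [x']))) xa)" for x'
        using \<open>der (map f V) (map g V) r = der (map f V') (map g V') r\<close>
        unfolding p by (simp only: step prod.case list.map map_append)
    qed
  qed (rule W)
  then obtain W' where W': "W' \<in> lists (A \<times> A \<times> A)" "length W' \<le> card (I \<times> ?P \<rightarrow>\<^sub>E ?P)" "st W' = st W"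
    by blast
  have W'n: "length W' \<le> n" using W'(2) card_le_power(2)[OF fin ne I] n by linarith
  have act: "der (map f W') (map g W') r = der (map f W) (map g W) r" if "(f, g) \<in> I" "r \<in> ?P" for f g r
  proof -
    have "st W' ((f, g), r) = st W ((f, g), r)" using W'(3) by simp
    then show ?thesis using that unfolding st_def by simp
  qed
  define s1' s2' s3' where "s1' = map \<pi>1 W'" and "s2' = map \<pi>2 W'" and "s3' = map \<pi>3 W'"
  have s': "s1' \<in> lists A" "s2' \<in> lists A" "s3' \<in> lists A"
    unfolding s1'_def s2'_def s3'_def using map_lists[OF W'(1)] proj by blast+
  have acts: "\<And>r. r \<in> ?P \<Longrightarrow> der s1 s1 r = der s1' s1' r" "\<And>r. r \<in> ?P \<Longrightarrow> der s2 s1 r = der s2' s1' r"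
    "\<And>r. r \<in> ?P \<Longrightarrow> der s3 s1 r = der s3' s1' r" "\<And>r. r \<in> ?P \<Longrightarrow> der s3 s2 r = der s3' s2' r"
    "\<And>r. r \<in> ?P \<Longrightarrow> der s3 s3 r = der s3' s3' r"
    unfolding s1'_def s2'_def s3'_def map_W[symmetric]
    by (rule act[symmetric]; simp add: I_def)+
  have cl: "\<And>r. r \<in> ?P \<Longrightarrow> der s1 s1 r \<in> ?P" "\<And>r. r \<in> ?P \<Longrightarrow> der s2 s1 r \<in> ?P"
    "\<And>r. r \<in> ?P \<Longrightarrow> der s3 s1 r \<in> ?P" "\<And>r. r \<in> ?P \<Longrightarrow> der s3 s2 r \<in> ?P"
    "\<And>r. r \<in> ?P \<Longrightarrow> der s3 s3 r \<in> ?P"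
    using der_in_residuals[where A = A and R = R] l len by simp_all
  have tt: "der t' t' r = der t t r" if "r \<in> ?P" for r
    using fun_cong[OF t'(3), of r] that by simp
  have r0: "der z z R \<in> ?P" using residualsI[OF l(1) l(1)] by simp
  have res: "pump_res R z' s1' s2' s3' t' i a b = pump_res R z s1 s2 s3 t i a b
      \<and> pump_res R z s1 s2 s3 t i a b \<in> ?P" for i a b
  proof -
    define r1 where "r1 = (der s1 s1 ^^ i) (der z z R)"
    have 1: "(der s1' s1' ^^ i) (der z z R) = r1" "r1 \<in> ?P"
      using funpow_cong_on[where F = "der s1 s1" and G = "der s1' s1'" and P = ?P, OF cl(1) acts(1) r0, where n = i] unfolding r1_def by auto
    define r2 where "r2 = der s2 s1 r1"
    have 2: "der s2' s1' r1 = r2" "r2 \<in> ?P" unfolding r2_def using acts(2)[OF 1(2)] cl(2)[OF 1(2)] by simp_all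
    define r3 where "r3 = (der s3 s1 ^^ a) r2"
    have 3: "(der s3' s1' ^^ a) r2 = r3" "r3 \<in> ?P"
      using funpow_cong_on[where F = "der s3 s1" and G = "der s3' s1'" and P = ?P, OF cl(3) acts(3) 2(2), where n = a] unfolding r3_def by auto
    define r4 where "r4 = der s3 s2 r3"
    have 4: "der s3' s2' r3 = r4" "r4 \<in> ?P" unfolding r4_def using acts(4)[OF 3(2)] cl(4)[OF 3(2)] by simp_all
    define r5 where "r5 = (der s3 s3 ^^ b) r4"
    have 5: "(der s3' s3' ^^ b) r4 = r5" "r5 \<in> ?P"
      using funpow_cong_on[where F = "der s3 s3" and G = "der s3' s3'" and P = ?P, OF cl(5) acts(5) 4(2), where n = b] unfolding r5_def by auto
    have "pump_res R z' s1' s2' s3' t' i a b = der t t r5"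
      unfolding pump_res_def z'(3) 1(1) 2(1) 3(1) 4(1) 5(1) by (rule tt[OF 5(2)])
    moreover have "pump_res R z s1 s2 s3 t i a b = der t t r5"
      unfolding pump_res_def r1_def[symmetric] r2_def[symmetric] r3_def[symmetric]
        r4_def[symmetric] r5_def[symmetric] ..
    moreover have "der t t r5 \<in> ?P" using der_in_residuals[OF 5(2)] l by simp
    ultimately show ?thesis by simp
  qed
  have bp: "(pump1 z' s1' s2' s3' t' i a b, pump2 z' s1' s2' s3' t' i a b) \<in> R \<and>
       (\<exists>x \<in> lists A. length x \<le> n \<and>
          (pump1 z' s1' s2' s3' t' i a b @ x, pump2 z' s1' s2' s3' t' i a b @ x) \<notin> R)" for i a b
  proof -
    define r where "r = pump_res R z s1 s2 s3 t i a b"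
    have rP: "r \<in> ?P" and r': "pump_res R z' s1' s2' s3' t' i a b = r" using res unfolding r_def by simp_all
    have "(pump1 z s1 s2 s3 t i a b, pump2 z s1 s2 s3 t i a b) \<in> R \<and>
       (\<exists>x \<in> lists A. (pump1 z s1 s2 s3 t i a b @ x, pump2 z s1 s2 s3 t i a b @ x) \<notin> R)"
      using pump unfolding pumpable_def by blast
    then have "([], []) \<in> r \<and> (\<exists>x \<in> lists A. (x, x) \<notin> r)"
      unfolding r_def pump_res[symmetric] by simp
    then obtain x where x: "([], []) \<in> r" "x \<in> lists A" "(x, x) \<notin> r" by blast
    \<comment> \<open>The separating continuation is shortened as well, now starting from the
      residual \<open>r\<close> of the pumped pair.\<close>
    have "\<exists>x' \<in> lists A. length x' \<le> card ?P \<and> der x' x' r = der x x r"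
    proof (rule short_word[where st = "\<lambda>X. der X X r", OF fin])
      show "der Z Z r \<in> ?P" if "Z \<in> lists A" for Z using der_in_residuals[OF rP that that] by simp
      show "der (Z @ [x]) (Z @ [x]) r = der (Z' @ [x]) (Z' @ [x]) r" if "der Z Z r = der Z' Z' r" for Z Z' x
        unfolding step that ..
    qed (rule x)
    then obtain x' where x': "x' \<in> lists A" "length x' \<le> card ?P" "der x' x' r = der x x r" by blast
    have "([], []) \<notin> der x' x' r" unfolding x'(3) using x by simp
    then have "(x', x') \<notin> r" by simp
    then have "([], []) \<in> r \<and> (\<exists>x' \<in> lists A. length x' \<le> n \<and> (x', x') \<notin> r)"
      using x(1) x'(1) order_trans[OF x'(2) Pn] by blast
    then show ?thesis unfolding r'[symmetric] pump_res[symmetric] by simp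
  qed
  show thesis
  proof (rule that[of z' s1' s2' s3' t'])
    show "bounded_pumpable n A R z' s1' s2' s3' t'"
      unfolding bounded_pumpable_def using bp by (simp add: s1'_def s2'_def s3'_def)
    show "z' \<in> lists A" "t' \<in> lists A" "length t' \<le> n" using z' t' t'n by blast+
    show "length z' \<le> n" using z'(2) Pn by simp
    show "length s1' \<le> n" "length s2' \<le> n" "length s3' \<le> n"
      unfolding s1'_def s2'_def s3'_def using W'n by simp_all
  qed (rule s')+
qed

end

text \<open>The length-lexicographic order. Unlike the plain lexicographic one it is well-founded,
  and on words of equal length the two agree.\<close>

definition lex_less :: "'a :: wellorder list \<Rightarrow> 'a list \<Rightarrow> bool" where
  "lex_less u v \<longleftrightarrow> (u, v) \<in> lenlex {(x, y). x < y}"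

text \<open>An appended letter decides only between equal prefixes, so an automaton reading from
  left to right can maintain the comparison.\<close>

lemma lex_less_snoc:
  "length u = length v \<Longrightarrow> lex_less (u @ [a]) (v @ [b]) \<longleftrightarrow> lex_less u v \<or> u = v \<and> a < b"
  unfolding lex_less_def by (induction u v rule: list_induct2) (auto simp: Cons_lenlex_iff)

lemma lex_less_total: "(u :: 'a :: wellorder list) \<noteq> v \<Longrightarrow> lex_less u v \<or> lex_less v u"
proof -
  have "total {(x :: 'a, y). x < y}" by (auto simp: total_on_def)
  from total_lenlex[OF this] show "u \<noteq> v \<Longrightarrow> lex_less u v \<or> lex_less v u"
    unfolding lex_less_def total_on_def by blast
qed

lemma lex_less_wf: "wf {(u, v). lex_less u v}"
  using wf_lenlex[OF wf] by (simp add: lex_less_def)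

context
  fixes A :: "'a :: wellorder set"
begin

type_synonym 'b residual = "('b list \<times> 'b list) set"

text \<open>
  After reading \<open>(u, v)\<close> the state consists of the residuals of \<open>(u, v)\<close> and \<open>(v, v)\<close> and,
  as in the subset construction, of the set of residuals of \<open>(v', v)\<close> for all
  lexicographically smaller \<open>v'\<close> of the same length; it tells whether \<open>v\<close> is the least word
  of its \<open>sim\<close>-class.
\<close>

fun rep_step :: "'a residual \<times> 'a residual \<times> 'a residual set \<Rightarrow> 'a \<times> 'a \<Rightarrow>
    'a residual \<times> 'a residual \<times> 'a residual set" where
  "rep_step (r, d, X) (a, b) =
     (der [a] [b] r, der [b] [b] d,
      {der [c] [b] x | x c. x \<in> X \<and> c \<in> A} \<union> {der [c] [b] d | c. c \<in> A \<and> c < b})"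

definition smaller :: "'a list \<Rightarrow> 'a list set" where
  "smaller v = {v' \<in> lists A. length v' = length v \<and> lex_less v' v}"

lemma smaller_snoc:
  assumes "v \<in> lists A"
  shows "smaller (v @ [b]) = {v' @ [c] | v' c. v' \<in> smaller v \<and> c \<in> A} \<union> {v @ [c] | c. c \<in> A \<and> c < b}"
proof (intro equalityI subsetI)
  fix w assume w: "w \<in> smaller (v @ [b])"
  then have "w \<noteq> []" unfolding smaller_def by auto
  then obtain v' c where "w = v' @ [c]" by (metis rev_exhaust)
  then show "w \<in> {v' @ [c] | v' c. v' \<in> smaller v \<and> c \<in> A} \<union> {v @ [c] | c. c \<in> A \<and> c < b}"
    using w unfolding smaller_def by (auto simp: lex_less_snoc)
next
  fix w assume "w \<in> {v' @ [c] | v' c. v' \<in> smaller v \<and> c \<in> A} \<union> {v @ [c] | c. c \<in> A \<and> c < b}"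
  then show "w \<in> smaller (v @ [b])"
    using assms unfolding smaller_def by (auto simp: lex_less_snoc)
qed

lemma smaller_Nil: "smaller [] = {}"
  unfolding smaller_def lex_less_def by auto

lemma run_rep_step:
  assumes "length u = length v" "v \<in> lists A"
  shows "foldl rep_step (R, R, {}) (zip u v) = (der u v R, der v v R, (\<lambda>v'. der v' v R) ` smaller v)"
  using assms
proof (induction u arbitrary: v rule: rev_induct)
  case Nil
  then show ?case by (simp add: smaller_Nil)
next
  case (snoc a u)
  then have "v \<noteq> []" by auto
  then obtain v' b where v: "v = v' @ [b]" by (metis rev_exhaust)
  have IH: "foldl rep_step (R, R, {}) (zip u v') = (der u v' R, der v' v' R, (\<lambda>w. der w v' R) ` smaller v')"
    using snoc v by simp
  have "v' \<in> lists A" using snoc.prems v by simp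
  have "(\<lambda>w. der w v R) ` smaller v =
     {der (w @ [c]) v R | w c. w \<in> smaller v' \<and> c \<in> A} \<union> {der (v' @ [c]) v R | c. c \<in> A \<and> c < b}"
    unfolding v smaller_snoc[OF \<open>v' \<in> lists A\<close>] by blast
  also have "\<dots> = {der [c] [b] (der w v' R) | w c. w \<in> smaller v' \<and> c \<in> A}
      \<union> {der [c] [b] (der v' v' R) | c. c \<in> A \<and> c < b}"
    unfolding v der_der ..
  also have "{der [c] [b] (der w v' R) | w c. w \<in> smaller v' \<and> c \<in> A} =
      {der [c] [b] x | x c. x \<in> (\<lambda>w. der w v' R) ` smaller v' \<and> c \<in> A}"
    by blast
  finally have sm: "(\<lambda>w. der w v R) ` smaller v =
     {der [c] [b] x | x c. x \<in> (\<lambda>w. der w v' R) ` smaller v' \<and> c \<in> A} \<union> {der [c] [b] (der v' v' R) | c. c \<in> A \<and> c < b}" .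
  have "length u = length v'" using snoc.prems v by simp
  then have "foldl rep_step (R, R, {}) (zip (u @ [a]) v) =
      rep_step (foldl rep_step (R, R, {}) (zip u v')) (a, b)"
    unfolding v by simp
  also have "\<dots> = (der [a] [b] (der u v' R), der [b] [b] (der v' v' R), (\<lambda>w. der w v R) ` smaller v)"
    unfolding IH rep_step.simps sm ..
  finally show ?case unfolding v der_der .
qed

end

section \<open>Least words of congruence classes\<close>

locale ordered_candidate = kernel_candidate A R
  for A :: "'a :: wellorder set" and R
begin

definition least_word :: "'a list \<Rightarrow> bool" where
  "least_word v \<longleftrightarrow> (\<forall>v' \<in> smaller A v. \<not> sim v' v)"

lemma least_wordD:
  assumes "least_word u" "least_word v" "u \<in> lists A" "v \<in> lists A" "length u = length v" "u \<noteq> v"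
  shows "\<not> sim u v"
proof
  assume "sim u v"
  then have "sim v u" by (rule sim_sym)
  from lex_less_total[OF assms(6)] show False
  proof
    assume "lex_less u v"
    then have "u \<in> smaller A v" using assms(3,5) unfolding smaller_def by blast
    then show False using assms(2) \<open>sim u v\<close> unfolding least_word_def by blast
  next
    assume "lex_less v u"
    then have "v \<in> smaller A u" using assms(4,5) unfolding smaller_def by simp
    then show False using assms(1) \<open>sim v u\<close> unfolding least_word_def by blast
  qed
qed

text \<open>\<open>sim\<close> refines the length-preserving \<open>R\<close>, so a minimum of the
  class has the length of \<open>v\<close>.\<close>

lemma least_word_exists:
  assumes "v \<in> lists A"
  obtains m where "sim m v" "least_word m" "m \<in> lists A" "length m = length v"
proof -
  have "v \<in> {m. sim m v}" using sim_refl[OF assms] by simp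
  then obtain m where m: "sim m v" "\<And>y. lex_less y m \<Longrightarrow> \<not> sim y v"
    by (rule wfE_min[OF lex_less_wf]) blast
  have "least_word m"
    unfolding least_word_def smaller_def using m sim_trans by blast
  then show thesis using that m(1) sim_lists[OF m(1)] R_length[OF sim_R[OF m(1)]] by blast
qed

definition accepting :: "('a residual \<times> 'a residual \<times> 'a residual set) set" where
  "accepting = {(r, d, X). ([], []) \<in> r \<and> (\<forall>x \<in> X. \<not> nonsep A x)}"

lemma accepting_iff:
  assumes "length u = length v" "v \<in> lists A"
  shows "foldl (rep_step A) (R, R, {}) (zip u v) \<in> accepting \<longleftrightarrow> (u, v) \<in> R \<and> least_word v"
  unfolding run_rep_step[OF assms] accepting_def least_word_def sim_def by simp

lemma rep_step_closed:
  assumes "q \<in> residuals A R \<times> residuals A R \<times> Pow (residuals A R)" "a \<in> A" "b \<in> A"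
  shows "rep_step A q (a, b) \<in> residuals A R \<times> residuals A R \<times> Pow (residuals A R)"
proof -
  obtain r d X where q: "q = (r, d, X)" "r \<in> residuals A R" "d \<in> residuals A R" "X \<subseteq> residuals A R"
    using assms(1) by auto
  have cl: "der [c] [b] x \<in> residuals A R" if "x \<in> residuals A R" "c \<in> A" for x c
    using der_in_residuals[OF that(1), of "[c]" "[b]"] that(2) assms(3) by simp
  have "der [a] [b] r \<in> residuals A R" "der [b] [b] d \<in> residuals A R" using cl q assms by blast+
  moreover have "{der [c] [b] x | x c. x \<in> X \<and> c \<in> A} \<union> {der [c] [b] d | c. c \<in> A \<and> c < b} \<subseteq> residuals A R"
    using cl q by blast
  ultimately show ?thesis unfolding q(1) rep_step.simps by blast
qed

text \<open>Fix one word \<open>u\<close> of a separated set and send each element to the least word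
  of its class. This is injective, and all images are accepted second tapes over the first tape
  \<open>u\<close>; so large separated sets supply what \<open>unbounded_pattern\<close> asks
  for.\<close>

theorem unbounded_imp_pumpable:
  assumes fin: "finite (residuals A R)"
    and unbounded: "\<And>k. \<exists>V. separated A R V \<and> k < card V"
  shows "\<exists>z \<in> lists A. \<exists>s1 \<in> lists A. \<exists>s2 \<in> lists A. \<exists>s3 \<in> lists A. \<exists>t \<in> lists A. pumpable A R z s1 s2 s3 t"
proof -
  let ?Q = "residuals A R \<times> residuals A R \<times> Pow (residuals A R)"
  let ?run = "\<lambda>q u v. foldl (rep_step A) q (zip u v)"
  have ub: "\<exists>u \<in> lists A. k < card {v \<in> lists A. length v = length u \<and> ?run (R, R, {}) u v \<in> accepting}" for k
  proof -
    obtain V where V: "separated A R V" "k < card V" using unbounded by blast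
    then have "V \<noteq> {}" by auto
    then obtain u where u: "u \<in> V" by blast
    have VR: "(u, v) \<in> R" if "v \<in> V" for v using V(1) u that unfolding separated_def by blast
    have VA: "v \<in> lists A" "length v = length u" if "v \<in> V" for v
      using R_lists[OF VR[OF that]] R_length[OF VR[OF that]] by simp_all
    have "\<exists>m. sim m v \<and> least_word m \<and> m \<in> lists A \<and> length m = length v" if "v \<in> V" for v
      using least_word_exists[OF VA(1)[OF that]] by blast
    then obtain \<mu> where \<mu>: "\<And>v. v \<in> V \<Longrightarrow> sim (\<mu> v) v \<and> least_word (\<mu> v) \<and> \<mu> v \<in> lists A \<and> length (\<mu> v) = length v"
      by metis
    let ?S = "{v \<in> lists A. length v = length u \<and> ?run (R, R, {}) u v \<in> accepting}"
    have "inj_on \<mu> V"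
    proof (rule inj_onI, rule ccontr)
      fix v w assume vw: "v \<in> V" "w \<in> V" "\<mu> v = \<mu> w" "v \<noteq> w"
      have "sim v (\<mu> v)" "sim (\<mu> v) w" using \<mu>[OF vw(1)] \<mu>[OF vw(2)] sim_sym vw(3) by auto
      then have "sim v w" by (rule sim_trans)
      then show False using V(1) vw unfolding separated_iff by blast
    qed
    moreover have "\<mu> ` V \<subseteq> ?S"
    proof (rule image_subsetI)
      fix v assume v: "v \<in> V"
      have "(u, \<mu> v) \<in> R" using VR[OF v] sim_R R_sym R_trans \<mu>[OF v] by blast
      then show "\<mu> v \<in> ?S" using \<mu>[OF v] VA[OF v] accepting_iff[of u "\<mu> v"] by simp
    qed
    moreover have "finite ?S"
      by (rule finite_subset[OF _ finite_lists_length_eq[OF finite_A, of "length u"]]) auto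
    ultimately have "card V \<le> card ?S" by (rule card_inj_on_le)
    then show ?thesis using V(2) VA(1)[OF u] by (intro bexI[of _ u]) simp_all
  qed
  have "finite ?Q" using fin by simp
  moreover have "(R, R, {}) \<in> ?Q" using R_in_residuals by simp
  ultimately obtain x z w s1 s2 s3 y t l m where
    p: "w \<in> lists A" "z \<in> lists A" "s1 \<in> lists A" "s2 \<in> lists A" "s3 \<in> lists A" "t \<in> lists A"
    "length x = length z" "length s1 = length w" "length s2 = length w" "length s3 = length w"
    "length y = length t" "s1 \<noteq> s2"
    "?run (R, R, {}) x z = l" "?run l w s1 = l" "?run l w s2 = m"
    "?run m w s3 = m" "?run m y t \<in> accepting" "x \<in> lists A" "y \<in> lists A"
    by (rule unbounded_pattern[OF _ _ finite_A rep_step_closed ub])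
  have loop: "?run q (word_pow n w) (word_pow n s) = q" if "?run q w s = q" "length s = length w" for q s n
    using that by (induction n) simp_all
  \<comment> \<open>The first tape has \<open>i\<close> copies of \<open>w\<close> for the loops on
    \<open>s1\<close>, one for the passage \<open>s2\<close> and \<open>j\<close> for the loops on
    \<open>s3\<close>.\<close>
  have acc: "(x @ word_pow (i + Suc j) w @ y, z @ word_pow i s1 @ s2 @ word_pow j s3 @ t) \<in> R
      \<and> least_word (z @ word_pow i s1 @ s2 @ word_pow j s3 @ t)" for i j
  proof -
    define uu where "uu = x @ word_pow (i + Suc j) w @ y"
    define vv where "vv = z @ word_pow i s1 @ s2 @ word_pow j s3 @ t"
    have uu: "uu = x @ word_pow i w @ w @ word_pow j w @ y" unfolding uu_def word_pow_add by simp
    have "?run (R, R, {}) uu vv = ?run m y t"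
      unfolding uu vv_def using p(7-16) loop[OF p(14) p(8), of i] loop[OF p(16) p(10), of j] by simp
    moreover have "length uu = length vv" unfolding uu vv_def using p(7-11) by simp
    moreover have "vv \<in> lists A"
      unfolding vv_def using p(2-6) word_pow_lists[OF p(3), of i] word_pow_lists[OF p(5), of j] by simp
    ultimately have "(uu, vv) \<in> R \<and> least_word vv"
      using accepting_iff[of uu vv] p(17) by simp
    then show ?thesis unfolding uu_def vv_def .
  qed
  have "(pump1 z s1 s2 s3 t i a b, pump2 z s1 s2 s3 t i a b) \<in> R \<and>
     \<not> sim (pump1 z s1 s2 s3 t i a b) (pump2 z s1 s2 s3 t i a b)" for i a b
  proof -
    have e1: "pump1 z s1 s2 s3 t i a b = z @ word_pow i s1 @ s2 @ word_pow (a + Suc b) s3 @ t"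
      unfolding pump1_def word_pow_add by simp
    have e2: "pump2 z s1 s2 s3 t i a b = z @ word_pow (i + Suc a) s1 @ s2 @ word_pow b s3 @ t"
      unfolding pump2_def word_pow_add by simp
    \<comment> \<open>The total number of blocks is the same, so both pumped words are accepted over
      one first tape and are related by transitivity.\<close>
    have n: "i + Suc (a + Suc b) = i + Suc a + Suc b" by simp
    have Rx: "(x @ word_pow (i + Suc a + Suc b) w @ y, pump1 z s1 s2 s3 t i a b) \<in> R"
      "(x @ word_pow (i + Suc a + Suc b) w @ y, pump2 z s1 s2 s3 t i a b) \<in> R"
      using acc[of i "a + Suc b"] acc[of "i + Suc a" b] unfolding e1 e2 n by blast+
    from R_trans[OF R_sym[OF Rx(1)] Rx(2)] have RR: "(pump1 z s1 s2 s3 t i a b, pump2 z s1 s2 s3 t i a b) \<in> R"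
      .
    have least: "least_word (pump1 z s1 s2 s3 t i a b)" "least_word (pump2 z s1 s2 s3 t i a b)"
      unfolding e1 e2 using acc by blast+
    \<comment> \<open>After the common prefix one word continues with \<open>s2\<close>, the other
      with \<open>s1\<close>, which has the same length but is different.\<close>
    have "pump1 z s1 s2 s3 t i a b \<noteq> pump2 z s1 s2 s3 t i a b"
      unfolding pump1_def pump2_def using p(8,9,12) by simp
    then show ?thesis using RR least_wordD[OF least] R_lists[OF RR] R_length[OF RR] by blast
  qed
  then have "pumpable A R z s1 s2 s3 t"
    unfolding pumpable_def not_sim_iff using p(8-10) by simp
  then show ?thesis using p(2-6) by blast
qed

theorem KerSeq_ll_iff:
  assumes fin: "finite (residuals A R)"
  shows "R \<in> KerSeq_ll A \<longleftrightarrow> prefix_closed R \<and>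
    \<not> (\<exists>z \<in> lists A. \<exists>s1 \<in> lists A. \<exists>s2 \<in> lists A. \<exists>s3 \<in> lists A. \<exists>t \<in> lists A. pumpable A R z s1 s2 s3 t)"
proof
  assume R: "R \<in> KerSeq_ll A"
  obtain k where k: "\<And>V. separated A R V \<Longrightarrow> card V \<le> k" using KerSeq_ll_imp(3)[OF R] by blast
  have "\<not> pumpable A R z s1 s2 s3 t"
    if "z \<in> lists A" "s1 \<in> lists A" "s2 \<in> lists A" "s3 \<in> lists A" "t \<in> lists A" for z s1 s2 s3 t
  proof
    assume "pumpable A R z s1 s2 s3 t"
    from pumpable_unbounded[OF that this, of "Suc k"] obtain V where
      "separated A R V" "card V = Suc k" by blast
    then show False using k[of V] by simp
  qed
  then show "prefix_closed R \<and>
    \<not> (\<exists>z \<in> lists A. \<exists>s1 \<in> lists A. \<exists>s2 \<in> lists A. \<exists>s3 \<in> lists A. \<exists>t \<in> lists A. pumpable A R z s1 s2 s3 t)"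
    using KerSeq_ll_imp(2)[OF R] by blast
next
  assume r: "prefix_closed R \<and>
    \<not> (\<exists>z \<in> lists A. \<exists>s1 \<in> lists A. \<exists>s2 \<in> lists A. \<exists>s3 \<in> lists A. \<exists>t \<in> lists A. pumpable A R z s1 s2 s3 t)"
  have "\<exists>k. \<forall>V. separated A R V \<longrightarrow> card V \<le> k"
  proof (rule ccontr)
    assume "\<not> ?thesis"
    then have "\<exists>V. separated A R V \<and> k < card V" for k using not_le by blast
    from unbounded_imp_pumpable[OF fin this] r show False by blast
  qed
  then obtain k where k: "\<And>V. separated A R V \<Longrightarrow> card V \<le> k" by blast
  obtain Al where "set Al = A" using finite_list[OF finite_A] by blast
  then interpret bounded_candidate A R Al k
    using r fin k by unfold_locales blast+
  show "R \<in> KerSeq_ll A" by (rule KerSeq_ll)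
qed

end

section \<open>Length bounds for transducers\<close>

lemma path_states:
  assumes "finite_transducer A B T" "path T p u v q"
  shows "p \<in> states T \<and> q \<in> states T"
  using assms(2,1) by (induction rule: path.induct) (auto simp: finite_transducer_def)

text \<open>A single number dominating all sizes, to be instantiated with the code of the
  instance.\<close>

definition label_bound :: "nat \<Rightarrow> ('q, 'a, 'b) transducer \<Rightarrow> bool" where
  "label_bound c T \<longleftrightarrow> card (transitions T) \<le> c \<and> card (states T) \<le> c \<and>
     (\<forall>(p, (x, y), q) \<in> transitions T. length x \<le> c \<and> length y \<le> c)"

lemma label_boundD:
  "label_bound c T \<Longrightarrow> (p, (x, y), q) \<in> transitions T \<Longrightarrow> length x \<le> c \<and> length y \<le> c"
  unfolding label_bound_def by blast

text \<open>In the graph of states at most \<open>card G \<le> c\<close> edges connect reachable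
  states, each with labels of length at most \<open>c\<close>. Only the endpoints of the path are
  kept, not its words.\<close>

lemma short_path:
  assumes T: "finite_transducer A B T" and c: "label_bound c T" and path: "path T p u v q"
  shows "\<exists>u' v'. path T p u' v' q \<and> length u' \<le> c * c \<and> length v' \<le> c * c"
proof -
  define G where "G = (\<lambda>(p, _, q). (p, q)) ` transitions T"
  have finG: "finite G" using T unfolding G_def finite_transducer_def by blast
  have "card G \<le> card (transitions T)" unfolding G_def
    by (rule card_image_le) (use T in \<open>simp add: finite_transducer_def\<close>)
  then have cG: "card G \<le> c" using c unfolding label_bound_def by linarith
  have "(p, q) \<in> G\<^sup>*" using path
  proof (induction rule: path.induct)
    case (step p x y q u v r)
    then have "(p, q) \<in> G" unfolding G_def by force
    then show ?case using step.IH by (rule converse_rtrancl_into_rtrancl)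
  qed simp
  then obtain n where n: "n \<le> card G" "(p, q) \<in> G ^^ n"
    unfolding rtrancl_finite_eq_relpow[OF finG] by blast
  have "(p, q) \<in> G ^^ n \<Longrightarrow> p \<in> states T \<Longrightarrow>
      \<exists>u' v'. path T p u' v' q \<and> length u' \<le> n * c \<and> length v' \<le> n * c" for p q n
  proof (induction n arbitrary: p)
    case 0
    then show ?case using path.empty[OF 0(2)] by fastforce
  next
    case (Suc n)
    from relpow_Suc_D2[OF Suc.prems(1)] obtain r where r: "(p, r) \<in> G" "(r, q) \<in> G ^^ n" by blast
    then obtain x y where xy: "(p, (x, y), r) \<in> transitions T" unfolding G_def by auto
    then have "r \<in> states T" using T unfolding finite_transducer_def by blast
    then obtain u' v' where uv: "path T r u' v' q" "length u' \<le> n * c" "length v' \<le> n * c"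
      using Suc.IH r(2) by blast
    have "path T p (x @ u') (y @ v') q" using path.step[OF xy uv(1)] .
    moreover have "length (x @ u') \<le> Suc n * c" "length (y @ v') \<le> Suc n * c"
      using label_boundD[OF c xy] uv by simp_all
    ultimately show ?case by blast
  qed
  then obtain u' v' where uv: "path T p u' v' q" "length u' \<le> n * c" "length v' \<le> n * c"
    using n(2) path_states[OF T path] by blast
  have "n * c \<le> c * c" using n(1) cG by simp
  then show ?thesis using uv order_trans by blast
qed

lemma realized_relationI:
  "i \<in> initials T \<Longrightarrow> path T i u v f \<Longrightarrow> f \<in> finals T \<Longrightarrow> (u, v) \<in> realized_relation T"
  unfolding realized_relation_def by blast

text \<open>
  If all short accepted pairs have equal lengths, the length difference on short access paths
  is a potential for the useful states, and every transition between them respects it.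
\<close>

lemma length_preserving_bounded:
  fixes T :: "('q, 'a, 'a) transducer"
  assumes T: "finite_transducer A A T" and c: "label_bound c T"
    and short: "\<And>u v. (u, v) \<in> realized_relation T \<Longrightarrow> length u \<le> 2 * (c * c) + c \<Longrightarrow>
      length v \<le> 2 * (c * c) + c \<Longrightarrow> length u = length v"
  shows "length_preserving (realized_relation T)"
proof -
  have *: "path T p u v f \<Longrightarrow> f \<in> finals T \<Longrightarrow> i \<in> initials T \<Longrightarrow> path T i a b p \<Longrightarrow>
      length a \<le> c * c \<Longrightarrow> length b \<le> c * c \<Longrightarrow> length a + length u = length b + length v"
    for p u v f i a b
  proof (induction arbitrary: i a b rule: path.induct)
    case (empty p)
    have "length a = length b"
      using short[OF realized_relationI[OF empty(3,4,2)]] empty(5,6) by linarith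
    then show ?case by simp
  next
    case (step p x y q u v f)
    note xy = label_boundD[OF c step.hyps(1)]
    have q: "q \<in> states T" using path_states[OF T step.hyps(2)] by blast
    have "path T q ([] :: 'a list) ([] :: 'a list) q" using q by (rule path.empty)
    from path.step[OF step.hyps(1) this] have pq: "path T p x y q" by simp
    have iq: "path T i (a @ x) (b @ y) q" using path_append[OF step.prems(3) pq] .
    obtain a' b' where ab: "path T i a' b' q" "length a' \<le> c * c" "length b' \<le> c * c"
      using short_path[OF T c iq] by blast
    obtain u0 v0 where uv: "path T q u0 v0 f" "length u0 \<le> c * c" "length v0 \<le> c * c"
      using short_path[OF T c step.hyps(2)] by blast
    have 1: "length a' + length u = length b' + length v"
      using step.IH[OF step.prems(1,2) ab] .
    \<comment> \<open>The short access path of \<open>q\<close> and the one through \<open>p\<close>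
      are completed by the same short exit, so they have the same length difference.\<close>
    have 2: "length (a' @ u0) = length (b' @ v0)"
      using short[OF realized_relationI[OF step.prems(2) path_append[OF ab(1) uv(1)] step.prems(1)]]
        ab uv by simp
    \<comment> \<open>The longest pair to be inspected: access \<open>c * c\<close>, one label
      \<open>c\<close>, exit \<open>c * c\<close>. This is the origin of the bound in
      \<open>short\<close>.\<close>
    have 3: "length ((a @ x) @ u0) = length ((b @ y) @ v0)"
      using short[OF realized_relationI[OF step.prems(2) path_append[OF iq uv(1)] step.prems(1)]]
        step.prems xy uv by simp
    show ?case using 1 2 3 by simp
  qed
  have "length u = length v" if uv: "(u, v) \<in> realized_relation T" for u v
  proof -
    obtain i f where i: "i \<in> initials T" "f \<in> finals T" "path T i u v f"
      using uv unfolding realized_relation_def by blast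
    have "path T i ([] :: 'a list) ([] :: 'a list) i"
      using path_states[OF T i(3)] by (intro path.empty) blast
    from *[OF i(3,2,1) this] show ?thesis by simp
  qed
  then show ?thesis unfolding length_preserving_def by blast
qed

text \<open>The first hypothesis makes \<open>h\<close> factor through \<open>f\<close> on
  \<open>S\<close>.\<close>

lemma card_determined:
  assumes "\<And>x y. x \<in> S \<Longrightarrow> y \<in> S \<Longrightarrow> f x = f y \<Longrightarrow> h x = h y" "f ` S \<subseteq> D" "finite D"
  shows "finite (h ` S) \<and> card (h ` S) \<le> card D"
proof -
  have "h ` S \<subseteq> (h \<circ> inv_into S f) ` (f ` S)"
  proof (rule image_subsetI)
    fix x assume x: "x \<in> S"
    then have "inv_into S f (f x) \<in> S" "f (inv_into S f (f x)) = f x"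
      by (auto intro: inv_into_into f_inv_into_f)
    then have "h x = h (inv_into S f (f x))" using assms(1)[OF x] by simp
    then show "h x \<in> (h \<circ> inv_into S f) ` (f ` S)" using x by auto
  qed
  note sub = this
  have fin: "finite (f ` S)" using assms(2,3) finite_subset by blast
  have "finite (h ` S)" using finite_subset[OF sub finite_imageI[OF fin]] .
  moreover have "card (h ` S) \<le> card (f ` S)"
    using card_mono[OF finite_imageI[OF fin] sub] card_image_le[OF fin, of "h \<circ> inv_into S f"] by linarith
  ultimately have "finite (h ` S) \<and> card (h ` S) \<le> card (f ` S)" by blast
  then show ?thesis using card_mono[OF assms(3,2)] by linarith
qed

text \<open>
  A run on \<open>(u @ s, v @ t)\<close> is cut at the last configuration that has not left \<open>(u, v)\<close>; by
  length preservation the unread parts \<open>x\<close>, \<open>y\<close> of \<open>u\<close> and \<open>v\<close> are short there.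
\<close>

definition configs :: "('q, 'a, 'a) transducer \<Rightarrow> nat \<Rightarrow> 'a list \<times> 'a list \<Rightarrow> ('q \<times> 'a list \<times> 'a list) set" where
  "configs T L p = {(q, x, y). length x \<le> L \<and> length y \<le> L \<and>
     (\<exists>i \<in> initials T. \<exists>u v. path T i u v q \<and> fst p = u @ x \<and> snd p = v @ y)}"

lemma path_configs:
  fixes T :: "('q, 'a, 'a) transducer"
  assumes T: "finite_transducer A A T" and c: "label_bound c T"
    and lp: "length_preserving (realized_relation T)" and len: "length u = length v"
  shows "path T q U V f \<Longrightarrow> f \<in> finals T \<Longrightarrow> i \<in> initials T \<Longrightarrow> path T i u' v' q \<Longrightarrow>
    u = u' @ x \<Longrightarrow> v = v' @ y \<Longrightarrow> U = x @ s \<Longrightarrow> V = y @ t \<Longrightarrow>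
    \<exists>p x y. (p, x, y) \<in> configs T (c * c + c) (u, v) \<and> path T p (x @ s) (y @ t) f"
proof (induction arbitrary: u' v' x y rule: path.induct)
  case (empty q)
  have "path T q ([] :: 'a list) ([] :: 'a list) q" using empty.hyps by (rule path.empty)
  moreover have "(q, [], []) \<in> configs T (c * c + c) (u, v)"
    using empty unfolding configs_def by auto
  ultimately show ?case using empty by (intro exI[of _ q] exI[of _ "[]"]) simp
next
  case (step q a b q' U V f)
  note ab = label_boundD[OF c step.hyps(1)]
  have full: "path T q (a @ U) (b @ V) f" using path.step[OF step.hyps] .
  show ?case
  proof (cases "length a \<le> length x \<and> length b \<le> length y")
    case True
    then obtain x' y' where xy: "x = a @ x'" "U = x' @ s" "y = b @ y'" "V = y' @ t"
      using step.prems(6,7) by (auto simp: append_eq_append_conv2)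
    have "path T q' ([] :: 'a list) ([] :: 'a list) q'"
      using path_states[OF T step.hyps(2)] by (intro path.empty) blast
    from path.step[OF step.hyps(1) this] have "path T q a b q'" by simp
    from path_append[OF step.prems(3) this] have "path T i (u' @ a) (v' @ b) q'" .
    from step.IH[OF step.prems(1,2) this _ _ xy(2,4)] show ?thesis
      using step.prems(4,5) xy by simp
  next
    \<comment> \<open>One of \<open>x\<close>, \<open>y\<close> is shorter than a label. All access
      paths of \<open>q\<close> have the same delay, at most \<open>c * c\<close> as on a short one,
      which bounds the other word.\<close>
    case False
    obtain a' b' where ab': "path T i a' b' q" "length a' \<le> c * c" "length b' \<le> c * c"
      using short_path[OF T c step.prems(3)] by blast
    have R: "length u = length v" if "(u, v) \<in> realized_relation T" for u v
      using lp that unfolding length_preserving_def by blast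
    have "length (a' @ (a @ U)) = length (b' @ (b @ V))"
      by (rule R[OF realized_relationI[OF step.prems(2) path_append[OF ab'(1) full] step.prems(1)]])
    moreover have "length (u' @ (a @ U)) = length (v' @ (b @ V))"
      by (rule R[OF realized_relationI[OF step.prems(2) path_append[OF step.prems(3) full] step.prems(1)]])
    moreover have "length u' + length x = length v' + length y"
      using len step.prems(4,5) by simp
    ultimately have "length x \<le> c * c + c \<and> length y \<le> c * c + c"
      using False ab ab'(2,3) by auto
    then have "(q, x, y) \<in> configs T (c * c + c) (u, v)"
      using step.prems(2-5) unfolding configs_def by auto
    moreover have "path T q (x @ s) (y @ t) f" using full step.prems(6,7) by simp
    ultimately show ?thesis by blast
  qed
qed

text \<open>An accepting run continues from some configuration by reading its unread words and then
  \<open>(s, t)\<close>; if \<open>(u2, v2)\<close> has the same configuration, the continuation can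
  be attached there.\<close>

lemma residual_configs:
  fixes T :: "('q, 'a, 'a) transducer"
  assumes T: "finite_transducer A A T" and c: "label_bound c T"
    and lp: "length_preserving (realized_relation T)"
    and len: "length u = length v" "length u2 = length v2"
    and eq: "configs T (c * c + c) (u, v) = configs T (c * c + c) (u2, v2)"
  shows "der u v (realized_relation T) \<subseteq> der u2 v2 (realized_relation T)"
proof (rule subrelI)
  fix s t assume "(s, t) \<in> der u v (realized_relation T)"
  then have "(u @ s, v @ t) \<in> realized_relation T" by simp
  then obtain i f where i: "i \<in> initials T" "f \<in> finals T" "path T i (u @ s) (v @ t) f"
    unfolding realized_relation_def by blast
  have "path T i ([] :: 'a list) ([] :: 'a list) i"
    using path_states[OF T i(3)] by (intro path.empty) blast
  from path_configs[OF T c lp len(1) i(3,2,1) this append_Nil[symmetric] append_Nil[symmetric] refl refl]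
  obtain p x y where
    p: "(p, x, y) \<in> configs T (c * c + c) (u, v)" "path T p (x @ s) (y @ t) f" by blast
  from p(1)[unfolded eq] obtain i' u' v' where
    i': "i' \<in> initials T" "path T i' u' v' p" "u2 = u' @ x" "v2 = v' @ y"
    unfolding configs_def by auto
  have "(u2 @ s, v2 @ t) \<in> realized_relation T"
    using realized_relationI[OF i'(1) path_append[OF i'(2) p(2)] i(2)] i'(3,4) by simp
  then show "(s, t) \<in> der u2 v2 (realized_relation T)" by simp
qed

text \<open>With \<open>L = c * c + c\<close>, at most \<open>(L + 1) * (c + 1) ^ L\<close> words
  have length at most \<open>L\<close>; a configuration consists of one of at most \<open>c\<close>
  states and two such words.\<close>

definition config_bound :: "nat \<Rightarrow> nat" where
  "config_bound c = c * (((c * c + c) + 1) * (c + 1) ^ (c * c + c)) ^ 2"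

lemma card_lists_le:
  assumes "finite A" "card A \<le> c"
  shows "finite {x \<in> lists A. length x \<le> L} \<and> card {x \<in> lists A. length x \<le> L} \<le> (L + 1) * (c + 1) ^ L"
proof -
  have eq: "{x \<in> lists A. length x \<le> L} = {x. set x \<subseteq> A \<and> length x \<le> L}" by auto
  have "card A ^ i \<le> (c + 1) ^ L" if "i \<le> L" for i
  proof -
    have "card A ^ i \<le> (c + 1) ^ i" using assms(2) by (intro power_mono) auto
    also have "\<dots> \<le> (c + 1) ^ L" using that by (intro power_increasing) auto
    finally show ?thesis .
  qed
  then have "(\<Sum>i\<le>L. card A ^ i) \<le> of_nat (card {..L}) * (c + 1) ^ L"
    by (intro sum_bounded_above) simp
  then show ?thesis
    unfolding eq using finite_lists_length_le[OF assms(1)] card_lists_length_le[OF assms(1), of L] by simp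
qed

text \<open>A residual is determined by a set of configurations, hence the power of two.\<close>

lemma card_residuals_bound:
  fixes T :: "('q, 'a, 'a) transducer"
  assumes T: "finite_transducer A A T" and c: "label_bound c T" "card A \<le> c"
    and lp: "length_preserving (realized_relation T)"
  shows "finite (residuals A (realized_relation T)) \<and>
    card (residuals A (realized_relation T)) \<le> 2 ^ config_bound c"
proof -
  let ?L = "c * c + c" and ?R = "realized_relation T"
  let ?X = "{x \<in> lists A. length x \<le> ?L}"
  define S where "S = {(u, v). u \<in> lists A \<and> v \<in> lists A \<and> length u = length v}"
  let ?C = "states T \<times> ?X \<times> ?X"
  have finA: "finite A" and finQ: "finite (states T)" using T unfolding finite_transducer_def by blast+
  note X = card_lists_le[OF finA c(2), of ?L]
  have finC: "finite ?C" using X finQ by simp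
  have "card ?C = card (states T) * (card ?X * card ?X)" by (simp add: card_cartesian_product)
  also have "\<dots> \<le> c * (((?L + 1) * (c + 1) ^ ?L) * ((?L + 1) * (c + 1) ^ ?L))"
    using X c(1) unfolding label_bound_def by (intro mult_le_mono) auto
  finally have "card ?C \<le> config_bound c"
    unfolding config_bound_def power2_eq_square .
  then have cC: "card (Pow ?C) \<le> 2 ^ config_bound c"
    using finC by (simp add: card_Pow)
  have "configs T ?L ` S \<subseteq> Pow ?C"
  proof (rule image_subsetI)
    fix p assume p: "p \<in> S"
    have "q \<in> states T \<and> x \<in> ?X \<and> y \<in> ?X" if q: "(q, x, y) \<in> configs T ?L p" for q x y
    proof -
      obtain i u v where *: "length x \<le> ?L" "length y \<le> ?L" "path T i u v q" "fst p = u @ x" "snd p = v @ y"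
        using q unfolding configs_def by blast
      have "u @ x \<in> lists A" "v @ y \<in> lists A" using p *(4,5) unfolding S_def by auto
      then show ?thesis using * path_states[OF T *(3)] by simp
    qed
    then have "w \<in> ?C" if "w \<in> configs T ?L p" for w
      using that by (cases w) blast
    then show "configs T ?L p \<in> Pow ?C" by blast
  qed
  moreover have "(\<lambda>(u, v). der u v ?R) p = (\<lambda>(u, v). der u v ?R) p'"
    if "p \<in> S" "p' \<in> S" "configs T ?L p = configs T ?L p'" for p p'
  proof -
    obtain u v u2 v2 where p: "p = (u, v)" "p' = (u2, v2)" by (cases p, cases p')
    have "length u = length v" "length u2 = length v2" using that unfolding p S_def by auto
    then show ?thesis
      using residual_configs[OF T c(1) lp _ _ that(3)[unfolded p]]
        residual_configs[OF T c(1) lp _ _ that(3)[unfolded p, symmetric]]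
      unfolding p by auto
  qed
  moreover have "finite (Pow ?C)" using finC by simp
  ultimately have "finite ((\<lambda>(u, v). der u v ?R) ` S) \<and> card ((\<lambda>(u, v). der u v ?R) ` S) \<le> card (Pow ?C)"
    using card_determined[where f = "configs T ?L" and D = "Pow ?C" and h = "\<lambda>(u, v). der u v ?R" and S = S]
    by blast
  moreover have "residuals A ?R = (\<lambda>(u, v). der u v ?R) ` S"
    unfolding residuals_def S_def by auto
  ultimately show ?thesis using cC by auto
qed

section \<open>Membership as reachability of configurations\<close>

definition config_step :: "('q \<times> ('a list \<times> 'b list) \<times> 'q) set \<Rightarrow>
    (('q \<times> 'a list \<times> 'b list) \<times> ('q \<times> 'a list \<times> 'b list)) set" where
  "config_step D = {((p, x @ u, y @ v), (q, u, v)) | p x y q u v. (p, (x, y), q) \<in> D}"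

lemma config_step_path:
  assumes "finite_transducer A B T"
  shows "((p, u, v), (q, [], [])) \<in> config_step (transitions T) ^^ k \<Longrightarrow> q \<in> states T \<Longrightarrow> path T p u v q"
proof (induction k arbitrary: p u v)
  case 0
  then show ?case by (auto intro: path.empty)
next
  case (Suc k)
  from relpow_Suc_D2[OF Suc.prems(1)] obtain p' u' v' where
    *: "((p, u, v), (p', u', v')) \<in> config_step (transitions T)"
       "((p', u', v'), (q, [], [])) \<in> config_step (transitions T) ^^ k" by auto
  then obtain x y where xy: "u = x @ u'" "v = y @ v'" "(p, (x, y), p') \<in> transitions T"
    unfolding config_step_def by blast
  from path.step[OF xy(3) Suc.IH[OF *(2) Suc.prems(2)]] show ?case unfolding xy(1,2) .
qed

definition suffixes_of :: "'a list \<Rightarrow> 'a list set" where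
  "suffixes_of w = (\<lambda>i. drop i w) ` {..length w}"

lemma suffixes_of_iff: "s \<in> suffixes_of w \<longleftrightarrow> (\<exists>p. w = p @ s)"
proof
  assume "s \<in> suffixes_of w"
  then show "\<exists>p. w = p @ s" unfolding suffixes_of_def by (metis append_take_drop_id imageE)
next
  assume "\<exists>p. w = p @ s"
  then obtain p where "w = p @ s" by blast
  then show "s \<in> suffixes_of w" unfolding suffixes_of_def by (intro image_eqI[of _ _ "length p"]) auto
qed

lemma suffixes_of_append: "x @ s \<in> suffixes_of w \<Longrightarrow> s \<in> suffixes_of w"
  unfolding suffixes_of_iff by (metis append.assoc)

lemma card_suffixes_of: "finite (suffixes_of w)" "card (suffixes_of w) \<le> length w + 1"
  unfolding suffixes_of_def using card_image_le[of "{..length w}" "\<lambda>i. drop i w"] by simp_all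

text \<open>Transitions with empty labels may cycle, so the lengths of the words do not bound the
  run. All its configurations hold suffixes of \<open>u\<close> and \<open>v\<close>, and
  reachability in this finite graph needs no more steps than there are edges, at most the square of
  the number of nodes.\<close>

lemma path_config_step:
  assumes T: "finite_transducer A B T" and c: "card (states T) \<le> c" and path: "path T p u v q"
  shows "\<exists>k \<le> (c * (length u + 1) * (length v + 1))\<^sup>2. ((p, u, v), (q, [], [])) \<in> config_step (transitions T) ^^ k"
proof -
  define C where "C = states T \<times> suffixes_of u \<times> suffixes_of v"
  \<comment> \<open>Restricted to suffixes of \<open>u\<close> and \<open>v\<close>, the step
    relation is finite and still contains the whole run.\<close>
  define G where "G = config_step (transitions T) \<inter> (C \<times> C)"
  have finQ: "finite (states T)" using T unfolding finite_transducer_def by blast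
  have finC: "finite C"
    unfolding C_def by (intro finite_cartesian_product finQ card_suffixes_of(1))
  have "card C = card (states T) * (card (suffixes_of u) * card (suffixes_of v))"
    unfolding C_def by (simp add: card_cartesian_product)
  also have "\<dots> \<le> c * ((length u + 1) * (length v + 1))"
    using c card_suffixes_of(2)[of u] card_suffixes_of(2)[of v] by (intro mult_le_mono)
  finally have cC: "card C \<le> c * (length u + 1) * (length v + 1)"
    by (simp only: mult.assoc)
  have finG: "finite G" using finC unfolding G_def by blast
  have "card G \<le> card (C \<times> C)" using finC unfolding G_def by (intro card_mono) auto
  also have "\<dots> = (card C)\<^sup>2" by (simp add: card_cartesian_product power2_eq_square)
  also have "\<dots> \<le> (c * (length u + 1) * (length v + 1))\<^sup>2" using cC by (rule power_mono) simp
  finally have cG: "card G \<le> (c * (length u + 1) * (length v + 1))\<^sup>2" .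
  have "path T p' u' v' q \<Longrightarrow> u' \<in> suffixes_of u \<Longrightarrow> v' \<in> suffixes_of v \<Longrightarrow>
      ((p', u', v'), (q, [], [])) \<in> G\<^sup>*" for p' u' v'
  proof (induction rule: path.induct)
    case (step p1 x y p2 u1 v1 r)
    have suf: "u1 \<in> suffixes_of u" "v1 \<in> suffixes_of v"
      using step.prems suffixes_of_append by blast+
    have "p1 \<in> states T" "p2 \<in> states T" using step.hyps(1) T unfolding finite_transducer_def by blast+
    then have "((p1, x @ u1, y @ v1), (p2, u1, v1)) \<in> G"
      using step.hyps(1) step.prems suf unfolding G_def C_def config_step_def by blast
    then show ?case using step.IH[OF suf] by (rule converse_rtrancl_into_rtrancl)
  qed simp
  moreover have "u \<in> suffixes_of u" "v \<in> suffixes_of v" unfolding suffixes_of_iff by auto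
  ultimately have "((p, u, v), (q, [], [])) \<in> G\<^sup>*" using path by blast
  then obtain k where k: "k \<le> card G" "((p, u, v), (q, [], [])) \<in> G ^^ k"
    unfolding rtrancl_finite_eq_relpow[OF finG] by blast
  have "G \<subseteq> config_step (transitions T)" unfolding G_def by blast
  then have "G ^^ k \<subseteq> config_step (transitions T) ^^ k" by (induction k) auto
  then show ?thesis using k cG by (intro exI[of _ k]) auto
qed

section \<open>The decision procedure\<close>

lemma computable_replicate [comp_intros]:
  assumes "computable n" "computable a"
  shows "computable (\<lambda>x. replicate (n x) (a x))"
proof -
  have *: "replicate n a = ((#) a ^^ n) []" for n and a :: 'b by (induction n) auto
  show ?thesis
    unfolding * by (intro comp_intros assms computable_comp[OF assms(2)])
qed

section \<open>Decoding of instances and the three tests\<close>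

definition transition_decode :: "nat \<Rightarrow> nat \<times> (nat list \<times> nat list) \<times> nat" where
  "transition_decode m = (nth0 (list_decode m) 0,
     (list_decode (nth0 (list_decode m) 1), list_decode (nth0 (list_decode m) 2)), nth0 (list_decode m) 3)"

definition alphabet_list :: "nat \<Rightarrow> nat list" where
  "alphabet_list n = bit_list (nth0 (list_decode n) 0)"

definition transition_list :: "nat \<Rightarrow> (nat \<times> (nat list \<times> nat list) \<times> nat) list" where
  "transition_list n = map transition_decode (bit_list (nth0 (list_decode n) 2))"

definition initial_list :: "nat \<Rightarrow> nat list" where
  "initial_list n = bit_list (nth0 (list_decode n) 3)"

definition final_list :: "nat \<Rightarrow> nat list" where
  "final_list n = bit_list (nth0 (list_decode n) 4)"

type_synonym config = "nat \<times> nat list \<times> nat list"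

definition fire :: "config \<Rightarrow> nat \<times> (nat list \<times> nat list) \<times> nat \<Rightarrow> config list" where
  "fire c t =
     (if fst t = fst c \<and> take (length (fst (fst (snd t)))) (fst (snd c)) = fst (fst (snd t))
         \<and> take (length (snd (fst (snd t)))) (snd (snd c)) = snd (fst (snd t))
      then [(snd (snd t), drop (length (fst (fst (snd t)))) (fst (snd c)),
             drop (length (snd (fst (snd t)))) (snd (snd c)))]
      else [])"

text \<open>Old configurations are kept, so \<open>k\<close> iterations collect everything reachable
  in at most \<open>k\<close> steps.\<close>

definition successors :: "nat \<Rightarrow> config list \<Rightarrow> config list" where
  "successors n X = X @ concat (map (\<lambda>c. concat (map (fire c) (transition_list n))) X)"

text \<open>The iteration count is the bound of \<open>path_config_step\<close>, with the code
  \<open>n\<close> in place of the number of states.\<close>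

definition related :: "nat \<Rightarrow> nat list \<Rightarrow> nat list \<Rightarrow> bool" where
  "related n u v \<longleftrightarrow>
     (\<exists>d \<in> set ((successors n ^^ (n * (length u + 1) * (length v + 1)) ^ 2)
         (map (\<lambda>p. (p, u, v)) (initial_list n))).
       (\<exists>f \<in> set (final_list n). d = (f, [], [])))"

definition words :: "nat \<Rightarrow> nat \<Rightarrow> nat list list" where
  "words n k = concat (map (\<lambda>i. List.n_lists i (alphabet_list n)) [0..<Suc k])"

text \<open>The first summand is the bound of \<open>pumpable_imp_bounded\<close> with
  \<open>2 ^ config_bound n\<close> for the number of residuals; it also covers exponents,
  separating words and prefix closure. The second is the bound of
  \<open>length_preserving_bounded\<close>.\<close>

definition size_bound :: "nat \<Rightarrow> nat" where
  "size_bound n = (2 ^ config_bound n) ^ (5 * 2 ^ config_bound n) + (2 * (n * n) + n)"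

definition lp_test :: "nat \<Rightarrow> bool" where
  "lp_test n \<longleftrightarrow> (\<forall>u \<in> set (words n (size_bound n)). \<forall>v \<in> set (words n (size_bound n)).
     related n u v \<longrightarrow> length u = length v)"

text \<open>For this test and \<open>pump_test\<close> the size bound is justified only on
  length-preserving relations; all others are already rejected by \<open>lp_test\<close>.\<close>

definition pc_test :: "nat \<Rightarrow> bool" where
  "pc_test n \<longleftrightarrow> (\<forall>u \<in> set (words n (size_bound n)). \<forall>v \<in> set (words n (size_bound n)).
     \<forall>a \<in> set (alphabet_list n). \<forall>b \<in> set (alphabet_list n).
       length u = length v \<and> related n (u @ [a]) (v @ [b]) \<longrightarrow> related n u v)"

definition separated_pair :: "nat \<Rightarrow> nat list \<Rightarrow> nat list \<Rightarrow> bool" where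
  "separated_pair n u v \<longleftrightarrow> related n u v \<and>
     (\<exists>x \<in> set (words n (size_bound n)). \<not> related n (u @ x) (v @ x))"

definition pump_test :: "nat \<Rightarrow> bool" where
  "pump_test n \<longleftrightarrow>
     (\<exists>z \<in> set (words n (size_bound n)). \<exists>s1 \<in> set (words n (size_bound n)).
      \<exists>s2 \<in> set (words n (size_bound n)). \<exists>s3 \<in> set (words n (size_bound n)).
      \<exists>t \<in> set (words n (size_bound n)).
        length s2 = length s1 \<and> length s3 = length s1 \<and>
        (\<forall>i \<in> set [0..<Suc (size_bound n)]. \<forall>a \<in> set [0..<Suc (size_bound n)].
         \<forall>b \<in> set [0..<Suc (size_bound n)].
           separated_pair n (pump1 z s1 s2 s3 t i a b) (pump2 z s1 s2 s3 t i a b)))"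

lemma computable_transition_list [comp_intros]:
  "computable f \<Longrightarrow> computable (\<lambda>x. transition_list (f x))"
  unfolding transition_list_def transition_decode_def by (intro comp_intros)

lemma computable_alphabet_list [comp_intros]:
  "computable f \<Longrightarrow> computable (\<lambda>x. alphabet_list (f x))"
  unfolding alphabet_list_def by (intro comp_intros)

lemma computable_initial_list [comp_intros]:
  "computable f \<Longrightarrow> computable (\<lambda>x. initial_list (f x))"
  unfolding initial_list_def by (intro comp_intros)

lemma computable_final_list [comp_intros]:
  "computable f \<Longrightarrow> computable (\<lambda>x. final_list (f x))"
  unfolding final_list_def by (intro comp_intros)

lemma computable_fire [comp_intros]:
  "computable f \<Longrightarrow> computable g \<Longrightarrow> computable (\<lambda>x. fire (f x) (g x))"
  unfolding fire_def by (intro comp_intros)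

lemma computable_successors [comp_intros]:
  assumes "computable f" "computable g"
  shows "computable (\<lambda>x. successors (f x) (g x))"
  unfolding successors_def by (intro comp_intros assms computable_comp[OF assms(1)])

lemma decidable_related [comp_intros]:
  assumes "computable f" "computable g" "computable h"
  shows "decidable (\<lambda>x. related (f x) (g x) (h x))"
  unfolding related_def
  by (intro comp_intros assms computable_comp[OF assms(1)] computable_comp[OF assms(2)] computable_comp[OF assms(3)])

lemma computable_words [comp_intros]:
  assumes "computable f" "computable g"
  shows "computable (\<lambda>x. words (f x) (g x))"
  unfolding words_def by (intro comp_intros assms computable_comp[OF assms(1)])

lemma computable_size_bound [comp_intros]:
  "computable f \<Longrightarrow> computable (\<lambda>x. size_bound (f x))"
  unfolding size_bound_def config_bound_def by (intro comp_intros)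

lemma decidable_separated_pair [comp_intros]:
  assumes "computable f" "computable g" "computable h"
  shows "decidable (\<lambda>x. separated_pair (f x) (g x) (h x))"
  unfolding separated_pair_def
  by (intro comp_intros assms computable_comp[OF assms(1)] computable_comp[OF assms(2)] computable_comp[OF assms(3)])

lemma decidable_tests: "decidable (\<lambda>n. lp_test n \<and> pc_test n \<and> \<not> pump_test n)"
  unfolding lp_test_def pc_test_def pump_test_def pump1_def pump2_def by (intro comp_intros)

lemma transition_decode_code: "transition_decode (transition_code t) = t"
proof -
  obtain p x y q where "t = (p, (x, y), q)" by (metis prod_cases3 surj_pair)
  then show ?thesis
    by (simp add: transition_decode_def nth0_def eval_nat_numeral del: list_encode.simps)
qed

section \<open>Codes dominate elements, lengths and cardinalities\<close>

lemma le_list_encode: "x \<in> set xs \<Longrightarrow> x \<le> list_encode xs"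
proof (induction xs)
  case (Cons a xs)
  have "a \<le> prod_encode (a, list_encode xs)" "list_encode xs \<le> prod_encode (a, list_encode xs)"
    by (rule le_prod_encode_1, rule le_prod_encode_2)
  then show ?case using Cons by auto
qed simp

lemma length_le_list_encode: "length xs \<le> list_encode xs"
proof (induction xs)
  case (Cons a xs)
  have "list_encode xs \<le> prod_encode (a, list_encode xs)" by (rule le_prod_encode_2)
  then show ?case using Cons by simp
qed simp

lemma less_set_encode: "finite S \<Longrightarrow> x \<in> S \<Longrightarrow> x < set_encode S"
proof -
  assume S: "finite S" "x \<in> S"
  have "2 ^ x \<le> (\<Sum>i\<in>S. 2 ^ i :: nat)" using S by (intro member_le_sum) auto
  moreover have "x < 2 ^ x" by (rule less_exp)
  ultimately show "x < set_encode S" unfolding set_encode_def by linarith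
qed

lemma card_le_set_encode: "finite S \<Longrightarrow> card S \<le> set_encode S"
proof -
  assume S: "finite S"
  have "S \<subseteq> {..<set_encode S}" using less_set_encode[OF S] by blast
  from card_mono[OF _ this] show ?thesis by simp
qed

lemma set_words: "set (words n k) = {w \<in> lists (set (alphabet_list n)). length w \<le> k}"
  unfolding words_def by (auto simp: set_n_lists)

lemma set_fire:
  "d \<in> set (fire c t) \<longleftrightarrow> (\<exists>p x y q u v. t = (p, (x, y), q) \<and> c = (p, x @ u, y @ v) \<and> d = (q, u, v))"
proof -
  obtain p x y q where t: "t = (p, (x, y), q)" by (metis prod_cases3 surj_pair)
  obtain p' u' v' where c: "c = (p', u', v')" by (metis prod_cases3)
  have *: "take (length x) u' = x \<longleftrightarrow> (\<exists>u. u' = x @ u)" for x u' :: "nat list"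
    by (metis append_eq_conv_conj)
  show ?thesis
    unfolding t c fire_def using *[of x u'] *[of y v'] by auto
qed

lemma set_successors:
  "set (successors n X) = set X \<union> config_step (set (transition_list n)) `` set X"
proof -
  have step: "(c, d) \<in> config_step (set (transition_list n)) \<longleftrightarrow>
      (\<exists>t \<in> set (transition_list n). d \<in> set (fire c t))" for c d
    unfolding set_fire config_step_def by blast
  have "d \<in> set (successors n X) \<longleftrightarrow>
      d \<in> set X \<or> (\<exists>c \<in> set X. \<exists>t \<in> set (transition_list n). d \<in> set (fire c t))" for d
    by (auto simp: successors_def)
  then show ?thesis unfolding step[symmetric] by blast
qed

lemma set_successors_funpow:
  "set ((successors n ^^ k) X) = {d. \<exists>j \<le> k. \<exists>c \<in> set X. (c, d) \<in> config_step (set (transition_list n)) ^^ j}"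
proof (induction k)
  case (Suc k)
  let ?S = "config_step (set (transition_list n))"
  have eq: "(\<exists>j \<le> Suc k. \<exists>c \<in> set X. (c, d) \<in> ?S ^^ j) \<longleftrightarrow>
      (\<exists>j \<le> k. \<exists>c \<in> set X. (c, d) \<in> ?S ^^ j) \<or> (\<exists>e j. j \<le> k \<and> (\<exists>c \<in> set X. (c, e) \<in> ?S ^^ j) \<and> (e, d) \<in> ?S)" for d
  proof
    assume "\<exists>j \<le> Suc k. \<exists>c \<in> set X. (c, d) \<in> ?S ^^ j"
    then obtain j c where j: "j \<le> Suc k" "c \<in> set X" "(c, d) \<in> ?S ^^ j" by blast
    show "(\<exists>j \<le> k. \<exists>c \<in> set X. (c, d) \<in> ?S ^^ j) \<or> (\<exists>e j. j \<le> k \<and> (\<exists>c \<in> set X. (c, e) \<in> ?S ^^ j) \<and> (e, d) \<in> ?S)"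
    proof (cases "j \<le> k")
      case False
      then have "j = Suc k" using j(1) by simp
      then obtain e where "(c, e) \<in> ?S ^^ k" "(e, d) \<in> ?S" using j(3) by auto
      then show ?thesis using j(2) by blast
    qed (use j in blast)
  next
    assume "(\<exists>j \<le> k. \<exists>c \<in> set X. (c, d) \<in> ?S ^^ j) \<or> (\<exists>e j. j \<le> k \<and> (\<exists>c \<in> set X. (c, e) \<in> ?S ^^ j) \<and> (e, d) \<in> ?S)"
    then show "\<exists>j \<le> Suc k. \<exists>c \<in> set X. (c, d) \<in> ?S ^^ j"
    proof
      assume "\<exists>e j. j \<le> k \<and> (\<exists>c \<in> set X. (c, e) \<in> ?S ^^ j) \<and> (e, d) \<in> ?S"
      then obtain e j c where "j \<le> k" "c \<in> set X" "(c, e) \<in> ?S ^^ j" "(e, d) \<in> ?S" by blast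
      then show ?thesis by (intro exI[of _ "Suc j"]) auto
    qed (meson le_SucI)
  qed
  have "d \<in> set ((successors n ^^ Suc k) X) \<longleftrightarrow> (\<exists>j \<le> Suc k. \<exists>c \<in> set X. (c, d) \<in> ?S ^^ j)" for d
    unfolding eq funpow.simps(2) comp_apply set_successors Suc by blast
  then show ?case by blast
qed simp

section \<open>Correctness on coded instances\<close>

locale instance_code =
  fixes A :: "nat set" and T :: "(nat, nat, nat) transducer" and n :: nat
  assumes T: "finite_transducer A A T" and equiv_T: "equiv (lists A) (realized_relation T)"
    and n: "n = transducer_code (A, T)"
begin

lemma fin: "finite A" "finite (states T)" "finite (transitions T)" "finite (initials T)" "finite (finals T)"
  using T by (auto simp: finite_transducer_def intro: finite_subset)

lemma decoded:
  "set (alphabet_list n) = A" "set (transition_list n) = transitions T"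
  "set (initial_list n) = initials T" "set (final_list n) = finals T"
proof -
  have l: "list_decode n = [set_encode A, set_encode (states T), set_encode (transition_code ` transitions T),
       set_encode (initials T), set_encode (finals T)]"
    unfolding n by (simp del: list_encode.simps)
  show "set (alphabet_list n) = A" "set (initial_list n) = initials T" "set (final_list n) = finals T"
    unfolding alphabet_list_def initial_list_def final_list_def set_bit_list l
    using fin by (simp_all add: nth0_def eval_nat_numeral)
  have "set (transition_list n) = transition_decode ` transition_code ` transitions T"
    unfolding transition_list_def set_map set_bit_list l using fin by (simp add: nth0_def eval_nat_numeral)
  then show "set (transition_list n) = transitions T"
    unfolding image_image transition_decode_code by simp
qed

lemma le_n: "set_encode A \<le> n" "set_encode (states T) \<le> n"
    "set_encode (transition_code ` transitions T) \<le> n"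
  unfolding n transducer_code.simps by (rule le_list_encode; simp)+

lemma card_A: "card A \<le> n"
  using card_le_set_encode[OF fin(1)] le_n(1) by linarith

lemma label_bound: "label_bound n T"
proof -
  have "card (transition_code ` transitions T) = card (transitions T)"
    by (intro card_image inj_on_subset[OF inj_transition_code]) simp
  then have "card (transitions T) \<le> n"
    using card_le_set_encode[of "transition_code ` transitions T"] fin(3) le_n(3) by simp
  moreover have "card (states T) \<le> n"
    using card_le_set_encode[OF fin(2)] le_n(2) by linarith
  moreover have "length x \<le> n \<and> length y \<le> n" if t: "(p, (x, y), q) \<in> transitions T" for p x y q
  proof -
    let ?t = "transition_code (p, (x, y), q)"
    have "?t < set_encode (transition_code ` transitions T)"
      by (rule less_set_encode) (use t fin in blast)+
    moreover have "list_encode x \<le> ?t" "list_encode y \<le> ?t"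
      unfolding transition_code.simps by (rule le_list_encode; simp)+
    ultimately show ?thesis
      using length_le_list_encode[of x] length_le_list_encode[of y] le_n(3) by linarith
  qed
  ultimately show ?thesis unfolding label_bound_def by blast
qed

lemma related_iff: "related n u v \<longleftrightarrow> (u, v) \<in> realized_relation T"
proof
  assume "related n u v"
  then obtain f j p where f: "f \<in> finals T" "p \<in> initials T"
    "((p, u, v), (f, [], [])) \<in> config_step (transitions T) ^^ j"
    unfolding related_def set_successors_funpow decoded by (auto simp: decoded)
  have "f \<in> states T" using f(1) T unfolding finite_transducer_def by blast
  from config_step_path[OF T f(3) this] show "(u, v) \<in> realized_relation T"
    using realized_relationI f by metis
next
  assume "(u, v) \<in> realized_relation T"
  then obtain p f where p: "p \<in> initials T" "f \<in> finals T" "path T p u v f"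
    unfolding realized_relation_def by blast
  have "card (states T) \<le> n" using label_bound unfolding label_bound_def by blast
  from path_config_step[OF T this p(3)] obtain k where
    "k \<le> (n * (length u + 1) * (length v + 1))\<^sup>2"
    "((p, u, v), (f, [], [])) \<in> config_step (transitions T) ^^ k" by blast
  moreover have "(p, u, v) \<in> set (map (\<lambda>p. (p, u, v)) (initial_list n))"
    using p(1) decoded by simp
  ultimately show "related n u v"
    unfolding related_def set_successors_funpow decoded using p(2) by blast
qed

lemma lp_test_iff: "lp_test n \<longleftrightarrow> length_preserving (realized_relation T)"
proof
  assume test: "lp_test n"
  show "length_preserving (realized_relation T)"
  proof (rule length_preserving_bounded[OF T label_bound])
    fix u v assume uv: "(u, v) \<in> realized_relation T"
      "length u \<le> 2 * (n * n) + n" "length v \<le> 2 * (n * n) + n"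
    then have "u \<in> lists A" "v \<in> lists A" using equiv_type[OF equiv_T] by blast+
    moreover have "length u \<le> size_bound n" "length v \<le> size_bound n"
      using uv(2,3) unfolding size_bound_def by linarith+
    ultimately have "u \<in> set (words n (size_bound n))" "v \<in> set (words n (size_bound n))"
      unfolding set_words decoded by blast+
    then show "length u = length v" using test uv(1) unfolding lp_test_def related_iff by blast
  qed
next
  assume "length_preserving (realized_relation T)"
  then show "lp_test n" unfolding lp_test_def related_iff length_preserving_def by blast
qed

theorem tests_correct:
  "lp_test n \<and> pc_test n \<and> \<not> pump_test n \<longleftrightarrow> realized_relation T \<in> KerSeq_ll A"
proof (cases "length_preserving (realized_relation T)")
  \<comment> \<open>Both sides are false here, whatever the other two tests answer.\<close>
  case False
  then show ?thesis using lp_test_iff KerSeq_ll_imp(1) by blast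
next
  case lp: True
  let ?R = "realized_relation T" and ?N = "size_bound n"
  let ?M = "2 ^ config_bound n :: nat"
  interpret ordered_candidate A ?R
    using fin(1) equiv_T lp by unfold_locales
  let ?P = "residuals A ?R"
  have P: "finite ?P" "card ?P \<le> ?M"
    using card_residuals_bound[OF T label_bound card_A lp] by blast+
  have P1: "1 \<le> card ?P" using P(1) R_in_residuals by (auto simp: Suc_le_eq card_gt_0_iff)
  \<comment> \<open>The unknown number of residuals is replaced by its computable bound, first in
    the base and then in the exponent.\<close>
  have "card ?P ^ (5 * card ?P) \<le> ?M ^ (5 * card ?P)" using P(2) by (intro power_mono) auto
  also have "\<dots> \<le> ?M ^ (5 * ?M)" using P(2) by (intro power_increasing) auto
  finally have N: "card ?P ^ (5 * card ?P) \<le> ?N" unfolding size_bound_def by linarith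
  have "card ?P ^ 1 \<le> card ?P ^ (5 * card ?P)" using P1 by (intro power_increasing) auto
  then have PN: "card ?P \<le> ?N" using N by simp
  note W = set_words[of n ?N, unfolded decoded]
  have pc: "pc_test n \<longleftrightarrow> prefix_closed ?R"
  proof
    assume test: "pc_test n"
    show "prefix_closed ?R"
    proof (rule prefix_closed_bounded[OF P(1) PN])
      fix u v a b assume uv: "u \<in> lists A" "v \<in> lists A" "length u \<le> ?N" "length v \<le> ?N"
        "length u = length v" "(u @ [a], v @ [b]) \<in> ?R"
      then have "a \<in> A" "b \<in> A" using R_lists[OF uv(6)] by auto
      moreover have "u \<in> set (words n ?N)" "v \<in> set (words n ?N)" unfolding W using uv by blast+
      ultimately show "(u, v) \<in> ?R"
        using test uv(5,6) unfolding pc_test_def related_iff decoded by blast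
    qed
  next
    assume "prefix_closed ?R"
    then show "pc_test n" unfolding pc_test_def related_iff prefix_closed_def by blast
  qed
  have bp: "bounded_pumpable ?N A ?R z s1 s2 s3 t \<longleftrightarrow> length s2 = length s1 \<and> length s3 = length s1 \<and>
        (\<forall>i \<in> set [0..<Suc ?N]. \<forall>a \<in> set [0..<Suc ?N]. \<forall>b \<in> set [0..<Suc ?N].
           separated_pair n (pump1 z s1 s2 s3 t i a b) (pump2 z s1 s2 s3 t i a b))" for z s1 s2 s3 t
  proof -
    have range: "set [0..<Suc ?N] = {..?N}" by auto
    show ?thesis
      unfolding bounded_pumpable_def separated_pair_def related_iff W range by blast
  qed
  have "pump_test n \<longleftrightarrow> (\<exists>z \<in> lists A. \<exists>s1 \<in> lists A. \<exists>s2 \<in> lists A. \<exists>s3 \<in> lists A. \<exists>t \<in> lists A.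
      pumpable A ?R z s1 s2 s3 t)"
  proof
    assume "pump_test n"
    then obtain z s1 s2 s3 t where l: "z \<in> lists A" "s1 \<in> lists A" "s2 \<in> lists A" "s3 \<in> lists A" "t \<in> lists A"
      and "bounded_pumpable ?N A ?R z s1 s2 s3 t"
      unfolding pump_test_def bp[symmetric] W by blast
    then have "pumpable A ?R z s1 s2 s3 t"
      using bounded_pumpable_imp_pumpable[OF P(1) PN l(1-4)] by blast
    then show "\<exists>z \<in> lists A. \<exists>s1 \<in> lists A. \<exists>s2 \<in> lists A. \<exists>s3 \<in> lists A. \<exists>t \<in> lists A.
      pumpable A ?R z s1 s2 s3 t" using l by blast
  next
    assume "\<exists>z \<in> lists A. \<exists>s1 \<in> lists A. \<exists>s2 \<in> lists A. \<exists>s3 \<in> lists A. \<exists>t \<in> lists A.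
      pumpable A ?R z s1 s2 s3 t"
    then obtain z s1 s2 s3 t where l: "z \<in> lists A" "s1 \<in> lists A" "s2 \<in> lists A" "s3 \<in> lists A" "t \<in> lists A"
      and pump: "pumpable A ?R z s1 s2 s3 t" by blast
    from pumpable_imp_bounded[OF P(1) N l pump] obtain z' s1' s2' s3' t' where
      "z' \<in> lists A" "s1' \<in> lists A" "s2' \<in> lists A" "s3' \<in> lists A" "t' \<in> lists A"
      "length z' \<le> ?N" "length s1' \<le> ?N" "length s2' \<le> ?N" "length s3' \<le> ?N" "length t' \<le> ?N"
      "bounded_pumpable ?N A ?R z' s1' s2' s3' t'" .
    then show "pump_test n" unfolding pump_test_def bp[symmetric] W by blast
  qed
  then show ?thesis using lp lp_test_iff pc KerSeq_ll_iff[OF P(1)] by blast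
qed

end

theorem theorem8:
  shows "decidable_problem transducer_code
    {(A, R). finite_transducer A A R \<and> equiv (lists A) (realized_relation R)}
    {(A, R). realized_relation R \<in> KerSeq_ll A}"
proof -
  obtain g where g: "\<And>n. computes g [n] (if lp_test n \<and> pc_test n \<and> \<not> pump_test n then 1 else 0)"
    using decidable_computes[OF decidable_tests] by blast
  have "computes g [transducer_code (A, T)] (if realized_relation T \<in> KerSeq_ll A then 1 else 0)"
    if "finite_transducer A A T" "equiv (lists A) (realized_relation T)" for A T
  proof -
    interpret instance_code A T "transducer_code (A, T)" using that by unfold_locales simp_all
    show ?thesis using g[of "transducer_code (A, T)"] unfolding tests_correct .
  qed
  then show ?thesis unfolding decidable_problem_def by (intro exI[of _ g]) auto
qed

end
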